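(* Let $p$ be a prime, let $k\geq 3$ be an integer, let $0<\varepsilon<1$ and set $\delta=\varepsilon^{C_{p,k}}$. Then for every $n\geq 1$ and any sets $X_1,\dots,X_k\subseteq \mathbb{F}_p^{n}$, at least one of the following holds: (a) the number of $k$-cycles $(x_1,\dots,x_k)\in X_1\times\dots\times X_k$ is at least $\delta N^{k-1}$; or (b) one can delete fewer than $\varepsilon N$ elements from each of the sets $X_1,\dots,X_k$ so that afterwards no $k$-cycles remain in $X_1\times\dots\times X_k$.
   Context: Let $p$ be a fixed prime, $n\geq 1$, and $N=p^n=|\mathbb{F}_p^n|$. For sets $X_1,\dots,X_k\subseteq\mathbb{F}_p^n$, a $k$-cycle is a $k$-tuple $(x_1,\dots,x_k)\in X_1\times\dots\times X_k$ with $x_1+\dots+x_k=0$. Define the constant $0<c_{p,3}<1$ by $\inf_{0<t<1}\frac{t^0+t^1+\dots+t^{p-1}}{t^{(p-1)/3}}=p^{1-c_{p,3}}$, set $C_{p,3}=1+\frac{1}{c_{p,3}}$, and for $k\geq 3$ set $C_{p,k}=(k-2)(C_{p,3}-1)+1=\frac{k-2}{c_{p,3}}+1$. *)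

theory Defs
  imports "HOL-Analysis.Analysis" "HOL-Library.FuncSet"
begin

text \<open>The vector space F_p^n is modelled as functions nat => nat that take values
 in {0..<p} on coordinates 0..n-1 and vanish elsewhere; addition is coordinatewise mod p.\<close>

definition Fpn :: "nat \<Rightarrow> nat \<Rightarrow> (nat \<Rightarrow> nat) set" where
  "Fpn p n = {x. (\<forall>i<n. x i < p) \<and> (\<forall>i. n \<le> i \<longrightarrow> x i = 0)}"

definition sums_to_zero :: "nat \<Rightarrow> nat \<Rightarrow> (nat \<Rightarrow> nat \<Rightarrow> nat) \<Rightarrow> bool" where
  "sums_to_zero p k xs \<longleftrightarrow> (\<forall>i. (\<Sum>j<k. xs j i) mod p = 0)"

definition k_cycles :: "nat \<Rightarrow> nat \<Rightarrow> (nat \<Rightarrow> (nat \<Rightarrow> nat) set) \<Rightarrow> (nat \<Rightarrow> nat \<Rightarrow> nat) set" where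
  "k_cycles p k X = {xs \<in> Pi\<^sub>E {..<k} X. sums_to_zero p k xs}"

definition c_p3 :: "nat \<Rightarrow> real" where
  "c_p3 p = 1 - log (real p)
     (INF t\<in>{0<..<1::real}. (\<Sum>i<p. t ^ i) / t powr ((real p - 1) / 3))"

definition C_p3 :: "nat \<Rightarrow> real" where
  "C_p3 p = 1 + 1 / c_p3 p"

definition C_pk :: "nat \<Rightarrow> nat \<Rightarrow> real" where
  "C_pk p k = (real k - 2) * (C_p3 p - 1) + 1"

end

theory Submission
  imports Defs "HOL-Number_Theory.Residues"
begin

text \<open>Suppose that the cycles cannot be destroyed by few deletions, so that there are \<open>m \<ge> \<epsilon>N\<close> pairwise
  disjoint cycles. With \<open>\<theta> = (k - 2) / c\<close> the claim becomes \<open>T \<ge> m\<^sup>1\<^sup>+\<^sup>\<theta> N\<^sup>k\<^sup>-\<^sup>2\<^sup>-\<^sup>\<theta>\<close> for the number \<open>T\<close> of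
  cycles. Deleting vertices of maximum degree greedily reduces this, up to a constant factor, to a
  lower bound on the maximum degree, and passing to Cartesian powers removes the constant.

  For \<open>k = 3\<close>, pull the sets back along a random affine map from a space of size about \<open>N\<close> divided by
  the maximum degree. A positive proportion of the surviving triangles is isolated, and isolated
  triangles form a tricolored sum-free set, whose size the slice rank method bounds.

  For \<open>k > 3\<close>, an entropy argument finds coordinates \<open>a\<close>, \<open>b\<close> for which \<open>x\<^sub>a + x\<^sub>b\<close> takes many values on
  the cycles, hence many disjoint cycles on which these sums are distinct. Replacing \<open>x\<^sub>a\<close> and \<open>x\<^sub>b\<close> by
  their sum splits a cycle into a triangle and a \<open>(k - 1)\<close>-cycle; by induction most of the sums
  extend in many ways on both sides.\<close>
section \<open>Slice rank modulo a prime\<close>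

text \<open>The exponent comes from triangles. If every vertex lies in at most D of T triangles, a
  random pullback to a space of size M of order N / D still consists largely of isolated ones, so T
  (M / N)^2 is at most of order M powr (1 - c). Up to constants this is D powr (1 + \<theta>) >= T
  powr \<theta> * N powr (1 - \<theta>) with \<theta> = 1 / c. Longer cycles are split into k - 2
  triangles, whose exponents add up, hence (k - 2) / c.

  Two kinds of estimate feed each other: splitting a cycle needs counts of the cycles spanned by
  disjoint families, but returns a bound on degrees, which greedy deletion converts back. Each round
  loses a factor; these losses are affordable because they never depend on the dimension.

  Coordinates are indexed by arbitrary finite sets rather than initial segments because these sets
  change: the slice rank argument uses vectors indexed by the sum-free set, sampling uses a second
  smaller space, the induction drops a member of \<open>J\<close>, and Cartesian powers replace
  \<open>I\<close> by a product.\<close>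

definition modvec :: "nat \<Rightarrow> 'i set \<Rightarrow> ('i \<Rightarrow> nat) set" where
  "modvec p I = {x. (\<forall>i\<in>I. x i < p) \<and> (\<forall>i. i \<notin> I \<longrightarrow> x i = 0)}"

lemma modvec_bij: "bij_betw (\<lambda>x. restrict x I) (modvec p I) (PiE I (\<lambda>_. {..<p}))"
proof (rule bij_betw_byWitness[where f' = "\<lambda>x i. if i \<in> I then x i else 0"])
  show "\<forall>x\<in>modvec p I. (\<lambda>i. if i \<in> I then restrict x I i else 0) = x"
    by (auto simp: modvec_def)
  show "\<forall>x\<in>PiE I (\<lambda>_. {..<p}). restrict (\<lambda>i. if i \<in> I then x i else 0) I = x"
    by (auto simp: PiE_def extensional_def restrict_def fun_eq_iff)
qed (auto simp: modvec_def PiE_def Pi_def)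

lemma
  assumes "finite I"
  shows finite_modvec: "finite (modvec p I)" and card_modvec: "card (modvec p I) = p ^ card I"
proof -
  have "finite (PiE I (\<lambda>_. {..<p}))" using assms by (auto intro!: finite_PiE)
  thus "finite (modvec p I)" using modvec_bij[of I p] bij_betw_finite by blast
  show "card (modvec p I) = p ^ card I"
    using bij_betw_same_card[OF modvec_bij[of I p]] card_PiE[OF assms, of "\<lambda>_. {..<p}"] by simp
qed

lemma nat_mod_eq_iff_dvd: "0 < p \<Longrightarrow> nat (a mod int p) = nat (b mod int p) \<longleftrightarrow> int p dvd a - b"
  by (simp add: eq_nat_nat_iff mod_eq_dvd_iff)

text \<open>Rank-nullity by counting: the residues of the \<open>card R\<close> linear forms take at
  most \<open>p ^ card R\<close> values, and vectors with equal residues differ by an element of the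
  kernel, so no fibre is larger than the kernel.\<close>

lemma card_kernel_ge:
  fixes M :: "'r \<Rightarrow> 's \<Rightarrow> int"
  assumes p: "0 < p" and S: "finite S" and R: "finite R"
  shows "p ^ card S \<le> card {v \<in> modvec p S. \<forall>r\<in>R. int p dvd (\<Sum>i\<in>S. int (v i) * M r i)} * p ^ card R"
proof -
  define K where "K = {v \<in> modvec p S. \<forall>r\<in>R. int p dvd (\<Sum>i\<in>S. int (v i) * M r i)}"
  define \<Psi> where "\<Psi> v = (\<lambda>r. if r \<in> R then nat ((\<Sum>i\<in>S. int (v i) * M r i) mod int p) else 0)" for v
  have \<Psi>: "\<Psi> ` modvec p S \<subseteq> modvec p R"
    using p by (auto simp: \<Psi>_def modvec_def nat_less_iff)
  have fiber: "card {v \<in> modvec p S. \<Psi> v = y} \<le> card K" for y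
  proof (cases "\<exists>v0\<in>modvec p S. \<Psi> v0 = y")
    case False
    hence "{v \<in> modvec p S. \<Psi> v = y} = {}" by auto
    thus ?thesis by (metis card.empty zero_le)
  next
    case True
    then obtain v0 where v0: "v0 \<in> modvec p S" "\<Psi> v0 = y" by blast
    define d where "d v = (\<lambda>i. nat ((int (v i) - int (v0 i)) mod int p))" for v
    have "inj_on d {v \<in> modvec p S. \<Psi> v = y}"
    proof (rule inj_onI)
      fix v w assume v: "v \<in> {v \<in> modvec p S. \<Psi> v = y}" and w: "w \<in> {v \<in> modvec p S. \<Psi> v = y}"
        and eq: "d v = d w"
      show "v = w"
      proof
        fix i
        have "d v i = d w i" using eq by simp
        hence "int p dvd int (v i) - int (w i)"
          unfolding d_def using nat_mod_eq_iff_dvd[OF p] by auto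
        hence c: "v i mod p = w i mod p"
          by (simp add: mod_eq_dvd_iff[symmetric] zmod_int[symmetric])
        show "v i = w i" using c v w by (cases "i \<in> S") (auto simp: modvec_def)
      qed
    qed
    moreover have "d ` {v \<in> modvec p S. \<Psi> v = y} \<subseteq> K"
    proof
      fix u assume "u \<in> d ` {v \<in> modvec p S. \<Psi> v = y}"
      then obtain v where v: "v \<in> modvec p S" "\<Psi> v = y" and u: "u = d v" by auto
      have "d v \<in> modvec p S" using v v0 p by (auto simp: modvec_def d_def nat_less_iff)
      moreover have "int p dvd (\<Sum>i\<in>S. int (d v i) * M r i)" if r: "r \<in> R" for r
      proof -
        have "\<Psi> v r = \<Psi> v0 r" using v v0 by simp
        hence "int p dvd (\<Sum>i\<in>S. int (v i) * M r i) - (\<Sum>i\<in>S. int (v0 i) * M r i)"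
          using r nat_mod_eq_iff_dvd[OF p] by (simp add: \<Psi>_def)
        hence 1: "int p dvd (\<Sum>i\<in>S. (int (v i) - int (v0 i)) * M r i)"
          by (simp add: left_diff_distrib sum_subtractf)
        have "int p dvd (\<Sum>i\<in>S. (int (v i) - int (v0 i)) * M r i) - (\<Sum>i\<in>S. int (d v i) * M r i)"
          unfolding sum_subtractf[symmetric] left_diff_distrib[symmetric]
          using p by (intro dvd_sum dvd_mult2) (simp add: d_def)
        from dvd_diff[OF 1 this] show ?thesis by simp
      qed
      ultimately show "u \<in> K" using u by (auto simp: K_def)
    qed
    ultimately show ?thesis
      by (rule card_inj_on_le) (simp add: K_def finite_modvec S)
  qed
  have "p ^ card S = card (modvec p S)" by (simp add: card_modvec S)
  also have "\<dots> = (\<Sum>y\<in>modvec p R. card {v \<in> modvec p S. \<Psi> v = y})"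
    using sum.group[OF finite_modvec[OF S] finite_modvec[OF R] \<Psi>, of "\<lambda>_. 1::nat"] by simp
  also have "\<dots> \<le> (\<Sum>y\<in>modvec p R. card K)" by (intro sum_mono fiber)
  also have "\<dots> = card K * p ^ card R" by (simp add: card_modvec R)
  finally show ?thesis by (simp add: K_def)
qed

lemma ex_max_on:
  fixes f :: "'a \<Rightarrow> 'b::linorder"
  assumes "finite A" "A \<noteq> {}"
  shows "\<exists>x\<in>A. \<forall>y\<in>A. f y \<le> f x"
proof -
  have "Max (f ` A) \<in> f ` A" using assms by (intro Max_in) auto
  then obtain x where "x \<in> A" "f x = Max (f ` A)" by auto
  hence "\<forall>y\<in>A. f y \<le> f x" using assms by simp
  thus ?thesis using \<open>x \<in> A\<close> by blast
qed

text \<open>A kernel vector of maximal support works. If it vanished on more than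
  \<open>card R\<close> indices, counting on these indices alone would give a nonzero kernel vector
  supported there, and adding it would enlarge the support.\<close>

lemma ex_kernel_large_support:
  fixes M :: "'r \<Rightarrow> 's \<Rightarrow> int"
  assumes p: "1 < p" and S: "finite S" and R: "finite R"
  obtains v where "v \<in> modvec p S" "\<forall>r\<in>R. int p dvd (\<Sum>i\<in>S. int (v i) * M r i)"
    "card S \<le> card {i \<in> S. v i \<noteq> 0} + card R"
proof -
  define K where "K = {v \<in> modvec p S. \<forall>r\<in>R. int p dvd (\<Sum>i\<in>S. int (v i) * M r i)}"
  have K: "finite K" "(\<lambda>_. 0) \<in> K" unfolding K_def
    using p by (auto intro!: finite_subset[OF _ finite_modvec[OF S, of p]]) (auto simp: modvec_def)
  obtain v where v: "v \<in> K" and max: "\<And>w. w \<in> K \<Longrightarrow> card {i \<in> S. w i \<noteq> 0} \<le> card {i \<in> S. v i \<noteq> 0}"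
  proof -
    have "K \<noteq> {}" using K(2) by auto
    from ex_max_on[OF K(1) this, of "\<lambda>v. card {i \<in> S. v i \<noteq> 0}"] show thesis
      by (elim bexE) (rule that, assumption, drule bspec)
  qed
  have "card S \<le> card {i \<in> S. v i \<noteq> 0} + card R"
  proof (rule ccontr)
    assume neg: "\<not> ?thesis"
    define S' where "S' = {i \<in> S. v i = 0}"
    have S': "finite S'" "S' \<subseteq> S" using S by (auto simp: S'_def)
    have "S' = S - {i \<in> S. v i \<noteq> 0}" by (auto simp: S'_def)
    hence "card S' = card S - card {i \<in> S. v i \<noteq> 0}" using S by (simp add: card_Diff_subset)
    hence less: "card R < card S'" using neg by linarith
    define K' where "K' = {w \<in> modvec p S'. \<forall>r\<in>R. int p dvd (\<Sum>i\<in>S'. int (w i) * M r i)}"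
    have "p ^ card R < p ^ card S'" using less p by simp
    also have "\<dots> \<le> card K' * p ^ card R"
      using card_kernel_ge[of p S' R M] p S' R by (simp add: K'_def)
    finally have "1 < card K'" by simp
    hence "\<not> K' \<subseteq> {\<lambda>_. 0}"
      using card_mono[of "{\<lambda>_. 0}" K'] by auto
    then obtain w where w: "w \<in> K'" "w \<noteq> (\<lambda>_. 0)" by blast
    then obtain i0 where i0: "w i0 \<noteq> 0" by auto
    have wS: "w i = 0" if "i \<notin> S'" for i using w that by (auto simp: K'_def modvec_def)
    have i0S: "i0 \<in> S'" using wS[of i0] i0 by auto
    \<comment> \<open>The supports of \<open>v\<close> and \<open>w\<close> are disjoint, so the
      plain sum already has entries below \<open>p\<close>.\<close>
    define u where "u = (\<lambda>i. v i + w i)"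
    have "u \<in> modvec p S"
    proof -
      have "v i + w i < p" if "i \<in> S" for i
        using that v w wS[of i] by (cases "i \<in> S'") (auto simp: K_def K'_def modvec_def S'_def)
      moreover have "v i + w i = 0" if "i \<notin> S" for i
        using that v wS[of i] S' by (auto simp: K_def modvec_def)
      ultimately show ?thesis by (auto simp: u_def modvec_def)
    qed
    moreover have "int p dvd (\<Sum>i\<in>S. int (u i) * M r i)" if r: "r \<in> R" for r
    proof -
      have "(\<Sum>i\<in>S. int (u i) * M r i) = (\<Sum>i\<in>S. int (v i) * M r i) + (\<Sum>i\<in>S. int (w i) * M r i)"
        by (simp add: u_def distrib_right sum.distrib)
      also have "(\<Sum>i\<in>S. int (w i) * M r i) = (\<Sum>i\<in>S'. int (w i) * M r i)"
        by (rule sum.mono_neutral_right) (use S S' wS in auto)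
      finally show ?thesis using v w r by (auto simp: K_def K'_def)
    qed
    ultimately have "u \<in> K" by (simp add: K_def)
    from max[OF this] have le: "card {i \<in> S. u i \<noteq> 0} \<le> card {i \<in> S. v i \<noteq> 0}" .
    have "i0 \<in> {i \<in> S. u i \<noteq> 0}" "i0 \<notin> {i \<in> S. v i \<noteq> 0}"
      using i0 i0S by (auto simp: u_def S'_def)
    moreover have "{i \<in> S. v i \<noteq> 0} \<subseteq> {i \<in> S. u i \<noteq> 0}" by (auto simp: u_def)
    ultimately have "{i \<in> S. v i \<noteq> 0} \<subset> {i \<in> S. u i \<noteq> 0}" by blast
    hence "card {i \<in> S. v i \<noteq> 0} < card {i \<in> S. u i \<noteq> 0}"
      using S by (intro psubset_card_mono) auto
    with le show False by simp
  qed
  with v show thesis by (intro that[of v]) (auto simp: K_def)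
qed

lemma dvd_sum_diff:
  fixes f g :: "'a \<Rightarrow> 'b::comm_ring_1"
  assumes "\<And>x. x \<in> A \<Longrightarrow> d dvd f x - g x"
  shows "d dvd sum f A - sum g A"
  unfolding sum_subtractf[symmetric] using assms by (rule dvd_sum)

text \<open>Ranks over the field with \<open>p\<close> elements are replaced by counting: contracting with a vector of
  large support that kills the third sum leaves a large diagonal matrix of rank at most \<open>2 * card R\<close>.\<close>

lemma card_diagonal_le_slice_rank:
  fixes \<phi> \<psi> \<xi> :: "'r \<Rightarrow> 's \<Rightarrow> int" and f g h :: "'r \<Rightarrow> 's \<Rightarrow> 's \<Rightarrow> int" and F :: "'s \<Rightarrow> 's \<Rightarrow> 's \<Rightarrow> int"
  assumes p: "prime p" and S: "finite S" and R: "finite R"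
    and off: "\<And>i j k. \<lbrakk>i \<in> S; j \<in> S; k \<in> S; \<not> (i = j \<and> j = k)\<rbrakk> \<Longrightarrow> int p dvd F i j k"
    and diag: "\<And>i. i \<in> S \<Longrightarrow> int p dvd F i i i - 1"
    and F: "\<And>i j k. \<lbrakk>i \<in> S; j \<in> S; k \<in> S\<rbrakk> \<Longrightarrow> F i j k =
      (\<Sum>r\<in>R. \<phi> r i * f r j k) + (\<Sum>r\<in>R. \<psi> r j * g r i k) + (\<Sum>r\<in>R. \<xi> r k * h r i j)"
  shows "card S \<le> 3 * card R"
proof -
  have p0: "0 < p" "1 < p" using p prime_gt_0_nat prime_gt_1_nat by blast+
  obtain v where v: "v \<in> modvec p S" and vk: "\<forall>r\<in>R. int p dvd (\<Sum>i\<in>S. int (v i) * \<xi> r i)"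
    and vs: "card S \<le> card {i \<in> S. v i \<noteq> 0} + card R"
    using ex_kernel_large_support[OF p0(2) S R] by blast
  define S1 where "S1 = {i \<in> S. v i \<noteq> 0}"
  have S1: "finite S1" "S1 \<subseteq> S" using S by (auto simp: S1_def)
  \<comment> \<open>Contracting \<open>F\<close> with \<open>u\<close> in the first index and
    \<open>v\<close> in the third kills the \<open>\<phi>\<close> slices and the
    \<open>\<xi>\<close> slices. Since \<open>F\<close> is diagonal, the contraction is
    \<open>u j * v j\<close> modulo \<open>p\<close>, and \<open>key\<close> expresses it through
    the \<open>card R\<close> residues recorded in \<open>b u\<close>.\<close>
  define U where "U = {u \<in> modvec p S1. \<forall>r\<in>R. int p dvd (\<Sum>i\<in>S1. int (u i) * \<phi> r i)}"
  define b where "b u r = (if r \<in> R then nat ((\<Sum>i\<in>S1. \<Sum>k\<in>S. int (u i) * int (v k) * g r i k) mod int p) else 0)" for u r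
  have key: "int p dvd int (u j) * int (v j) - (\<Sum>r\<in>R. \<psi> r j * (\<Sum>i\<in>S1. \<Sum>k\<in>S. int (u i) * int (v k) * g r i k))"
    if u: "u \<in> U" and j: "j \<in> S1" for u j
  proof -
    have jS: "j \<in> S" using j S1 by auto
    have "int p dvd (\<Sum>i\<in>S1. \<Sum>k\<in>S. int (u i) * int (v k) * F i j k) -
        (\<Sum>i\<in>S1. \<Sum>k\<in>S. (if i = j \<and> k = j then int (u j) * int (v j) else 0))"
    proof (intro dvd_sum_diff)
      fix i k assume ik: "i \<in> S1" "k \<in> S"
      show "int p dvd int (u i) * int (v k) * F i j k - (if i = j \<and> k = j then int (u j) * int (v j) else 0)"
      proof (cases "i = j \<and> k = j")
        case True
        have "int p dvd int (u j) * int (v j) * (F j j j - 1)" using diag[OF jS] by simp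
        thus ?thesis using True by (simp add: right_diff_distrib)
      next
        case False
        hence "int p dvd F i j k" using off[of i j k] ik jS S1 by auto
        thus ?thesis using False by auto
      qed
    qed
    also have "(\<Sum>i\<in>S1. \<Sum>k\<in>S. (if i = j \<and> k = j then int (u j) * int (v j) else 0)) =
       (\<Sum>i\<in>S1. if i = j then (\<Sum>k\<in>S. (if k = j then int (u j) * int (v j) else 0)) else 0)"
      by (intro sum.cong) auto
    also have "\<dots> = int (u j) * int (v j)"
      using S S1 j jS by (simp add: sum.delta)
    finally have 1: "int p dvd (\<Sum>i\<in>S1. \<Sum>k\<in>S. int (u i) * int (v k) * F i j k) - int (u j) * int (v j)" .
    have "(\<Sum>i\<in>S1. \<Sum>k\<in>S. int (u i) * int (v k) * F i j k) =
       (\<Sum>i\<in>S1. \<Sum>k\<in>S. \<Sum>r\<in>R. int (u i) * int (v k) * (\<phi> r i * f r j k)) +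
       (\<Sum>i\<in>S1. \<Sum>k\<in>S. \<Sum>r\<in>R. int (u i) * int (v k) * (\<psi> r j * g r i k)) +
       (\<Sum>i\<in>S1. \<Sum>k\<in>S. \<Sum>r\<in>R. int (u i) * int (v k) * (\<xi> r k * h r i j))" (is "_ = ?A + ?B + ?C")
      using S1 jS unfolding sum.distrib[symmetric]
      by (intro sum.cong refl) (auto simp: F sum_distrib_left sum.distrib distrib_left subset_iff)
    moreover have "?A = (\<Sum>k\<in>S. \<Sum>r\<in>R. int (v k) * f r j k * (\<Sum>i\<in>S1. int (u i) * \<phi> r i))"
      unfolding sum_distrib_left
      by (subst sum.swap, rule sum.cong[OF refl], subst sum.swap) (simp add: mult_ac)
    hence "int p dvd ?A" using u by (auto simp: U_def intro!: dvd_sum)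
    moreover have "?C = (\<Sum>i\<in>S1. \<Sum>r\<in>R. int (u i) * h r i j * (\<Sum>k\<in>S. int (v k) * \<xi> r k))"
      unfolding sum_distrib_left
      by (rule sum.cong[OF refl], subst sum.swap) (simp add: mult_ac)
    hence "int p dvd ?C" using vk by (auto intro!: dvd_sum)
    moreover have "?B = (\<Sum>r\<in>R. \<psi> r j * (\<Sum>i\<in>S1. \<Sum>k\<in>S. int (u i) * int (v k) * g r i k))"
      unfolding sum_distrib_left
      by (simp only: sum.swap[of _ R S] sum.swap[of _ R S1]) (simp add: mult_ac)
    ultimately have 2: "int p dvd (\<Sum>i\<in>S1. \<Sum>k\<in>S. int (u i) * int (v k) * F i j k) -
        (\<Sum>r\<in>R. \<psi> r j * (\<Sum>i\<in>S1. \<Sum>k\<in>S. int (u i) * int (v k) * g r i k))"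
      by simp
    from dvd_diff[OF 2 1] show ?thesis by (simp only: dvd_diff_commute diff_diff_eq2 add_diff_cancel_left' diff_diff_eq diff_add_cancel) (simp add: dvd_diff_commute algebra_simps)
  qed
  \<comment> \<open>By \<open>key\<close>, \<open>b u\<close> determines \<open>u j * v j\<close>
    modulo \<open>p\<close>, and \<open>v j\<close> is invertible on \<open>S1\<close>. So
    \<open>U\<close> has at most \<open>p ^ card R\<close> elements, while as a kernel it has at
    least \<open>p ^ card S1 / p ^ card R\<close>; comparison gives
    \<open>card S1 \<le> 2 * card R\<close>.\<close>
  have "inj_on b U"
  proof (rule inj_onI)
    fix u u' assume u: "u \<in> U" "u' \<in> U" and eq: "b u = b u'"
    show "u = u'"
    proof
      fix j show "u j = u' j"
      proof (cases "j \<in> S1")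
        case False
        thus ?thesis using u by (auto simp: U_def modvec_def)
      next
        case j: True
        let ?s = "\<lambda>u r. (\<Sum>i\<in>S1. \<Sum>k\<in>S. int (u i) * int (v k) * g r i k)"
        have "int p dvd ?s u r - ?s u' r" if "r \<in> R" for r
          using fun_cong[OF eq, of r] that nat_mod_eq_iff_dvd[OF p0(1)] by (simp add: b_def)
        hence "int p dvd (\<Sum>r\<in>R. \<psi> r j * ?s u r) - (\<Sum>r\<in>R. \<psi> r j * ?s u' r)"
          by (intro dvd_sum_diff) (simp add: right_diff_distrib[symmetric])
        from dvd_diff[OF dvd_add[OF key[OF u(1) j] this] key[OF u(2) j]]
        have "int p dvd int (u j) * int (v j) - int (u' j) * int (v j)"
          by (simp only: diff_add_cancel add_diff_eq diff_diff_eq2)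
        hence "int p dvd (int (u j) - int (u' j)) * int (v j)" by (simp add: left_diff_distrib)
        moreover have "\<not> int p dvd int (v j)"
          using j v by (auto simp: S1_def modvec_def dest: nat_dvd_not_less)
        ultimately have "int p dvd int (u j) - int (u' j)"
          using p prime_dvd_mult_iff[of "int p"] by auto
        hence "u j mod p = u' j mod p" by (simp add: mod_eq_dvd_iff[symmetric] zmod_int[symmetric])
        thus ?thesis using j u by (auto simp: U_def modvec_def)
      qed
    qed
  qed
  moreover have "b ` U \<subseteq> modvec p R" using p0 by (auto simp: b_def modvec_def nat_less_iff)
  ultimately have "card U \<le> card (modvec p R)" by (rule card_inj_on_le) (rule finite_modvec[OF R])
  hence "card U \<le> p ^ card R" by (simp add: card_modvec R)
  moreover have "p ^ card S1 \<le> card U * p ^ card R"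
    using card_kernel_ge[OF p0(1) S1(1) R, of \<phi>] by (simp add: U_def)
  ultimately have "p ^ card S1 \<le> p ^ card R * p ^ card R"
    using mult_le_mono1 order_trans by blast
  hence "card S1 \<le> card R + card R" using p0 by (simp add: power_add[symmetric])
  with vs show ?thesis by (simp add: S1_def)
qed

section \<open>Tricolored sum-free sets\<close>

text \<open>The index set includes exponents of smaller total degree, with coefficient 0, so that
  the constant 1 in \<open>1 - (x + y + z) ^ m\<close> can later be absorbed at
  \<open>(0, 0, 0)\<close>.\<close>

lemma power_trinomial_expansion:
  fixes m :: nat
  obtains q :: "nat \<times> nat \<times> nat \<Rightarrow> int" where
    "\<And>x y z. (x + y + z) ^ m = (\<Sum>t\<in>{(a, b, e). a + b + e \<le> m}. q t * x ^ fst t * y ^ fst (snd t) * z ^ snd (snd t))"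
proof
  fix x y z :: int
  let ?E = "{(a, b, e). a + b + e \<le> m}"
  have fin: "finite ?E" by (rule finite_subset[of _ "{..m} \<times> {..m} \<times> {..m}"]) auto
  define q where "q = (\<lambda>(a, b, e). if a + b + e = m then int (m choose a) * int ((m - a) choose b) else 0)"
  have "(x + y + z) ^ m = (\<Sum>a\<le>m. \<Sum>b\<le>m-a. int (m choose a) * int ((m - a) choose b) * x ^ a * y ^ b * z ^ (m - a - b))"
    by (simp add: add.assoc binomial_ring[of x "y + z"] binomial_ring[of y z] sum_distrib_left mult_ac)
  also have "\<dots> = (\<Sum>t\<in>(SIGMA a:{..m}. {..m-a}). int (m choose fst t) * int ((m - fst t) choose snd t) * x ^ fst t * y ^ snd t * z ^ (m - fst t - snd t))"
    by (subst sum.Sigma) (auto simp: case_prod_beta)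
  also have "\<dots> = (\<Sum>t\<in>{(a, b, e). a + b + e = m}. q t * x ^ fst t * y ^ fst (snd t) * z ^ snd (snd t))"
    by (rule sum.reindex_bij_witness[of _ "\<lambda>t. (fst t, fst (snd t))" "\<lambda>t. (fst t, snd t, m - fst t - snd t)"])
       (auto simp: q_def)
  also have "\<dots> = (\<Sum>t\<in>?E. q t * x ^ fst t * y ^ fst (snd t) * z ^ snd (snd t))"
    using fin by (intro sum.mono_neutral_left) (auto simp: q_def)
  finally show "(x + y + z) ^ m = (\<Sum>t\<in>?E. (case t of (a, b, e) \<Rightarrow> if a + b + e = m then int (m choose a) * int ((m - a) choose b) else 0)
     * x ^ fst t * y ^ fst (snd t) * z ^ snd (snd t))"
    unfolding q_def .
qed

definition low_monomials :: "nat \<Rightarrow> 'i set \<Rightarrow> ('i \<Rightarrow> nat) set" where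
  "low_monomials p I = {\<alpha> \<in> PiE I (\<lambda>_. {..<p}). 3 * sum \<alpha> I \<le> (p - 1) * card I}"

lemma finite_low_monomials: "finite I \<Longrightarrow> finite (low_monomials p I)"
  unfolding low_monomials_def by (rule finite_subset[of _ "PiE I (\<lambda>_. {..<p})"]) (auto intro!: finite_PiE)

lemma fermat_int:
  fixes s :: nat
  assumes "prime p" "\<not> p dvd s"
  shows "int p dvd 1 - int s ^ (p - 1)"
proof -
  have "[int (s ^ (p - 1)) = int 1] (mod int p)"
    using fermat_theorem[OF assms] cong_int_iff by blast
  thus ?thesis by (simp add: cong_iff_dvd_diff dvd_diff_commute)
qed

text \<open>By Fermat's theorem the product of \<open>1 - (x c + y c + z c) ^ (p - 1)\<close> over
  \<open>c\<close> is, modulo \<open>p\<close>, the indicator of \<open>x + y + z = 0\<close>; on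
  sum-free data it is a diagonal tensor. Each monomial of the expansion has total degree at most
  \<open>(p - 1) * card I\<close>, hence at most a third of that in one of the three groups of
  variables. Collecting terms by that low factor writes the tensor as a sum of slices.\<close>

lemma tricolored_sum_free_card_le:
  fixes x y z :: "'s \<Rightarrow> 'i \<Rightarrow> nat"
  assumes p: "prime p" and I: "finite I" and S: "finite S"
    and sf: "\<And>i j k. \<lbrakk>i \<in> S; j \<in> S; k \<in> S\<rbrakk> \<Longrightarrow>
      (\<forall>c\<in>I. p dvd x i c + y j c + z k c) \<longleftrightarrow> i = j \<and> j = k"
  shows "card S \<le> 3 * card (low_monomials p I)"
proof -
  have p0: "0 < p" "1 < p" using p prime_gt_0_nat prime_gt_1_nat by blast+
  define E where "E = {(a, b, e). a + b + e \<le> p - 1}"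
  have finE: "finite E" unfolding E_def by (rule finite_subset[of _ "{..p - 1} \<times> {..p - 1} \<times> {..p - 1}"]) auto
  have E0: "(0, 0, 0) \<in> E" by (simp add: E_def)
  obtain q0 :: "nat \<times> nat \<times> nat \<Rightarrow> int" where q0:
    "\<And>x y z. (x + y + z) ^ (p - 1) = (\<Sum>t\<in>E. q0 t * x ^ fst t * y ^ fst (snd t) * z ^ snd (snd t))"
    unfolding E_def using power_trinomial_expansion[of "p - 1"] by blast
  define q where "q t = (if t = (0, 0, 0) then 1 else 0) - q0 t" for t
  have q: "1 - (x + y + z) ^ (p - 1) = (\<Sum>t\<in>E. q t * x ^ fst t * y ^ fst (snd t) * z ^ snd (snd t))" for x y z
  proof -
    have "(\<Sum>t\<in>E. q t * x ^ fst t * y ^ fst (snd t) * z ^ snd (snd t)) =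
       (\<Sum>t\<in>E. (if t = (0, 0, 0) then 1 else 0) - q0 t * x ^ fst t * y ^ fst (snd t) * z ^ snd (snd t))"
      by (intro sum.cong) (auto simp: q_def)
    also have "\<dots> = 1 - (\<Sum>t\<in>E. q0 t * x ^ fst t * y ^ fst (snd t) * z ^ snd (snd t))"
      using finE E0 by (simp add: sum_subtractf sum.delta)
    finally show ?thesis by (simp only: q0)
  qed
  define F where "F i j k = (\<Prod>c\<in>I. 1 - (int (x i c) + int (y j c) + int (z k c)) ^ (p - 1))" for i j k
  define \<Phi> where "\<Phi> = PiE I (\<lambda>_. E)"
  have fin\<Phi>: "finite \<Phi>" unfolding \<Phi>_def using I finE by (auto intro!: finite_PiE)
  define A where "A f = restrict (\<lambda>c. fst (f c)) I" for f :: "'i \<Rightarrow> nat \<times> nat \<times> nat"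
  define B where "B f = restrict (\<lambda>c. fst (snd (f c))) I" for f :: "'i \<Rightarrow> nat \<times> nat \<times> nat"
  define C where "C f = restrict (\<lambda>c. snd (snd (f c))) I" for f :: "'i \<Rightarrow> nat \<times> nat \<times> nat"
  define Q where "Q f = (\<Prod>c\<in>I. q (f c))" for f :: "'i \<Rightarrow> nat \<times> nat \<times> nat"
  define mon where "mon v \<alpha> = (\<Prod>c\<in>I. int (v c) ^ \<alpha> c)" for v \<alpha> :: "'i \<Rightarrow> nat"
  have F_eq: "F i j k = (\<Sum>f\<in>\<Phi>. Q f * mon (x i) (A f) * mon (y j) (B f) * mon (z k) (C f))" for i j k
  proof -
    have "F i j k = (\<Sum>f\<in>\<Phi>. \<Prod>c\<in>I. q (f c) * int (x i c) ^ fst (f c) * int (y j c) ^ fst (snd (f c)) * int (z k c) ^ snd (snd (f c)))"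
      unfolding F_def q \<Phi>_def using I finE by (rule prod_sum_PiE)
    also have "\<dots> = (\<Sum>f\<in>\<Phi>. Q f * mon (x i) (A f) * mon (y j) (B f) * mon (z k) (C f))"
      by (intro sum.cong refl) (simp add: Q_def mon_def A_def B_def C_def prod.distrib)
    finally show ?thesis .
  qed
  let ?R = "low_monomials p I"
  have PiE: "A f \<in> PiE I (\<lambda>_. {..<p})" "B f \<in> PiE I (\<lambda>_. {..<p})" "C f \<in> PiE I (\<lambda>_. {..<p})" if "f \<in> \<Phi>" for f
    using that p0 by (fastforce simp: \<Phi>_def E_def A_def B_def C_def PiE_def Pi_def case_prod_beta)+
  have low: "A f \<in> ?R \<or> B f \<in> ?R \<or> C f \<in> ?R" if f: "f \<in> \<Phi>" for f
  proof (rule ccontr)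
    assume "\<not> ?thesis"
    hence "(p - 1) * card I < 3 * sum (A f) I" "(p - 1) * card I < 3 * sum (B f) I" "(p - 1) * card I < 3 * sum (C f) I"
      using PiE[OF f] by (auto simp: low_monomials_def)
    moreover have "sum (A f) I + sum (B f) I + sum (C f) I = (\<Sum>c\<in>I. fst (f c) + fst (snd (f c)) + snd (snd (f c)))"
      by (simp add: A_def B_def C_def sum.distrib)
    moreover have "\<dots> \<le> (\<Sum>c\<in>I. p - 1)"
      using f by (intro sum_mono) (auto simp: \<Phi>_def E_def PiE_def Pi_def case_prod_beta)
    ultimately show False by (simp add: mult.commute)
  qed
  \<comment> \<open>Each term goes to the first of its three factors that has low degree, so none is
    counted twice; by \<open>low\<close>, the terms left for \<open>\<Phi>3\<close> have a low third
    factor.\<close>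
  define \<Phi>1 where "\<Phi>1 = {f \<in> \<Phi>. A f \<in> ?R}"
  define \<Phi>2 where "\<Phi>2 = {f \<in> \<Phi>. A f \<notin> ?R \<and> B f \<in> ?R}"
  define \<Phi>3 where "\<Phi>3 = {f \<in> \<Phi>. A f \<notin> ?R \<and> B f \<notin> ?R}"
  have fin: "finite \<Phi>1" "finite \<Phi>2" "finite \<Phi>3" using fin\<Phi> by (auto simp: \<Phi>1_def \<Phi>2_def \<Phi>3_def)
  have group: "(\<Sum>f\<in>\<Theta>. G f) = (\<Sum>r\<in>?R. \<Sum>f\<in>{f \<in> \<Theta>. H f = r}. G f)"
    if "finite \<Theta>" "H ` \<Theta> \<subseteq> ?R" for \<Theta> and G :: "('i \<Rightarrow> nat \<times> nat \<times> nat) \<Rightarrow> int" and H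
    using sum.group[OF that(1) finite_low_monomials[OF I] that(2), of G] by simp
  show ?thesis
  proof (rule card_diagonal_le_slice_rank[where F = F and R = ?R and
      \<phi> = "\<lambda>r i. mon (x i) r" and \<psi> = "\<lambda>r j. mon (y j) r" and \<xi> = "\<lambda>r k. mon (z k) r" and
      f = "\<lambda>r j k. \<Sum>f\<in>{f \<in> \<Phi>1. A f = r}. Q f * mon (y j) (B f) * mon (z k) (C f)" and
      g = "\<lambda>r i k. \<Sum>f\<in>{f \<in> \<Phi>2. B f = r}. Q f * mon (x i) (A f) * mon (z k) (C f)" and
      h = "\<lambda>r i j. \<Sum>f\<in>{f \<in> \<Phi>3. C f = r}. Q f * mon (x i) (A f) * mon (y j) (B f)"])
    fix i j k assume ijk: "i \<in> S" "j \<in> S" "k \<in> S" "\<not> (i = j \<and> j = k)"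
    then obtain c where c: "c \<in> I" "\<not> p dvd x i c + y j c + z k c" using sf by blast
    have "int p dvd 1 - int (x i c + y j c + z k c) ^ (p - 1)" using fermat_int[OF p c(2)] .
    also have "\<dots> dvd F i j k" using dvd_prodI[OF I c(1), of "\<lambda>c. 1 - (int (x i c) + int (y j c) + int (z k c)) ^ (p - 1)"] by (simp add: F_def)
    finally show "int p dvd F i j k" .
  next
    fix i assume i: "i \<in> S"
    have "[F i i i = (\<Prod>c\<in>I. 1)] (mod int p)" unfolding F_def
    proof (rule cong_prod)
      fix c assume "c \<in> I"
      hence "p dvd x i c + y i c + z i c" using sf[OF i i i] by blast
      hence "int p dvd (int (x i c) + int (y i c) + int (z i c))"
        by (metis of_nat_add of_nat_dvd_iff)
      hence "int p dvd (int (x i c) + int (y i c) + int (z i c)) ^ (p - 1)"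
        using p0 by (intro dvd_power_le[where n = 1, simplified]) auto
      thus "[1 - (int (x i c) + int (y i c) + int (z i c)) ^ (p - 1) = 1] (mod int p)"
        by (simp add: cong_iff_dvd_diff)
    qed
    thus "int p dvd F i i i - 1" by (simp add: cong_iff_dvd_diff)
  next
    fix i j k assume "i \<in> S" "j \<in> S" "k \<in> S"
    let ?G = "\<lambda>f. Q f * mon (x i) (A f) * mon (y j) (B f) * mon (z k) (C f)"
    have "F i j k = (\<Sum>f\<in>\<Phi>1 \<union> (\<Phi>2 \<union> \<Phi>3). ?G f)"
      unfolding F_eq by (rule sum.cong) (auto simp: \<Phi>1_def \<Phi>2_def \<Phi>3_def)
    also have "\<dots> = (\<Sum>f\<in>\<Phi>1. ?G f) + ((\<Sum>f\<in>\<Phi>2. ?G f) + (\<Sum>f\<in>\<Phi>3. ?G f))"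
      using fin by (subst sum.union_disjoint, (auto simp: \<Phi>1_def \<Phi>2_def \<Phi>3_def)[3], subst sum.union_disjoint)
        (auto simp: \<Phi>1_def \<Phi>2_def \<Phi>3_def)
    also have "(\<Sum>f\<in>\<Phi>1. ?G f) = (\<Sum>r\<in>?R. \<Sum>f\<in>{f \<in> \<Phi>1. A f = r}. ?G f)"
      using fin by (intro group) (auto simp: \<Phi>1_def)
    also have "\<dots> = (\<Sum>r\<in>?R. mon (x i) r * (\<Sum>f\<in>{f \<in> \<Phi>1. A f = r}. Q f * mon (y j) (B f) * mon (z k) (C f)))"
      unfolding sum_distrib_left by (intro sum.cong refl) (auto simp: mult_ac)
    also have "(\<Sum>f\<in>\<Phi>2. ?G f) = (\<Sum>r\<in>?R. \<Sum>f\<in>{f \<in> \<Phi>2. B f = r}. ?G f)"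
      using fin by (intro group) (auto simp: \<Phi>2_def)
    also have "\<dots> = (\<Sum>r\<in>?R. mon (y j) r * (\<Sum>f\<in>{f \<in> \<Phi>2. B f = r}. Q f * mon (x i) (A f) * mon (z k) (C f)))"
      unfolding sum_distrib_left by (intro sum.cong refl) (auto simp: mult_ac)
    also have "(\<Sum>f\<in>\<Phi>3. ?G f) = (\<Sum>r\<in>?R. \<Sum>f\<in>{f \<in> \<Phi>3. C f = r}. ?G f)"
      using fin low by (intro group) (auto simp: \<Phi>3_def)
    also have "\<dots> = (\<Sum>r\<in>?R. mon (z k) r * (\<Sum>f\<in>{f \<in> \<Phi>3. C f = r}. Q f * mon (x i) (A f) * mon (y j) (B f)))"
      unfolding sum_distrib_left by (intro sum.cong refl) (auto simp: mult_ac)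
    finally show "F i j k =
        (\<Sum>r\<in>?R. mon (x i) r * (\<Sum>f\<in>{f \<in> \<Phi>1. A f = r}. Q f * mon (y j) (B f) * mon (z k) (C f))) +
        (\<Sum>r\<in>?R. mon (y j) r * (\<Sum>f\<in>{f \<in> \<Phi>2. B f = r}. Q f * mon (x i) (A f) * mon (z k) (C f))) +
        (\<Sum>r\<in>?R. mon (z k) r * (\<Sum>f\<in>{f \<in> \<Phi>3. C f = r}. Q f * mon (x i) (A f) * mon (y j) (B f)))"
      by (simp only: add.assoc)
  qed (use p S I in \<open>simp_all add: finite_low_monomials\<close>)
qed

section \<open>The number of monomials of low degree\<close>

definition entropy_ratio :: "nat \<Rightarrow> real \<Rightarrow> real" where
  "entropy_ratio p t = (\<Sum>i<p. t ^ i) / t powr ((real p - 1) / 3)"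

text \<open>A Chernoff bound. Give each monomial the weight \<open>t\<close> to the power of its
  degree: as \<open>t < 1\<close>, low monomials weigh at least \<open>t powr ?e\<close>, and the
  total weight over all exponents below \<open>p\<close> factors over the variables. The resulting
  ratio is the function minimised in the definition of \<open>c_p3\<close>.\<close>

lemma card_low_monomials_le:
  assumes p: "1 < p" and I: "finite I" and t: "0 < t" "t < 1"
  shows "real (card (low_monomials p I)) \<le> entropy_ratio p t ^ card I"
proof -
  let ?e = "(real p - 1) / 3 * real (card I)"
  have "real (card (low_monomials p I)) * t powr ?e = (\<Sum>\<alpha>\<in>low_monomials p I. t powr ?e)" by simp
  also have "\<dots> \<le> (\<Sum>\<alpha>\<in>low_monomials p I. \<Prod>c\<in>I. t ^ \<alpha> c)"
  proof (rule sum_mono)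
    fix \<alpha> assume "\<alpha> \<in> low_monomials p I"
    hence "3 * sum \<alpha> I \<le> (p - 1) * card I" by (simp add: low_monomials_def)
    hence "real (3 * sum \<alpha> I) \<le> real ((p - 1) * card I)" by (simp only: of_nat_le_iff)
    hence "real (sum \<alpha> I) \<le> ?e" using p by (simp add: of_nat_diff)
    hence "t powr ?e \<le> t powr real (sum \<alpha> I)" using t by (intro powr_mono') auto
    also have "\<dots> = (\<Prod>c\<in>I. t ^ \<alpha> c)" using t by (simp only: powr_realpow power_sum)
    finally show "t powr ?e \<le> (\<Prod>c\<in>I. t ^ \<alpha> c)" .
  qed
  also have "\<dots> \<le> (\<Sum>\<alpha>\<in>PiE I (\<lambda>_. {..<p}). \<Prod>c\<in>I. t ^ \<alpha> c)"
    using I t by (intro sum_mono2 finite_PiE) (auto simp: low_monomials_def intro!: prod_nonneg)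
  also have "\<dots> = (\<Prod>c\<in>I. \<Sum>i<p. t ^ i)"
    using I by (subst prod_sum_PiE) auto
  finally have "real (card (low_monomials p I)) * t powr ?e \<le> (\<Sum>i<p. t ^ i) ^ card I" by simp
  moreover have "t powr ?e = (t powr ((real p - 1) / 3)) ^ card I"
    using t by (simp only: powr_powr[symmetric] powr_realpow powr_gt_zero)
  ultimately show ?thesis
    using t by (simp add: entropy_ratio_def power_divide pos_le_divide_eq)
qed

lemma entropy_ratio_ge_1:
  assumes "1 < p" "0 < t" "t < 1"
  shows "1 \<le> entropy_ratio p t"
proof -
  have "(\<Sum>i\<in>{0}. t ^ i) \<le> (\<Sum>i<p. t ^ i)" using assms by (intro sum_mono2) auto
  moreover have "t powr ((real p - 1) / 3) \<le> t powr 0" using assms by (intro powr_mono') auto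
  ultimately show ?thesis using assms by (simp add: entropy_ratio_def pos_le_divide_eq)
qed

text \<open>This is what makes \<open>c_p3 p\<close> positive. The function \<open>h\<close>
  vanishes at 1, where its derivative is p (p - 1) / 2 - p (p - 1) / 3 > 0, so it is negative
  slightly to the left of 1.\<close>

lemma ex_entropy_ratio_less:
  assumes p: "1 < p"
  obtains t where "0 < t" "t < 1" "entropy_ratio p t < real p"
proof -
  let ?e = "(real p - 1) / 3"
  define h where "h t = (\<Sum>i<p. t ^ i) - real p * t powr ?e" for t :: real
  have "(h has_real_derivative ((\<Sum>i<p. real i) - real p * ?e)) (at 1)"
    unfolding h_def by (auto intro!: derivative_eq_intros sum.cong)
  moreover have "2 * (\<Sum>i<p. real i) = real p * (real p - 1)"
    by (induction p) (simp_all add: algebra_simps)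
  hence "0 < (\<Sum>i<p. real i) - real p * ?e"
  proof -
    have "0 < real p * (real p - 1)" using p by simp
    thus ?thesis using \<open>2 * (\<Sum>i<p. real i) = real p * (real p - 1)\<close> by (simp add: field_simps)
  qed
  ultimately obtain d where d: "0 < d" "\<And>e. 0 < e \<Longrightarrow> e < d \<Longrightarrow> h (1 - e) < h 1"
    using DERIV_pos_inc_left by blast
  define e where "e = min (1/2) (d / 2)"
  have e: "0 < e" "e < d" "e < 1" using d(1) by (auto simp: e_def)
  have "h (1 - e) < 0" using d(2)[OF e(1,2)] by (simp add: h_def)
  hence "entropy_ratio p (1 - e) < real p"
    using e by (simp add: h_def entropy_ratio_def pos_divide_less_eq)
  with e show thesis by (intro that[of "1 - e"]) auto
qed

lemma Inf_entropy_ratio: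
  assumes p: "1 < p"
  shows "p powr (1 - c_p3 p) = (INF t\<in>{0<..<1}. entropy_ratio p t)"
    and c_p3_pos: "0 < c_p3 p"
proof -
  let ?L = "INF t\<in>{0<..<1}. entropy_ratio p t"
  have bdd: "bdd_below (entropy_ratio p ` {0<..<1})"
    using entropy_ratio_ge_1[OF p] by (intro bdd_belowI2[of _ 1]) auto
  have 1: "1 \<le> ?L" using entropy_ratio_ge_1[OF p] by (intro cINF_greatest) auto
  obtain t where t: "0 < t" "t < 1" "entropy_ratio p t < real p" using ex_entropy_ratio_less[OF p] by blast
  have "?L \<le> entropy_ratio p t" using t by (intro cINF_lower[OF bdd]) auto
  hence 2: "?L < real p" using t by simp
  have c: "c_p3 p = 1 - log (real p) ?L" by (simp add: c_p3_def entropy_ratio_def)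
  show "p powr (1 - c_p3 p) = ?L" using 1 p by (simp add: c)
  show "0 < c_p3 p" using 1 2 p by (simp add: c)
qed

lemma tricolored_sum_free_card_le_powr:
  fixes x y z :: "'s \<Rightarrow> 'i \<Rightarrow> nat"
  assumes p: "prime p" and I: "finite I" and S: "finite S"
    and sf: "\<And>i j k. \<lbrakk>i \<in> S; j \<in> S; k \<in> S\<rbrakk> \<Longrightarrow>
      (\<forall>c\<in>I. p dvd x i c + y j c + z k c) \<longleftrightarrow> i = j \<and> j = k"
  shows "real (card S) \<le> 3 * (real p ^ card I) powr (1 - c_p3 p)"
proof -
  have p1: "1 < p" using p prime_gt_1_nat by blast
  let ?n = "card I" and ?m = "real (card (low_monomials p I))"
  let ?L = "INF t\<in>{0<..<1}. entropy_ratio p t"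
  have m: "?m \<le> ?L ^ ?n"
  proof (cases "?n = 0")
    case True
    thus ?thesis using card_low_monomials_le[OF p1 I, of "1/2"] by simp
  next
    case False
    hence n: "0 < ?n" by simp
    \<comment> \<open>After taking roots, the bounds for the individual \<open>t\<close> say that
      the left side is a lower bound of all values of \<open>entropy_ratio\<close>, hence of their
      infimum, attained or not.\<close>
    have "root ?n ?m \<le> ?L"
    proof (rule cINF_greatest)
      fix t :: real assume "t \<in> {0<..<1}"
      hence "root ?n ?m \<le> root ?n (entropy_ratio p t ^ ?n)" and "0 \<le> entropy_ratio p t"
        using card_low_monomials_le[OF p1 I, of t] n entropy_ratio_ge_1[OF p1, of t] by auto
      thus "root ?n ?m \<le> entropy_ratio p t" using n by (simp add: real_root_power_cancel)
    qed auto
    hence "root ?n ?m ^ ?n \<le> ?L ^ ?n" by (rule power_mono) (use n in simp)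
    thus ?thesis using n by simp
  qed
  have "real (card S) \<le> 3 * ?m"
    using tricolored_sum_free_card_le[OF p I S sf] by linarith
  also have "\<dots> \<le> 3 * ?L ^ ?n" using m by simp
  also have "?L ^ ?n = (real p powr (1 - c_p3 p)) ^ ?n" using Inf_entropy_ratio[OF p1] by simp
  also have "\<dots> = (real p ^ ?n) powr (1 - c_p3 p)"
    using p1 by (simp add: powr_realpow[symmetric] powr_powr mult.commute)
  finally show ?thesis .
qed

section \<open>Cycles and random affine maps\<close>

definition cycles :: "nat \<Rightarrow> 'j set \<Rightarrow> ('j \<Rightarrow> ('i \<Rightarrow> nat) set) \<Rightarrow> ('j \<Rightarrow> 'i \<Rightarrow> nat) set" where
  "cycles p J X = {x \<in> PiE J X. \<forall>i. p dvd (\<Sum>j\<in>J. x j i)}"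

lemma dvd_sum_mod_iff: "(p::nat) dvd (\<Sum>j\<in>J. f j mod p) \<longleftrightarrow> p dvd (\<Sum>j\<in>J. f j)"
  by (simp add: dvd_eq_mod_eq_0 mod_sum_eq)

lemma modvec_eqI:
  assumes "x \<in> modvec p I" "y \<in> modvec p I" "\<And>i. int p dvd int (x i) - int (y i)"
  shows "x = y"
proof
  fix i
  have "x i mod p = y i mod p" using assms(3)[of i] by (simp add: mod_eq_dvd_iff[symmetric] zmod_int[symmetric])
  thus "x i = y i" using assms by (cases "i \<in> I") (auto simp: modvec_def)
qed

lemma mod_in_modvec:
  assumes "0 < p" "\<And>i. i \<notin> I \<Longrightarrow> p dvd f i"
  shows "(\<lambda>i. f i mod p) \<in> modvec p I"
  using assms by (auto simp: modvec_def)

lemma cycles_mono: "(\<And>j. j \<in> J \<Longrightarrow> X j \<subseteq> Y j) \<Longrightarrow> cycles p J X \<subseteq> cycles p J Y"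
  by (fastforce simp: cycles_def)

lemma finite_cycles:
  assumes "finite J" "finite I" "\<And>j. j \<in> J \<Longrightarrow> X j \<subseteq> modvec p I"
  shows "finite (cycles p J X)"
proof (rule finite_subset)
  show "cycles p J X \<subseteq> PiE J X" by (auto simp: cycles_def)
  show "finite (PiE J X)" using assms finite_modvec finite_subset by (blast intro!: finite_PiE)
qed

lemma cycles_eqI:
  assumes J: "finite J" "j0 \<in> J" and X: "X j0 \<subseteq> modvec p I"
    and x: "x \<in> cycles p J X" and y: "y \<in> cycles p J X"
    and eq: "\<And>j. j \<in> J \<Longrightarrow> j \<noteq> j0 \<Longrightarrow> x j = y j"
  shows "x = y"
proof -
  have "x j0 = y j0"
  proof (rule modvec_eqI)
    show "x j0 \<in> modvec p I" "y j0 \<in> modvec p I" using x y J X by (auto simp: cycles_def)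
    fix i
    have "int p dvd int (\<Sum>j\<in>J. x j i) - int (\<Sum>j\<in>J. y j i)"
      using x y by (intro dvd_diff) (auto simp: cycles_def simp del: of_nat_sum)
    also have "(\<Sum>j\<in>J. x j i) = x j0 i + (\<Sum>j\<in>J-{j0}. x j i)" using J by (rule sum.remove)
    also have "(\<Sum>j\<in>J. y j i) = y j0 i + (\<Sum>j\<in>J-{j0}. y j i)" using J by (rule sum.remove)
    also have "(\<Sum>j\<in>J-{j0}. y j i) = (\<Sum>j\<in>J-{j0}. x j i)" using eq by (intro sum.cong) auto
    finally show "int p dvd int (x j0 i) - int (y j0 i)" by simp
  qed
  show ?thesis
  proof
    fix j show "x j = y j"
      using x y eq[of j] \<open>x j0 = y j0\<close> by (cases "j \<in> J"; cases "j = j0") (auto simp: cycles_def PiE_def extensional_def)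
  qed
qed

text \<open>Reducing \<open>f i\<close> first keeps the truncated subtraction exact; the outer
  reduction sends \<open>p\<close> back to 0.\<close>

definition neg_mod :: "nat \<Rightarrow> ('i \<Rightarrow> nat) \<Rightarrow> 'i \<Rightarrow> nat" where
  "neg_mod p f = (\<lambda>i. (p - f i mod p) mod p)"

lemma dvd_neg_mod:
  assumes "0 < p" shows "p dvd f i + neg_mod p f i"
proof -
  have "(f i + neg_mod p f i) mod p = (f i mod p + (p - f i mod p)) mod p"
    unfolding neg_mod_def by (simp add: mod_add_eq mod_add_left_eq mod_add_right_eq)
  also have "\<dots> = 0" using assms by (simp add: less_imp_le)
  finally show ?thesis by (simp add: dvd_eq_mod_eq_0)
qed

lemma neg_mod_in_modvec:
  assumes "0 < p" "\<And>i. i \<notin> I \<Longrightarrow> f i = 0"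
  shows "neg_mod p f \<in> modvec p I"
  using assms by (auto simp: modvec_def neg_mod_def)

lemma card_cycles_modvec:
  assumes J: "finite J" "j0 \<in> J" and I: "finite I" and p: "0 < p"
  shows "card (cycles p J (\<lambda>_. modvec p I)) = (p ^ card I) ^ (card J - 1)"
proof -
  let ?Z = "cycles p J (\<lambda>_. modvec p I)" and ?P = "PiE (J - {j0}) (\<lambda>_. modvec p I)"
  define g where "g y = (\<lambda>j. if j = j0 then neg_mod p (\<lambda>i. \<Sum>j\<in>J-{j0}. y j i) else y j)" for y :: "'a \<Rightarrow> 'b \<Rightarrow> nat"
  have "bij_betw (\<lambda>x. restrict x (J - {j0})) ?Z ?P"
    unfolding bij_betw_def
  proof
    show "inj_on (\<lambda>x. restrict x (J - {j0})) ?Z"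
    proof (rule inj_onI)
      fix x y assume xy: "x \<in> ?Z" "y \<in> ?Z" "restrict x (J - {j0}) = restrict y (J - {j0})"
      have "x j = y j" if "j \<in> J" "j \<noteq> j0" for j using fun_cong[OF xy(3), of j] that by simp
      with xy show "x = y" by (intro cycles_eqI[OF J, of "\<lambda>_. modvec p I" p I]) auto
    qed
    show "(\<lambda>x. restrict x (J - {j0})) ` ?Z = ?P"
    proof (intro equalityI subsetI)
      fix y assume y: "y \<in> ?P"
      have "g y \<in> ?Z"
      proof -
        have sum0: "(\<Sum>j\<in>J-{j0}. y j i) = 0" if "i \<notin> I" for i
          using that y by (intro sum.neutral) (auto simp: modvec_def PiE_def Pi_def)
        have "neg_mod p (\<lambda>i. \<Sum>j\<in>J-{j0}. y j i) \<in> modvec p I"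
          using p sum0 by (intro neg_mod_in_modvec) auto
        hence "g y \<in> PiE J (\<lambda>_. modvec p I)"
          using y J by (auto simp: g_def PiE_def extensional_def)
        moreover have "p dvd (\<Sum>j\<in>J. g y j i)" for i
        proof -
          have "(\<Sum>j\<in>J. g y j i) = g y j0 i + (\<Sum>j\<in>J-{j0}. g y j i)" using J by (rule sum.remove)
          also have "(\<Sum>j\<in>J-{j0}. g y j i) = (\<Sum>j\<in>J-{j0}. y j i)" by (intro sum.cong) (auto simp: g_def)
          finally show ?thesis
            using dvd_neg_mod[OF p, of "\<lambda>i. \<Sum>j\<in>J-{j0}. y j i" i] by (simp add: g_def add.commute)
        qed
        ultimately show ?thesis by (simp add: cycles_def)
      qed
      moreover have "restrict (g y) (J - {j0}) = y"
        using y by (auto simp: g_def fun_eq_iff PiE_def extensional_def)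
      ultimately show "y \<in> (\<lambda>x. restrict x (J - {j0})) ` ?Z" by (metis imageI)
    qed (auto simp: cycles_def split: if_splits)
  qed
  hence "card ?Z = card ?P" by (rule bij_betw_same_card)
  also have "\<dots> = (p ^ card I) ^ (card J - 1)"
    using J I by (simp add: card_PiE card_modvec)
  finally show ?thesis .
qed

text \<open>The pair \<open>\<omega>\<close> encodes one affine map for each \<open>j\<close>. All
  share the linear part with matrix rows \<open>fst \<omega> l\<close>; the translations are
  \<open>snd \<omega> j\<close>. When the translations themselves form a cycle, cycles are mapped to
  cycles.\<close>

definition affine_cycle :: "nat \<Rightarrow> 'l set \<Rightarrow> 'j set \<Rightarrow> ('l \<Rightarrow> 'i \<Rightarrow> nat) \<times> ('j \<Rightarrow> 'i \<Rightarrow> nat)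
    \<Rightarrow> ('j \<Rightarrow> 'l \<Rightarrow> nat) \<Rightarrow> 'j \<Rightarrow> 'i \<Rightarrow> nat" where
  "affine_cycle p L J \<omega> s = (\<lambda>j\<in>J. \<lambda>i. ((\<Sum>l\<in>L. s j l * fst \<omega> l i) + snd \<omega> j i) mod p)"

lemma affine_cycle_in:
  assumes p: "0 < p" and A: "A \<in> PiE L (\<lambda>_. modvec p I)"
    and a: "a \<in> cycles p J (\<lambda>_. modvec p I)" and s: "s \<in> cycles p J (\<lambda>_. modvec p L)"
  shows "affine_cycle p L J (A, a) s \<in> cycles p J (\<lambda>_. modvec p I)"
proof -
  have "(\<lambda>i. ((\<Sum>l\<in>L. s j l * A l i) + a j i) mod p) \<in> modvec p I" if "j \<in> J" for j
  proof (rule mod_in_modvec[OF p])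
    fix i assume "i \<notin> I"
    hence "A l i = 0" if "l \<in> L" for l using A that by (auto simp: modvec_def PiE_def Pi_def)
    moreover have "a j i = 0" using a \<open>i \<notin> I\<close> that by (auto simp: cycles_def modvec_def PiE_def Pi_def)
    ultimately show "p dvd (\<Sum>l\<in>L. s j l * A l i) + a j i" by simp
  qed
  moreover have "p dvd (\<Sum>j\<in>J. affine_cycle p L J (A, a) s j i)" for i
  proof -
    have "(\<Sum>j\<in>J. (\<Sum>l\<in>L. s j l * A l i) + a j i) = (\<Sum>l\<in>L. (\<Sum>j\<in>J. s j l) * A l i) + (\<Sum>j\<in>J. a j i)"
      unfolding sum.distrib sum_distrib_right by (subst sum.swap) (rule refl)
    moreover have "p dvd (\<Sum>l\<in>L. (\<Sum>j\<in>J. s j l) * A l i)"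
      by (rule dvd_sum, rule dvd_mult2) (use s in \<open>simp add: cycles_def\<close>)
    moreover have "p dvd (\<Sum>j\<in>J. a j i)" using a by (simp add: cycles_def)
    ultimately have "p dvd (\<Sum>j\<in>J. (\<Sum>l\<in>L. s j l * A l i) + a j i)" by simp
    thus ?thesis by (simp add: affine_cycle_def dvd_sum_mod_iff)
  qed
  ultimately show ?thesis by (auto simp: cycles_def affine_cycle_def)
qed

lemma affine_cycle_eqD:
  assumes "affine_cycle p L J (A, a) s = affine_cycle p L J (B, b) s" "j \<in> J"
  shows "int p dvd (\<Sum>l\<in>L. int (s j l) * (int (A l i) - int (B l i))) + (int (a j i) - int (b j i))"
proof -
  have "((\<Sum>l\<in>L. s j l * A l i) + a j i) mod p = ((\<Sum>l\<in>L. s j l * B l i) + b j i) mod p"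
    using fun_cong[OF fun_cong[OF assms(1), of j], of i] assms(2) by (simp add: affine_cycle_def)
  hence "int (((\<Sum>l\<in>L. s j l * A l i) + a j i) mod p) = int (((\<Sum>l\<in>L. s j l * B l i) + b j i) mod p)" by simp
  hence "int p dvd int ((\<Sum>l\<in>L. s j l * A l i) + a j i) - int ((\<Sum>l\<in>L. s j l * B l i) + b j i)"
    by (simp only: zmod_int mod_eq_dvd_iff)
  thus ?thesis by (simp add: right_diff_distrib sum_subtractf algebra_simps)
qed

text \<open>For a fixed linear part, a random cycle of translations makes the image of
  \<open>s\<close> uniformly distributed on all cycles: distinct translations give distinct images,
  and an injective self-map of a finite set is onto.\<close>

lemma card_affine_cycle_translates:
  assumes p: "0 < p" and J: "finite J" and I: "finite I" and A: "A \<in> PiE L (\<lambda>_. modvec p I)"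
    and s: "s \<in> cycles p J (\<lambda>_. modvec p L)" and C: "C \<subseteq> cycles p J (\<lambda>_. modvec p I)"
  shows "card {a \<in> cycles p J (\<lambda>_. modvec p I). affine_cycle p L J (A, a) s \<in> C} = card C"
proof -
  let ?Z = "cycles p J (\<lambda>_. modvec p I)" and ?f = "\<lambda>a. affine_cycle p L J (A, a) s"
  have finZ: "finite ?Z" using J I by (rule finite_cycles) simp
  have into: "?f ` ?Z \<subseteq> ?Z" using affine_cycle_in[OF p A _ s] by blast
  have inj: "inj_on ?f ?Z"
  proof (rule inj_onI)
    fix a b assume ab: "a \<in> ?Z" "b \<in> ?Z" "?f a = ?f b"
    show "a = b"
    proof
      fix j show "a j = b j"
      proof (cases "j \<in> J")
        case True
        show ?thesis
        proof (rule modvec_eqI)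
          show "a j \<in> modvec p I" "b j \<in> modvec p I" using ab True by (auto simp: cycles_def)
          show "int p dvd int (a j i) - int (b j i)" for i using affine_cycle_eqD[OF ab(3) True, of i] by simp
        qed
      qed (use ab in \<open>auto simp: cycles_def PiE_def extensional_def\<close>)
    qed
  qed
  have "?f ` ?Z = ?Z" using endo_inj_surj[OF finZ into inj] .
  hence "C \<subseteq> ?f ` ?Z" using C by simp
  hence img: "?f ` {a \<in> ?Z. ?f a \<in> C} = C" by (auto simp: image_iff subset_iff)
  have "inj_on ?f {a \<in> ?Z. ?f a \<in> C}" using inj by (rule inj_on_subset) auto
  from card_image[OF this] show ?thesis unfolding img by simp
qed

text \<open>The \<open>j\<close>-th coordinates of the two images differ by the linear part applied
  to \<open>s j - s' j\<close>. At an index \<open>e\<close> where this difference is nonzero modulo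
  the prime, row \<open>e\<close> is determined by the other rows, and then the translations are
  determined as well. So only \<open>card L - 1\<close> rows are free.\<close>

lemma card_affine_cycle_two_points:
  assumes p: "prime p" and J: "finite J" and I: "finite I" and L: "finite L"
    and s: "s \<in> cycles p J (\<lambda>_. modvec p L)" and s': "s' \<in> cycles p J (\<lambda>_. modvec p L)"
    and j: "j \<in> J" "s j \<noteq> s' j"
  shows "card {\<omega> \<in> PiE L (\<lambda>_. modvec p I) \<times> cycles p J (\<lambda>_. modvec p I).
      affine_cycle p L J \<omega> s = x \<and> affine_cycle p L J \<omega> s' = x'} * p ^ card I \<le> (p ^ card I) ^ card L"
    (is "card ?G * _ \<le> _")
proof -
  have sj: "s j \<in> modvec p L" "s' j \<in> modvec p L" using s s' j by (auto simp: cycles_def)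
  from j(2) obtain e where e: "s j e \<noteq> s' j e" by auto
  have eL: "e \<in> L" using sj e by (cases "e \<in> L") (auto simp: modvec_def)
  have ndvd: "\<not> int p dvd int (s j e) - int (s' j e)"
  proof
    assume "int p dvd int (s j e) - int (s' j e)"
    hence "s j e mod p = s' j e mod p" by (simp add: mod_eq_dvd_iff[symmetric] zmod_int[symmetric])
    thus False using e eL sj by (auto simp: modvec_def)
  qed
  let ?r = "\<lambda>\<omega>::('c \<Rightarrow> 'b \<Rightarrow> nat) \<times> ('a \<Rightarrow> 'b \<Rightarrow> nat). restrict (fst \<omega>) (L - {e})"
  have "inj_on ?r ?G"
  proof (rule inj_onI)
    fix \<omega> \<omega>' assume \<omega>: "\<omega> \<in> ?G" "\<omega>' \<in> ?G" and eq: "?r \<omega> = ?r \<omega>'"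
    obtain A a B b where AB: "\<omega> = (A, a)" "\<omega>' = (B, b)" by (cases \<omega>, cases \<omega>')
    have AL: "A \<in> PiE L (\<lambda>_. modvec p I)" "B \<in> PiE L (\<lambda>_. modvec p I)"
      and ab: "a \<in> cycles p J (\<lambda>_. modvec p I)" "b \<in> cycles p J (\<lambda>_. modvec p I)"
      and F: "affine_cycle p L J (A, a) s = affine_cycle p L J (B, b) s"
         "affine_cycle p L J (A, a) s' = affine_cycle p L J (B, b) s'"
      using \<omega> AB by auto
    have AB': "A l = B l" if "l \<in> L" "l \<noteq> e" for l
      using fun_cong[OF eq, of l] that AB by simp
    have red: "(\<Sum>l\<in>L. int (t l) * (int (A l i) - int (B l i))) = int (t e) * (int (A e i) - int (B e i))" for t i
      using AB' L eL by (subst sum.remove[of _ e]) (auto intro!: sum.neutral)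
    have "A e = B e"
    proof (rule modvec_eqI)
      show "A e \<in> modvec p I" "B e \<in> modvec p I" using AL eL by auto
      fix i
      have "int p dvd (int (s j e) * (int (A e i) - int (B e i)) + (int (a j i) - int (b j i))) -
          (int (s' j e) * (int (A e i) - int (B e i)) + (int (a j i) - int (b j i)))"
        using affine_cycle_eqD[OF F(1) j(1), of i] affine_cycle_eqD[OF F(2) j(1), of i]
        unfolding red by (rule dvd_diff)
      hence "int p dvd (int (s j e) - int (s' j e)) * (int (A e i) - int (B e i))"
        by (simp add: algebra_simps)
      thus "int p dvd int (A e i) - int (B e i)"
        using p ndvd prime_dvd_mult_iff[of "int p"] by auto
    qed
    with AB' have "A l = B l" if "l \<in> L" for l using that by blast
    hence "A = B" using PiE_ext[OF AL] by blast
    moreover have "a = b"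
    proof
      fix j show "a j = b j"
      proof (cases "j \<in> J")
        case True
        show ?thesis
        proof (rule modvec_eqI)
          show "a j \<in> modvec p I" "b j \<in> modvec p I" using ab True by (auto simp: cycles_def)
          show "int p dvd int (a j i) - int (b j i)" for i
            using affine_cycle_eqD[OF F(1) True, of i] \<open>A = B\<close> by simp
        qed
      qed (use ab in \<open>auto simp: cycles_def PiE_def extensional_def\<close>)
    qed
    ultimately show "\<omega> = \<omega>'" using AB by simp
  qed
  moreover have "?r ` ?G \<subseteq> PiE (L - {e}) (\<lambda>_. modvec p I)" by (auto split: if_splits)
  moreover have "finite (PiE (L - {e}) (\<lambda>_. modvec p I))" using L I finite_modvec by (auto intro!: finite_PiE)
  ultimately have "card ?G \<le> card (PiE (L - {e}) (\<lambda>_. modvec p I))" by (rule card_inj_on_le)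
  also have "\<dots> = (p ^ card I) ^ (card L - 1)" using L eL I by (simp add: card_PiE card_modvec)
  finally have "card ?G * p ^ card I \<le> (p ^ card I) ^ (card L - 1) * p ^ card I" by (rule mult_le_mono1)
  also have "\<dots> = (p ^ card I) ^ card L"
    using eL L card_gt_0_iff[of L] by (subst power_minus_mult) auto
  finally show ?thesis .
qed

text \<open>Triples of isolated sampled triangles cannot be recombined to a new triangle, so they are
  tricolored sum-free.\<close>

lemma card_isolated_le:
  fixes X :: "'j \<Rightarrow> ('i \<Rightarrow> nat) set" and L :: "'l set"
  assumes p: "prime p" and J: "card J = 3" and L: "finite L"
    and a: "a \<in> cycles p J (\<lambda>_. modvec p I)" and A: "A \<in> PiE L (\<lambda>_. modvec p I)"
    and S: "S = {s \<in> cycles p J (\<lambda>_. modvec p L). affine_cycle p L J (A, a) s \<in> cycles p J X}"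
  shows "real (card {s \<in> S. \<forall>s'\<in>S. \<forall>j\<in>J. s' j = s j \<longrightarrow> s' = s}) \<le> 3 * (real p ^ card L) powr (1 - c_p3 p)"
proof -
  have p0: "0 < p" using p prime_gt_0_nat by blast
  have finJ: "finite J" using J by (intro card_ge_0_finite) simp
  obtain j1 j2 j3 where j: "J = {j1, j2, j3}" "j1 \<noteq> j2" "j2 \<noteq> j3" "j1 \<noteq> j3"
    using J unfolding card_3_iff by blast
  have sum3: "(\<Sum>j\<in>J. f j) = f j1 + f j2 + f j3" for f :: "'j \<Rightarrow> nat" using j by simp
  let ?Z = "cycles p J (\<lambda>_. modvec p L)"
  define T where "T = {s \<in> S. \<forall>s'\<in>S. \<forall>j\<in>J. s' j = s j \<longrightarrow> s' = s}"
  have SZ: "S \<subseteq> ?Z" unfolding S by blast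
  have TS: "T \<subseteq> S" unfolding T_def by blast
  have "finite ?Z" using finJ L by (rule finite_cycles) simp
  hence finT: "finite T" by (rule finite_subset[OF order_trans[OF TS SZ]])
  have "real (card T) \<le> 3 * (real p ^ card L) powr (1 - c_p3 p)"
  proof (rule tricolored_sum_free_card_le_powr[OF p L finT, of "\<lambda>s. s j1" "\<lambda>s. s j2" "\<lambda>s. s j3"])
    fix s1 s2 s3 assume sT: "s1 \<in> T" "s2 \<in> T" "s3 \<in> T"
    show "(\<forall>c\<in>L. p dvd s1 j1 c + s2 j2 c + s3 j3 c) \<longleftrightarrow> s1 = s2 \<and> s2 = s3"
    proof
      assume eq: "s1 = s2 \<and> s2 = s3"
      have "s1 \<in> ?Z" using sT TS SZ by blast
      thus "\<forall>c\<in>L. p dvd s1 j1 c + s2 j2 c + s3 j3 c" using eq by (simp add: cycles_def sum3)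
    next
      assume dv: "\<forall>c\<in>L. p dvd s1 j1 c + s2 j2 c + s3 j3 c"
      \<comment> \<open>The recombined \<open>t\<close> belongs to the sample: the
        \<open>j\<close>-th coordinate of its image depends only on \<open>t j\<close>, so it agrees
        there with the image of \<open>s1\<close>, \<open>s2\<close> or \<open>s3\<close>. Sharing a
        coordinate with each of three isolated triangles, \<open>t\<close> equals all of
        them.\<close>
      define t where "t = (\<lambda>j\<in>J. if j = j1 then s1 j1 else if j = j2 then s2 j2 else s3 j3)"
      have t: "t j1 = s1 j1" "t j2 = s2 j2" "t j3 = s3 j3" using j by (auto simp: t_def)
      have sZ: "s1 \<in> ?Z" "s2 \<in> ?Z" "s3 \<in> ?Z" using sT TS SZ by blast+
      have mv: "s1 j1 \<in> modvec p L" "s2 j2 \<in> modvec p L" "s3 j3 \<in> modvec p L"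
        using sZ j by (auto simp: cycles_def)
      have "t \<in> PiE J (\<lambda>_. modvec p L)" using mv by (auto simp: t_def)
      moreover have "p dvd (\<Sum>j\<in>J. t j i)" for i
      proof (cases "i \<in> L")
        case True thus ?thesis using dv t by (simp add: sum3)
      next
        case False thus ?thesis using mv t by (simp add: sum3 modvec_def)
      qed
      ultimately have tZ: "t \<in> ?Z" by (simp add: cycles_def)
      have F: "affine_cycle p L J (A, a) t \<in> cycles p J (\<lambda>_. modvec p I)"
        by (rule affine_cycle_in[OF p0 A a tZ])
      have FX: "affine_cycle p L J (A, a) s j \<in> X j" if "s \<in> T" "j \<in> J" for s j
      proof -
        have "affine_cycle p L J (A, a) s \<in> cycles p J X" using that(1) S by (simp add: T_def)
        thus ?thesis using that(2) unfolding cycles_def by blast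
      qed
      have "j1 \<in> J" "j2 \<in> J" "j3 \<in> J" using j by auto
      note FX[OF sT(1) this(1)] FX[OF sT(2) this(2)] FX[OF sT(3) this(3)]
      moreover have "affine_cycle p L J (A, a) t j1 = affine_cycle p L J (A, a) s1 j1"
        "affine_cycle p L J (A, a) t j2 = affine_cycle p L J (A, a) s2 j2"
        "affine_cycle p L J (A, a) t j3 = affine_cycle p L J (A, a) s3 j3"
        using t by (simp_all only: affine_cycle_def restrict_def)
      ultimately have "affine_cycle p L J (A, a) t \<in> PiE J X"
        using F j unfolding cycles_def PiE_def by simp
      with F have "affine_cycle p L J (A, a) t \<in> cycles p J X" by (simp add: cycles_def)
      with tZ have tS: "t \<in> S" using S by simp
      have eqI: "t = s" if "s \<in> T" "j \<in> J" "t j = s j" for s j using that tS unfolding T_def by blast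
      have "t = s1" by (rule eqI[OF sT(1), of j1]) (use t j in auto)
      moreover have "t = s2" by (rule eqI[OF sT(2), of j2]) (use t j in auto)
      moreover have "t = s3" by (rule eqI[OF sT(3), of j3]) (use t j in auto)
      ultimately show "s1 = s2 \<and> s2 = s3" by simp
    qed
  qed
  thus ?thesis by (simp add: T_def)
qed

lemma card_nonisolated_le:
  assumes "finite S" "finite J"
  shows "card S \<le> card {s \<in> S. \<forall>s'\<in>S. \<forall>j\<in>J. s' j = s j \<longrightarrow> s' = s} +
    (\<Sum>j\<in>J. card {(s, s') \<in> S \<times> S. s \<noteq> s' \<and> s j = s' j})"
proof -
  let ?I = "{s \<in> S. \<forall>s'\<in>S. \<forall>j\<in>J. s' j = s j \<longrightarrow> s' = s}"
  let ?P = "\<lambda>j. {(s, s') \<in> S \<times> S. s \<noteq> s' \<and> s j = s' j}"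
  have finP: "finite (?P j)" for j by (rule finite_subset[of _ "S \<times> S"]) (use assms in auto)
  have "S \<subseteq> ?I \<union> (\<Union>j\<in>J. fst ` ?P j)" by force
  hence "card S \<le> card (?I \<union> (\<Union>j\<in>J. fst ` ?P j))"
    using assms finP by (intro card_mono) auto
  also have "\<dots> \<le> card ?I + card (\<Union>j\<in>J. fst ` ?P j)" by (rule card_Un_le)
  also have "card (\<Union>j\<in>J. fst ` ?P j) \<le> (\<Sum>j\<in>J. card (fst ` ?P j))" using assms by (intro card_UN_le)
  also have "\<dots> \<le> (\<Sum>j\<in>J. card (?P j))" using finP by (intro sum_mono card_image_le)
  finally show ?thesis by simp
qed

text \<open>First moment counting over all parameters of the affine maps. On average the sample has
  M^2 T / N^2 triangles. At most 3 M powr (1 - c) are isolated, and every other one lies in an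
  ordered pair sharing a vertex. For each of the three coordinates the small space has at most M^3
  such pairs, and each lands in the given cycles with probability at most T D / N^3. The claim is
  this inequality multiplied by N^2.\<close>

lemma sampling_bound:
  fixes X :: "'j \<Rightarrow> ('i \<Rightarrow> nat) set" and D :: real and d :: nat
  assumes p: "prime p" and J: "card J = 3" and I: "finite I"
    and X: "\<And>j. j \<in> J \<Longrightarrow> X j \<subseteq> modvec p I"
    and deg: "\<And>j v. j \<in> J \<Longrightarrow> real (card {x \<in> cycles p J X. x j = v}) \<le> D"
  defines "N \<equiv> real p ^ card I" and "M \<equiv> real p ^ d"
  shows "M\<^sup>2 * real (card (cycles p J X)) \<le>
    3 * N\<^sup>2 * M powr (1 - c_p3 p) + 3 * M ^ 3 * real (card (cycles p J X)) * D / N"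
proof -
  let ?T = "real (card (cycles p J X))"
  have p0: "0 < p" using p prime_gt_0_nat by blast
  hence N: "0 < N" and M: "0 < M" by (auto simp: N_def M_def)
  have finJ: "finite J" using J by (intro card_ge_0_finite) simp
  define L where "L = {..<d}"
  have L: "finite L" "card L = d" by (simp_all add: L_def)
  define Z where "Z = cycles p J (\<lambda>_. modvec p L)"
  define ZI where "ZI = cycles p J (\<lambda>_. modvec p I)"
  define Acol where "Acol = PiE L (\<lambda>_. modvec p I)"
  define C where "C = cycles p J X"
  have fin: "finite Z" "finite ZI" "finite Acol" "finite C"
    unfolding Z_def ZI_def Acol_def C_def using finJ L I X finite_modvec
    by (auto intro!: finite_cycles finite_PiE)
  have CZI: "C \<subseteq> ZI" unfolding C_def ZI_def using X by (intro cycles_mono)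
  obtain j0 where j0: "j0 \<in> J" using J by fastforce
  have cardZ: "real (card Z) = M\<^sup>2"
    using card_cycles_modvec[OF finJ j0 L(1) p0] J L by (simp add: Z_def M_def)
  have cardZI: "real (card ZI) = N\<^sup>2"
    using card_cycles_modvec[OF finJ j0 I p0] J by (simp add: ZI_def N_def)
  have cardA: "real (card Acol) = N ^ d"
    unfolding Acol_def using L I by (simp add: card_PiE card_modvec N_def)
  define F :: "(nat \<Rightarrow> 'i \<Rightarrow> nat) \<times> ('j \<Rightarrow> 'i \<Rightarrow> nat) \<Rightarrow> ('j \<Rightarrow> nat \<Rightarrow> nat) \<Rightarrow> 'j \<Rightarrow> 'i \<Rightarrow> nat"
    where "F = affine_cycle p L J"
  define S where "S \<omega> = {s \<in> Z. F \<omega> s \<in> C}" for \<omega> :: "(nat \<Rightarrow> 'i \<Rightarrow> nat) \<times> ('j \<Rightarrow> 'i \<Rightarrow> nat)"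
  have finS: "finite (S \<omega>)" for \<omega> using fin by (simp add: S_def)
  define Iso where "Iso \<omega> = {s \<in> S \<omega>. \<forall>s'\<in>S \<omega>. \<forall>j\<in>J. s' j = s j \<longrightarrow> s' = s}" for \<omega>
  define P where "P \<omega> j = {(s, s') \<in> S \<omega> \<times> S \<omega>. s \<noteq> s' \<and> s j = s' j}" for \<omega> j
  define Q where "Q j = {(s, s') \<in> Z \<times> Z. s \<noteq> s' \<and> s j = s' j}" for j
  let ?\<Omega> = "Acol \<times> ZI"
  have fin\<Omega>: "finite ?\<Omega>" using fin by simp
  have finQ: "finite (Q j)" for j by (rule finite_subset[of _ "Z \<times> Z"]) (use fin in \<open>auto simp: Q_def\<close>)
  have total: "(\<Sum>\<omega>\<in>?\<Omega>. real (card (S \<omega>))) = M\<^sup>2 * N ^ d * ?T"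
  proof -
    have "(\<Sum>\<omega>\<in>?\<Omega>. real (card (S \<omega>))) = (\<Sum>A\<in>Acol. \<Sum>a\<in>ZI. \<Sum>s\<in>Z. if F (A, a) s \<in> C then 1 else 0)"
      using fin by (simp add: S_def sum.cartesian_product sum.If_cases Int_def case_prod_beta)
    also have "\<dots> = (\<Sum>A\<in>Acol. \<Sum>s\<in>Z. \<Sum>a\<in>ZI. if F (A, a) s \<in> C then 1 else 0)"
      by (intro sum.cong refl sum.swap)
    also have "\<dots> = (\<Sum>A\<in>Acol. \<Sum>s\<in>Z. real (card {a \<in> ZI. F (A, a) s \<in> C}))"
      using fin by (simp add: sum.If_cases Int_def)
    also have "\<dots> = (\<Sum>A\<in>Acol. \<Sum>s\<in>Z. ?T)"
    proof (intro sum.cong refl)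
      fix A s assume "A \<in> Acol" "s \<in> Z"
      thus "real (card {a \<in> ZI. F (A, a) s \<in> C}) = ?T"
        using card_affine_cycle_translates[OF p0 finJ I, of A L s C] CZI
        by (simp add: Acol_def Z_def ZI_def F_def C_def)
    qed
    also have "\<dots> = M\<^sup>2 * N ^ d * ?T" by (simp add: cardZ cardA)
    finally show ?thesis .
  qed
  \<comment> \<open>A pair is determined by \<open>s\<close> and one further coordinate of
    \<open>s'\<close>, since the zero sum forces the last one.\<close>
  have cardQ: "real (card (Q j)) \<le> M ^ 3" if j: "j \<in> J" for j
  proof -
    have "card (J - {j}) = 2" using J j finJ by simp
    hence "J - {j} \<noteq> {}" by (metis card.empty zero_neq_numeral)
    then obtain j' where j': "j' \<in> J" "j' \<noteq> j" by blast
    have "inj_on (\<lambda>(s, s'). (s, s' j')) (Q j)"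
    proof (rule inj_onI)
      fix q r assume qr: "q \<in> Q j" "r \<in> Q j" "(case q of (s, s') \<Rightarrow> (s, s' j')) = (case r of (s, s') \<Rightarrow> (s, s' j'))"
      obtain s s' t' where q: "q = (s, s')" "r = (s, t')" using qr(3) by (cases q, cases r) auto
      have s: "s' \<in> Z" "t' \<in> Z" "s' j = t' j" "s' j' = t' j'" using qr q by (auto simp: Q_def)
      have "card (J - {j, j'}) = 1" using J j j' finJ by (simp add: card_Diff_subset)
      then obtain j'' where j'': "J - {j, j'} = {j''}" using card_1_singletonE by blast
      have "s' = t'"
        using s j'' by (intro cycles_eqI[of J j'' "\<lambda>_. modvec p L" p L]) (auto simp: Z_def finJ)
      thus "q = r" using q by simp
    qed
    moreover have "(\<lambda>(s, s'). (s, s' j')) ` Q j \<subseteq> Z \<times> modvec p L"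
      using j' by (auto simp: Q_def Z_def cycles_def)
    moreover have "finite (Z \<times> modvec p L)" using fin L finite_modvec by auto
    ultimately have "card (Q j) \<le> card (Z \<times> modvec p L)" by (rule card_inj_on_le)
    hence "real (card (Q j)) \<le> real (card (Z \<times> modvec p L))" by simp
    also have "\<dots> = M\<^sup>2 * M" using cardZ L by (simp add: card_cartesian_product card_modvec M_def)
    finally show ?thesis by (simp add: power3_eq_cube power2_eq_square)
  qed
  \<comment> \<open>The two images share their \<open>j\<close>-th coordinate, so at most
    \<open>?T * D\<close> pairs of cycles can occur as images, each for at most
    \<open>N ^ d / N\<close> parameters.\<close>
  have pair: "real (card {\<omega> \<in> ?\<Omega>. F \<omega> s \<in> C \<and> F \<omega> s' \<in> C}) \<le> ?T * D * N ^ d / N"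
    if "(s, s') \<in> Q j" "j \<in> J" for s s' j
  proof -
    have s: "s \<in> Z" "s' \<in> Z" "s \<noteq> s'" "s j = s' j" using that by (auto simp: Q_def)
    have "\<exists>j'\<in>J. s j' \<noteq> s' j'"
    proof (rule ccontr)
      assume "\<not> ?thesis"
      moreover have "s \<in> PiE J (\<lambda>_. modvec p L)" "s' \<in> PiE J (\<lambda>_. modvec p L)"
        using s by (simp_all add: Z_def cycles_def)
      ultimately have "s = s'" by (meson PiE_ext)
      with s show False by simp
    qed
    then obtain j' where j': "j' \<in> J" "s j' \<noteq> s' j'" by blast
    define G where "G x x' = {\<omega> \<in> ?\<Omega>. F \<omega> s = x \<and> F \<omega> s' = x'}" for x x'
    have G: "real (card (G x x')) \<le> N ^ d / N" for x x'
    proof -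
      have "card (G x x') * p ^ card I \<le> (p ^ card I) ^ d"
        using card_affine_cycle_two_points[OF p finJ I L(1), of s s' j' x x'] s j' L
        by (simp add: G_def Z_def ZI_def Acol_def F_def)
      hence "real (card (G x x') * p ^ card I) \<le> real ((p ^ card I) ^ d)" by (simp only: of_nat_le_iff)
      thus ?thesis using N by (simp add: N_def pos_le_divide_eq)
    qed
    have finG: "finite (G x x')" for x x' unfolding G_def using fin\<Omega> by simp
    have "{\<omega> \<in> ?\<Omega>. F \<omega> s \<in> C \<and> F \<omega> s' \<in> C} \<subseteq> (\<Union>x\<in>C. \<Union>x'\<in>{x' \<in> C. x' j = x j}. G x x')"
    proof
      fix \<omega> assume \<omega>: "\<omega> \<in> {\<omega> \<in> ?\<Omega>. F \<omega> s \<in> C \<and> F \<omega> s' \<in> C}"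
      have "F \<omega> s' j = F \<omega> s j" using s that by (simp add: F_def affine_cycle_def)
      thus "\<omega> \<in> (\<Union>x\<in>C. \<Union>x'\<in>{x' \<in> C. x' j = x j}. G x x')" using \<omega> by (auto simp: G_def)
    qed
    hence "card {\<omega> \<in> ?\<Omega>. F \<omega> s \<in> C \<and> F \<omega> s' \<in> C} \<le> card (\<Union>x\<in>C. \<Union>x'\<in>{x' \<in> C. x' j = x j}. G x x')"
      using fin finG by (intro card_mono) auto
    also have "\<dots> \<le> (\<Sum>x\<in>C. card (\<Union>x'\<in>{x' \<in> C. x' j = x j}. G x x'))" using fin by (intro card_UN_le)
    also have "\<dots> \<le> (\<Sum>x\<in>C. \<Sum>x'\<in>{x' \<in> C. x' j = x j}. card (G x x'))"
      using fin by (intro sum_mono card_UN_le) auto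
    finally have "real (card {\<omega> \<in> ?\<Omega>. F \<omega> s \<in> C \<and> F \<omega> s' \<in> C}) \<le>
        real (\<Sum>x\<in>C. \<Sum>x'\<in>{x' \<in> C. x' j = x j}. card (G x x'))" by (simp only: of_nat_le_iff)
    also have "\<dots> = (\<Sum>x\<in>C. \<Sum>x'\<in>{x' \<in> C. x' j = x j}. real (card (G x x')))" by simp
    also have "\<dots> \<le> (\<Sum>x\<in>C. \<Sum>x'\<in>{x' \<in> C. x' j = x j}. N ^ d / N)" by (intro sum_mono G)
    also have "\<dots> = (\<Sum>x\<in>C. real (card {x' \<in> C. x' j = x j}) * (N ^ d / N))" by simp
    also have "\<dots> \<le> (\<Sum>x\<in>C. D * (N ^ d / N))"
      using deg[OF that(2)] N by (intro sum_mono mult_right_mono) (auto simp: C_def)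
    also have "\<dots> = ?T * D * N ^ d / N" by (simp add: C_def)
    finally show ?thesis .
  qed
  have D0: "0 \<le> D" using deg[OF j0, of undefined] of_nat_0_le_iff order_trans by blast
  have pairs: "(\<Sum>\<omega>\<in>?\<Omega>. real (card (P \<omega> j))) \<le> M ^ 3 * (?T * D * N ^ d / N)" if j: "j \<in> J" for j
  proof -
    have "(\<Sum>\<omega>\<in>?\<Omega>. real (card (P \<omega> j))) = (\<Sum>\<omega>\<in>?\<Omega>. \<Sum>q\<in>Q j. if F \<omega> (fst q) \<in> C \<and> F \<omega> (snd q) \<in> C then 1 else 0)"
    proof (intro sum.cong refl)
      fix \<omega>
      have "P \<omega> j = {q \<in> Q j. F \<omega> (fst q) \<in> C \<and> F \<omega> (snd q) \<in> C}" by (auto simp: P_def Q_def S_def)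
      thus "real (card (P \<omega> j)) = (\<Sum>q\<in>Q j. if F \<omega> (fst q) \<in> C \<and> F \<omega> (snd q) \<in> C then 1 else 0)"
        using finQ by (simp add: sum.If_cases Int_def)
    qed
    also have "\<dots> = (\<Sum>q\<in>Q j. \<Sum>\<omega>\<in>?\<Omega>. if F \<omega> (fst q) \<in> C \<and> F \<omega> (snd q) \<in> C then 1 else 0)" by (rule sum.swap)
    also have "\<dots> = (\<Sum>q\<in>Q j. real (card {\<omega> \<in> ?\<Omega>. F \<omega> (fst q) \<in> C \<and> F \<omega> (snd q) \<in> C}))"
      using fin\<Omega> by (simp add: sum.If_cases Int_def del: mem_Sigma_iff)
    also have "\<dots> \<le> (\<Sum>q\<in>Q j. ?T * D * N ^ d / N)" using pair j by (intro sum_mono) auto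
    also have "\<dots> = real (card (Q j)) * (?T * D * N ^ d / N)" by simp
    also have "\<dots> \<le> M ^ 3 * (?T * D * N ^ d / N)"
      using cardQ[OF j] D0 N by (intro mult_right_mono) auto
    finally show ?thesis .
  qed
  have "M\<^sup>2 * N ^ d * ?T = (\<Sum>\<omega>\<in>?\<Omega>. real (card (S \<omega>)))" by (rule total[symmetric])
  also have "\<dots> \<le> (\<Sum>\<omega>\<in>?\<Omega>. real (card (Iso \<omega>)) + (\<Sum>j\<in>J. real (card (P \<omega> j))))"
  proof (rule sum_mono)
    fix \<omega>
    have "real (card (S \<omega>)) \<le> real (card (Iso \<omega>) + (\<Sum>j\<in>J. card (P \<omega> j)))"
      unfolding of_nat_le_iff Iso_def P_def by (rule card_nonisolated_le[OF finS finJ])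
    thus "real (card (S \<omega>)) \<le> real (card (Iso \<omega>)) + (\<Sum>j\<in>J. real (card (P \<omega> j)))" by simp
  qed
  also have "\<dots> = (\<Sum>\<omega>\<in>?\<Omega>. real (card (Iso \<omega>))) + (\<Sum>j\<in>J. \<Sum>\<omega>\<in>?\<Omega>. real (card (P \<omega> j)))"
    unfolding sum.distrib by (simp only: sum.swap[of _ J ?\<Omega>])
  also have "\<dots> \<le> (\<Sum>\<omega>\<in>?\<Omega>. 3 * M powr (1 - c_p3 p)) + (\<Sum>j\<in>J. M ^ 3 * (?T * D * N ^ d / N))"
  proof (intro add_mono sum_mono pairs)
    fix \<omega> assume "\<omega> \<in> ?\<Omega>"
    then obtain A a where "\<omega> = (A, a)" "A \<in> Acol" "a \<in> ZI" by auto
    thus "real (card (Iso \<omega>)) \<le> 3 * M powr (1 - c_p3 p)"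
      using card_isolated_le[OF p J L(1), of a I A "S \<omega>" X] L(2)
      by (simp add: Acol_def ZI_def Iso_def S_def Z_def F_def C_def M_def)
  qed
  also have "\<dots> = N ^ d * (3 * N\<^sup>2 * M powr (1 - c_p3 p) + 3 * M ^ 3 * ?T * D / N)"
    using J by (simp add: card_cartesian_product cardA cardZI algebra_simps)
  finally have "N ^ d * (M\<^sup>2 * ?T) \<le> N ^ d * (3 * N\<^sup>2 * M powr (1 - c_p3 p) + 3 * M ^ 3 * ?T * D / N)"
    by (simp add: mult_ac)
  thus ?thesis using N by (subst (asm) mult_le_cancel_left_pos) auto
qed

section \<open>Degrees and disjoint cycles\<close>

definition disjoint_cycles :: "'j set \<Rightarrow> ('j \<Rightarrow> 'a) set \<Rightarrow> bool" where
  "disjoint_cycles J A \<longleftrightarrow> (\<forall>x\<in>A. \<forall>y\<in>A. x \<noteq> y \<longrightarrow> (\<forall>j\<in>J. x j \<noteq> y j))"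

text \<open>Both bounds are used with \<open>r = card J - 2\<close> and \<open>\<theta> = r / c\<close>, for which \<open>1 + \<theta>\<close> is \<open>C_pk\<close>.\<close>

definition degree_bound :: "nat \<Rightarrow> real \<Rightarrow> real \<Rightarrow> real \<Rightarrow> 'j set \<Rightarrow> 'i set \<Rightarrow> bool" where
  "degree_bound p \<kappa> r \<theta> J I \<longleftrightarrow> (\<forall>X D. (\<forall>j\<in>J. X j \<subseteq> modvec p I) \<longrightarrow>
     (\<forall>j\<in>J. \<forall>v. real (card {x \<in> cycles p J X. x j = v}) \<le> D) \<longrightarrow>
     \<kappa> * real (card (cycles p J X)) powr \<theta> * (real p ^ card I) powr (r - \<theta>) \<le> D powr (1 + \<theta>))"

definition matching_bound :: "nat \<Rightarrow> real \<Rightarrow> real \<Rightarrow> real \<Rightarrow> 'j set \<Rightarrow> 'i set \<Rightarrow> bool" where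
  "matching_bound p \<kappa> r \<theta> J I \<longleftrightarrow> (\<forall>A. A \<subseteq> cycles p J (\<lambda>_. modvec p I) \<longrightarrow> disjoint_cycles J A \<longrightarrow>
     \<kappa> * real (card A) powr (1 + \<theta>) * (real p ^ card I) powr (r - \<theta>)
       \<le> real (card (cycles p J (\<lambda>j. (\<lambda>x. x j) ` A))))"

lemma card_cycles_le_degree_sum:
  assumes "finite J" "finite I" "\<And>j. j \<in> J \<Longrightarrow> X j \<subseteq> modvec p I" "j \<in> J"
    and deg: "\<And>v. real (card {x \<in> cycles p J X. x j = v}) \<le> D"
  shows "real (card (cycles p J X)) \<le> real p ^ card I * D"
proof -
  have fin: "finite (cycles p J X)" using assms by (intro finite_cycles)
  have "(\<lambda>x. x j) ` cycles p J X \<subseteq> X j" using assms(4) by (auto simp: cycles_def)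
  also have "\<dots> \<subseteq> modvec p I" by (rule assms(3)[OF assms(4)])
  finally have "card (cycles p J X) = (\<Sum>v\<in>modvec p I. card {x \<in> cycles p J X. x j = v})"
    using sum.group[OF fin finite_modvec[OF assms(2)], of "\<lambda>x. x j" p "\<lambda>_. 1::nat"] by simp
  hence "real (card (cycles p J X)) = (\<Sum>v\<in>modvec p I. real (card {x \<in> cycles p J X. x j = v}))" by simp
  also have "\<dots> \<le> (\<Sum>v\<in>modvec p I. D)" by (intro sum_mono deg)
  also have "\<dots> = real p ^ card I * D" using assms(2) by (simp add: card_modvec)
  finally show ?thesis .
qed

lemma degree_ge_1:
  assumes "finite (cycles p J X)" "cycles p J X \<noteq> {}"
    and deg: "\<And>v. real (card {x \<in> cycles p J X. x j = v}) \<le> D"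
  shows "1 \<le> D"
proof -
  obtain x where "x \<in> cycles p J X" using assms(2) by blast
  hence "{y \<in> cycles p J X. y j = x j} \<noteq> {}" by blast
  hence "1 \<le> card {y \<in> cycles p J X. y j = x j}" using assms(1) by (simp add: Suc_le_eq card_gt_0_iff)
  thus ?thesis using deg[of "x j"] by linarith
qed

text \<open>Let \<open>M\<close> be the largest power of \<open>p\<close> that is at most N / (6 D).
  Then the pairs sharing a vertex account for at most half of the sample, and
  \<open>sampling_bound\<close> leaves T <= 6 N^2 M powr (-1 - c). Since M exceeds N / (6 p D),
  raising this to the power \<theta> gives the claim. If \<open>N < 6 * D\<close> there is no room
  for sampling, but then the trivial bound \<open>T \<le> N * D\<close> is strong enough.\<close>

lemma degree_bound_3:
  fixes p :: nat
  assumes p: "prime p"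
  defines "\<theta> \<equiv> 1 / c_p3 p"
  shows "\<exists>\<kappa>>0. \<forall>(J::'j set) (I::'i set). finite I \<longrightarrow> card J = 3 \<longrightarrow> degree_bound p \<kappa> 1 \<theta> J I"
proof -
  define c where "c = c_p3 p"
  have p1: "1 < p" using p prime_gt_1_nat by blast
  hence P: "1 < real p" by simp
  have c: "0 < c" unfolding c_def by (rule c_p3_pos[OF p1])
  have \<theta>: "0 < \<theta>" "\<theta> * c = 1" using c by (simp_all add: \<theta>_def c_def[symmetric])
  \<comment> \<open>The first term pays for the factor 6 in
    \<open>M\<^sup>2 * T \<le> 6 * N\<^sup>2 * M powr (1 - c)\<close>, raised to \<theta>; the
    second for the factor \<open>6 * real p\<close> in \<open>N \<le> M * (6 * real p) * D\<close>,
    raised to 1 + \<theta>.\<close>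
  define \<kappa> where "\<kappa> = exp (- \<theta> * ln 6 - (1 + \<theta>) * ln (6 * real p))"
  have ln\<kappa>: "ln \<kappa> = - \<theta> * ln 6 - (1 + \<theta>) * ln (6 * real p)" and \<kappa>: "0 < \<kappa>" by (simp_all add: \<kappa>_def)
  have ln6: "0 < ln (6::real)" by simp
  have lnp: "ln (6 * real p) = ln 6 + ln (real p)" and lnp0: "0 < ln (real p)" using P by (simp_all add: ln_mult)
  have "degree_bound p \<kappa> 1 \<theta> J I" if I: "finite I" and J: "card J = 3" for J :: "'j set" and I :: "'i set"
    unfolding degree_bound_def
  proof (intro allI impI)
    fix X :: "'j \<Rightarrow> ('i \<Rightarrow> nat) set" and D :: real
    assume X: "\<forall>j\<in>J. X j \<subseteq> modvec p I"
      and deg: "\<forall>j\<in>J. \<forall>v. real (card {x \<in> cycles p J X. x j = v}) \<le> D"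
    define N where "N = real p ^ card I"
    define T where "T = real (card (cycles p J X))"
    have N: "1 \<le> N" using P by (simp add: N_def)
    have finJ: "finite J" using J by (intro card_ge_0_finite) simp
    obtain j0 where j0: "j0 \<in> J" using J by fastforce
    have fin: "finite (cycles p J X)" using finJ I X by (intro finite_cycles) auto
    show "\<kappa> * T powr \<theta> * N powr (1 - \<theta>) \<le> D powr (1 + \<theta>)"
    proof (cases "cycles p J X = {}")
      case True
      thus ?thesis by (simp add: T_def)
    next
      case ne: False
      have T: "1 \<le> T" using ne fin by (simp add: T_def Suc_le_eq card_gt_0_iff)
      have D: "1 \<le> D" using degree_ge_1[OF fin ne, of j0 D] deg j0 by blast
      have goal: ?thesis if "ln \<kappa> + \<theta> * ln T + (1 - \<theta>) * ln N \<le> (1 + \<theta>) * ln D"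
      proof -
        have "ln (\<kappa> * T powr \<theta> * N powr (1 - \<theta>)) = ln \<kappa> + \<theta> * ln T + (1 - \<theta>) * ln N"
          using \<kappa> T N by (simp add: ln_mult ln_powr)
        also have "\<dots> \<le> ln (D powr (1 + \<theta>))" using that D by (simp add: ln_powr)
        finally show ?thesis using \<kappa> T N D by (subst (asm) ln_le_cancel_iff) auto
      qed
      show ?thesis
      proof (cases "N < 6 * D")
        case True
        have "T \<le> N * D" unfolding T_def N_def
          using card_cycles_le_degree_sum[OF finJ I, of X p j0 D] X deg j0 by blast
        hence "ln T \<le> ln (N * D)" using T N D by (subst ln_le_cancel_iff) auto
        hence "ln T \<le> ln N + ln D" using N D by (simp add: ln_mult)
        hence 1: "\<theta> * ln T \<le> \<theta> * (ln N + ln D)" using \<theta> by (intro mult_left_mono) auto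
        have "ln N \<le> ln (6 * D)" using True N D by (subst ln_le_cancel_iff) auto
        hence 2: "ln N \<le> ln 6 + ln D" using D by (simp add: ln_mult)
        have "ln \<kappa> \<le> - ln 6"
        proof -
          have "0 \<le> \<theta> * ln 6" "0 \<le> \<theta> * ln (6 * real p)" using \<theta> ln6 lnp lnp0 by auto
          thus ?thesis unfolding ln\<kappa> using lnp lnp0 by (simp add: distrib_right)
        qed
        with 1 2 show ?thesis by (intro goal) (simp add: algebra_simps)
      next
        case False
        hence y: "1 \<le> N / (6 * D)" using D by (simp add: pos_le_divide_eq)
        obtain n where n: "N / (6 * D) < real p ^ n" and nmin: "\<And>m. m < n \<Longrightarrow> real p ^ m \<le> N / (6 * D)"
        proof -
          have "\<exists>n. N / (6 * D) < real p ^ n" using real_arch_pow[OF P] by blast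
          from LeastI_ex[OF this] show thesis
            by (intro that[of "LEAST n. N / (6 * D) < real p ^ n"]) (auto dest: not_less_Least)
        qed
        have "n \<noteq> 0" using n y by (intro notI) simp
        then obtain d where d: "n = Suc d" using not0_implies_Suc by blast
        define M where "M = real p ^ d"
        have M: "1 \<le> M" "M \<le> N / (6 * D)" "N / (6 * D) < real p * M"
          using nmin[of d] n P by (simp_all add: M_def d)
        have "M\<^sup>2 * T \<le> 3 * N\<^sup>2 * M powr (1 - c) + 3 * M ^ 3 * T * D / N"
          using sampling_bound[OF p J I, of X D d] X deg by (simp add: T_def N_def M_def c_def)
        moreover have "3 * M ^ 3 * T * D / N \<le> M\<^sup>2 * T / 2"
        proof -
          have "6 * D * M \<le> N" using M(2) D by (simp add: pos_le_divide_eq mult_ac)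
          hence "M\<^sup>2 * T * (6 * D * M) \<le> M\<^sup>2 * T * N" using T by (intro mult_left_mono) auto
          thus ?thesis using N by (simp add: field_simps power3_eq_cube power2_eq_square)
        qed
        ultimately have "M\<^sup>2 * T \<le> 6 * N\<^sup>2 * M powr (1 - c)" by linarith
        hence "ln (M\<^sup>2 * T) \<le> ln (6 * N\<^sup>2 * M powr (1 - c))" using M T N by (subst ln_le_cancel_iff) auto
        hence "2 * ln M + ln T \<le> ln 6 + 2 * ln N + (1 - c) * ln M"
          using M T N by (simp add: ln_mult ln_powr ln_realpow)
        hence "\<theta> * ln T \<le> \<theta> * (ln 6 + 2 * ln N - (1 + c) * ln M)"
          using \<theta> by (intro mult_left_mono) (auto simp: algebra_simps)
        also have "\<dots> = \<theta> * ln 6 + 2 * \<theta> * ln N - (\<theta> + \<theta> * c) * ln M" by (simp add: algebra_simps)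
        finally have 1: "\<theta> * ln T \<le> \<theta> * ln 6 + 2 * \<theta> * ln N - (1 + \<theta>) * ln M" unfolding \<theta> by (simp add: add.commute)
        have "N \<le> M * (6 * real p) * D" using M(3) D by (simp add: pos_divide_less_eq mult_ac)
        hence "ln N \<le> ln (M * (6 * real p) * D)" using N M D P by (subst ln_le_cancel_iff) auto
        hence "ln N \<le> ln M + ln (6 * real p) + ln D" using N M D P by (simp add: ln_mult)
        hence "(1 + \<theta>) * ln N \<le> (1 + \<theta>) * (ln M + ln (6 * real p) + ln D)"
          using \<theta> by (intro mult_left_mono) auto
        with 1 show ?thesis by (intro goal) (simp add: ln\<kappa> algebra_simps)
      qed
    qed
  qed
  with \<kappa> show ?thesis by blast
qed

text \<open>Concavity: the graph of the power lies below its tangent at \<open>T\<close>. After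
  division by \<open>T powr \<gamma>\<close> this is Bernoulli's inequality for \<open>u\<close>,
  obtained from Young's inequality with second entry 1.\<close>

lemma powr_decrement:
  fixes \<gamma> T D :: real
  assumes "0 < \<gamma>" "\<gamma> \<le> 1" "0 \<le> D" "D \<le> T" "0 < T"
  shows "(T - D) powr \<gamma> \<le> T powr \<gamma> - \<gamma> * D * T powr (\<gamma> - 1)"
proof -
  define u where "u = 1 - D / T"
  have u: "0 \<le> u" "T - D = T * u" using assms by (auto simp: u_def field_simps)
  have "u powr \<gamma> \<le> 1 - \<gamma> * (D / T)"
  proof (cases "u = 0")
    case True
    hence "D / T = 1" by (simp add: u_def)
    thus ?thesis using True assms by simp
  next
    case False
    hence "u powr \<gamma> * 1 powr (1 - \<gamma>) \<le> \<gamma> * u + (1 - \<gamma>) * 1"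
      using assms u by (intro Youngs_inequality_0) auto
    thus ?thesis by (simp add: u_def algebra_simps)
  qed
  hence "T powr \<gamma> * u powr \<gamma> \<le> T powr \<gamma> * (1 - \<gamma> * (D / T))" by (intro mult_left_mono) auto
  also have "\<dots> = T powr \<gamma> - \<gamma> * D * (T powr \<gamma> / T)" by (simp add: field_simps)
  also have "T powr \<gamma> / T = T powr (\<gamma> - 1)" using assms by (simp add: powr_diff)
  finally show ?thesis using u assms by (simp add: powr_mult)
qed

text \<open>Deleting a vertex of maximum degree destroys many cycles but meets at most one member of a
  disjoint family; \<open>powr_decrement\<close> turns this into a bound on the number of deletions.\<close>

lemma card_disjoint_cycles_le:
  fixes I :: "'i set" and J :: "'j set"
  assumes J: "finite J" and I: "finite I" and B: "0 < B" and \<gamma>: "0 < \<gamma>" "\<gamma> \<le> 1"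
    and step: "\<And>X. \<lbrakk>\<And>j. j \<in> J \<Longrightarrow> X j \<subseteq> modvec p I; cycles p J X \<noteq> {}\<rbrakk> \<Longrightarrow>
      \<exists>j\<in>J. \<exists>v. B * real (card (cycles p J X)) powr (1 - \<gamma>) \<le> real (card {x \<in> cycles p J X. x j = v})"
    and X: "\<And>j. j \<in> J \<Longrightarrow> X j \<subseteq> modvec p I" and A: "A \<subseteq> cycles p J X" "disjoint_cycles J A"
  shows "\<gamma> * B * real (card A) \<le> real (card (cycles p J X)) powr \<gamma>"
  using X A
proof (induction "card (cycles p J X)" arbitrary: X A rule: less_induct)
  case less
  let ?C = "cycles p J X"
  have fin: "finite ?C" using J I less.prems(1) by (rule finite_cycles)
  have finA: "finite A" using finite_subset[OF less.prems(2) fin] .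
  show ?case
  proof (cases "?C = {}")
    case True
    thus ?thesis using less.prems by simp
  next
    case False
    hence T: "0 < real (card ?C)" using fin by (simp add: card_gt_0_iff)
    obtain j v where j: "j \<in> J" and deg: "B * real (card ?C) powr (1 - \<gamma>) \<le> real (card {x \<in> ?C. x j = v})"
      using step[OF less.prems(1) False] by blast
    define R where "R = {x \<in> ?C. x j = v}"
    have R: "finite R" "R \<subseteq> ?C" using fin by (auto simp: R_def)
    have "0 < B * real (card ?C) powr (1 - \<gamma>)" using B T by simp
    hence R0: "0 < card R" using deg by (simp add: R_def)
    define X' where "X' = X(j := X j - {v})"
    have C': "cycles p J X' = ?C - R"
      using j by (auto simp: cycles_def X'_def R_def PiE_def Pi_def)
    hence cardC': "card (cycles p J X') = card ?C - card R" using R by (simp add: card_Diff_subset)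
    have le: "card R \<le> card ?C" using R fin by (simp add: card_mono)
    define A' where "A' = {x \<in> A. x j \<noteq> v}"
    have "card (A - A') \<le> 1"
    proof (rule ccontr)
      assume "\<not> ?thesis"
      hence "\<not> (\<exists>x. A - A' \<subseteq> {x})" using card_mono[of "{_}" "A - A'"] by fastforce
      then obtain x y where "x \<in> A - A'" "y \<in> A - A'" "x \<noteq> y" by blast
      thus False using less.prems(3) j by (auto simp: A'_def disjoint_cycles_def)
    qed
    moreover have "card A = card A' + card (A - A')"
      using finA by (subst card_Un_disjoint[symmetric]) (auto simp: A'_def intro: arg_cong[where f = card])
    ultimately have cardA: "real (card A) \<le> real (card A') + 1" by linarith
    have "\<gamma> * B * real (card A') \<le> real (card (cycles p J X')) powr \<gamma>"
    proof (rule less.hyps)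
      show "card (cycles p J X') < card ?C" using cardC' R0 le by simp
      show "X' k \<subseteq> modvec p I" if "k \<in> J" for k using less.prems(1)[OF that] by (auto simp: X'_def)
      show "A' \<subseteq> cycles p J X'" using less.prems(2) unfolding C' by (auto simp: A'_def R_def)
      show "disjoint_cycles J A'" using less.prems(3) by (auto simp: A'_def disjoint_cycles_def)
    qed
    also have "\<dots> = (real (card ?C) - real (card R)) powr \<gamma>" using cardC' le by (simp add: of_nat_diff)
    also have "\<dots> \<le> real (card ?C) powr \<gamma> - \<gamma> * real (card R) * real (card ?C) powr (\<gamma> - 1)"
      using \<gamma> le T by (intro powr_decrement) auto
    \<comment> \<open>The number of cycles raised to \<gamma> serves as a potential. As
      \<open>R\<close> has at least \<open>B * real (card ?C) powr (1 - \<gamma>)\<close> elements,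
      a deletion lowers it by at least \<open>\<gamma> * B\<close>, which pays for the one member
      that \<open>A\<close> may lose.\<close>
    also have "\<dots> \<le> real (card ?C) powr \<gamma> - \<gamma> * B"
    proof -
      have "B = B * real (card ?C) powr (1 - \<gamma>) * real (card ?C) powr (\<gamma> - 1)"
        using T by (simp add: powr_add[symmetric])
      also have "\<dots> \<le> real (card R) * real (card ?C) powr (\<gamma> - 1)"
        using deg by (intro mult_right_mono) (auto simp: R_def)
      finally have "\<gamma> * B \<le> \<gamma> * (real (card R) * real (card ?C) powr (\<gamma> - 1))"
        using \<gamma> by (intro mult_left_mono) auto
      thus ?thesis by simp
    qed
    finally have "\<gamma> * B * real (card A') + \<gamma> * B \<le> real (card ?C) powr \<gamma>" by simp
    moreover have "\<gamma> * B * real (card A) \<le> \<gamma> * B * (real (card A') + 1)"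
      using cardA \<gamma> B by (intro mult_left_mono) auto
    ultimately show ?thesis by (simp add: distrib_left)
  qed
qed

text \<open>Solving the degree bound for \<open>D\<close> gives a vertex of degree at least
  \<open>B * T powr (1 - \<gamma>)\<close> with \<gamma> = 1 / (1 + \<theta>). Since the degree
  bound covers all families of sets, it persists during deletions. The outcome
  \<open>\<gamma> * B * m \<le> T powr \<gamma>\<close>, raised to 1 + \<theta>, costs only the
  factor \<open>\<gamma> powr (1 + \<theta>)\<close>.\<close>

lemma matching_bound_of_degree_bound:
  fixes I :: "'i set" and J :: "'j set"
  assumes p: "0 < p" and J: "finite J" "J \<noteq> {}" and I: "finite I" and \<kappa>: "0 < \<kappa>" and \<theta>: "0 \<le> \<theta>"
    and db: "degree_bound p \<kappa> r \<theta> J I"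
  shows "matching_bound p (\<kappa> / (1 + \<theta>) powr (1 + \<theta>)) r \<theta> J I"
  unfolding matching_bound_def
proof (intro allI impI)
  fix A assume A: "A \<subseteq> cycles p J (\<lambda>_. modvec p I)" and dis: "disjoint_cycles J A"
  define N where "N = real p ^ card I"
  have N: "0 < N" using p by (simp add: N_def)
  define \<gamma> where "\<gamma> = 1 / (1 + \<theta>)"
  have \<gamma>: "0 < \<gamma>" "\<gamma> \<le> 1" "(1 + \<theta>) * \<gamma> = 1" "\<theta> * \<gamma> = 1 - \<gamma>" using \<theta> by (auto simp: \<gamma>_def field_simps)
  define B where "B = (\<kappa> * N powr (r - \<theta>)) powr \<gamma>"
  have B: "0 < B" using \<kappa> N by (simp add: B_def)
  define X where "X j = (\<lambda>x. x j) ` A" for j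
  have X: "X j \<subseteq> modvec p I" if "j \<in> J" for j using A that by (auto simp: X_def cycles_def)
  have AX: "A \<subseteq> cycles p J X" using A by (auto simp: cycles_def X_def PiE_def)
  let ?T = "real (card (cycles p J X))"
  have "\<gamma> * B * real (card A) \<le> ?T powr \<gamma>"
  proof (rule card_disjoint_cycles_le[OF J(1) I B \<gamma>(1,2) _ X AX dis])
    fix Y :: "'j \<Rightarrow> ('i \<Rightarrow> nat) set" assume Y: "\<And>j. j \<in> J \<Longrightarrow> Y j \<subseteq> modvec p I" and ne: "cycles p J Y \<noteq> {}"
    let ?deg = "\<lambda>j v. card {x \<in> cycles p J Y. x j = v}"
    have fin: "finite (J \<times> modvec p I)" using J finite_modvec[OF I] by blast
    have "(\<lambda>_. 0) \<in> modvec p I" using p by (simp add: modvec_def)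
    hence "J \<times> modvec p I \<noteq> {}" using J by auto
    from ex_max_on[OF fin this, of "\<lambda>q. ?deg (fst q) (snd q)"] have "\<exists>q\<in>J \<times> modvec p I. \<forall>q'\<in>J \<times> modvec p I. ?deg (fst q') (snd q') \<le> ?deg (fst q) (snd q)" .
    then obtain q where q: "q \<in> J \<times> modvec p I"
      "\<And>q'. q' \<in> J \<times> modvec p I \<Longrightarrow> ?deg (fst q') (snd q') \<le> ?deg (fst q) (snd q)"
      by blast
    define D where "D = real (?deg (fst q) (snd q))"
    have deg: "real (?deg j v) \<le> D" if "j \<in> J" for j v
    proof (cases "v \<in> modvec p I")
      case True thus ?thesis using q(2)[of "(j, v)"] that by (simp add: D_def)
    next
      case False
      hence "{x \<in> cycles p J Y. x j = v} = {}" using Y[OF that] that by (auto simp: cycles_def)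
      thus ?thesis by (simp only: card.empty D_def of_nat_0 of_nat_0_le_iff)
    qed
    have "\<kappa> * real (card (cycles p J Y)) powr \<theta> * N powr (r - \<theta>) \<le> D powr (1 + \<theta>)"
      using db Y deg unfolding degree_bound_def N_def by blast
    hence "(\<kappa> * real (card (cycles p J Y)) powr \<theta> * N powr (r - \<theta>)) powr \<gamma> \<le> (D powr (1 + \<theta>)) powr \<gamma>"
      using \<kappa> \<gamma> by (intro powr_mono2) auto
    also have "\<dots> = D" using \<gamma> by (simp add: powr_powr D_def)
    also have "(\<kappa> * real (card (cycles p J Y)) powr \<theta> * N powr (r - \<theta>)) powr \<gamma> = B * real (card (cycles p J Y)) powr (1 - \<gamma>)"
      using \<kappa> N by (simp add: B_def powr_mult powr_powr \<gamma>(4))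
    finally have "B * real (card (cycles p J Y)) powr (1 - \<gamma>) \<le> real (?deg (fst q) (snd q))" by (simp add: D_def)
    thus "\<exists>j\<in>J. \<exists>v. B * real (card (cycles p J Y)) powr (1 - \<gamma>) \<le> real (?deg j v)" using q(1) by auto
  qed
  moreover have "\<gamma> * (1 + \<theta>) = 1" using \<gamma>(3) by (simp only: mult.commute)
  hence BE: "B powr (1 + \<theta>) = \<kappa> * N powr (r - \<theta>)"
    using \<kappa> by (simp add: B_def powr_powr)
  ultimately have "(\<gamma> * B * real (card A)) powr (1 + \<theta>) \<le> (?T powr \<gamma>) powr (1 + \<theta>)"
    using \<theta> \<gamma> B by (intro powr_mono2) auto
  also have "\<dots> = ?T" using \<gamma>(3) by (simp add: powr_powr mult.commute)
  also have "(\<gamma> * B * real (card A)) powr (1 + \<theta>) = \<gamma> powr (1 + \<theta>) * (\<kappa> * N powr (r - \<theta>)) * real (card A) powr (1 + \<theta>)"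
    using \<gamma>(1) B by (simp add: powr_mult BE)
  also have "\<gamma> powr (1 + \<theta>) = 1 / (1 + \<theta>) powr (1 + \<theta>)" using \<theta> by (simp add: \<gamma>_def powr_divide)
  finally show "\<kappa> / (1 + \<theta>) powr (1 + \<theta>) * real (card A) powr (1 + \<theta>) * (real p ^ card I) powr (r - \<theta>)
       \<le> real (card (cycles p J (\<lambda>j. (\<lambda>x. x j) ` A)))"
    by (simp add: N_def X_def[abs_def] mult_ac)
qed

section \<open>Sums of two coordinates\<close>

definition pair_sum :: "nat \<Rightarrow> 'j \<Rightarrow> 'j \<Rightarrow> ('j \<Rightarrow> 'i \<Rightarrow> nat) \<Rightarrow> 'i \<Rightarrow> nat" where
  "pair_sum p a b x = (\<lambda>i. (x a i + x b i) mod p)"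

definition agreeing :: "('j \<Rightarrow> 'a) set \<Rightarrow> 'j set \<Rightarrow> ('j \<Rightarrow> 'a) \<Rightarrow> ('j \<Rightarrow> 'a) set" where
  "agreeing C S x = {y \<in> C. \<forall>j\<in>S. y j = x j}"

definition merge_pair :: "'j set \<Rightarrow> 'j \<Rightarrow> 'j \<Rightarrow> ('j \<Rightarrow> 'a) \<Rightarrow> ('j \<Rightarrow> 'a) \<Rightarrow> 'j \<Rightarrow> 'a" where
  "merge_pair J a b y z = (\<lambda>j\<in>J. if j = a \<or> j = b then y j else z j)"

lemma sum_remove_pair:
  assumes "finite J" "a \<in> J" "b \<in> J" "a \<noteq> b"
  shows "(\<Sum>j\<in>J. f j) = f a + f b + (\<Sum>j\<in>J-{a,b}. f j :: nat)"
proof -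
  have "(\<Sum>j\<in>J. f j) = (\<Sum>j\<in>J-{a,b}. f j) + (\<Sum>j\<in>{a,b}. f j)"
    using assms by (intro sum.subset_diff) auto
  thus ?thesis using assms by simp
qed

lemma dvd_add_cong:
  fixes u v r :: nat
  assumes "u mod p = v mod p" shows "p dvd u + r \<longleftrightarrow> p dvd v + r"
  using mod_add_cong[OF assms, of r r] by (simp add: dvd_eq_mod_eq_0)

lemma mod_eq_of_dvd_add:
  fixes u v r :: nat
  assumes "p dvd u + r" "p dvd v + r" shows "u mod p = v mod p"
proof -
  have "int p dvd int (u + r) - int (v + r)" using assms by (intro dvd_diff) (auto simp del: of_nat_add)
  hence "int p dvd int u - int v" by simp
  thus ?thesis by (simp add: mod_eq_dvd_iff[symmetric] zmod_int[symmetric])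
qed

lemma merge_pair_in_cycles:
  assumes J: "finite J" "a \<in> J" "b \<in> J" "a \<noteq> b"
    and z: "z \<in> cycles p J X" and y: "y a \<in> X a" "y b \<in> X b"
    and eq: "\<And>i. (y a i + y b i) mod p = (z a i + z b i) mod p"
  shows "merge_pair J a b y z \<in> cycles p J X"
proof -
  have "p dvd (\<Sum>j\<in>J. merge_pair J a b y z j i)" for i
  proof -
    have "(\<Sum>j\<in>J-{a,b}. merge_pair J a b y z j i) = (\<Sum>j\<in>J-{a,b}. z j i)"
      by (intro sum.cong) (auto simp: merge_pair_def)
    moreover have "p dvd z a i + z b i + (\<Sum>j\<in>J-{a,b}. z j i)"
      using z by (simp add: cycles_def sum_remove_pair[OF J])
    ultimately show ?thesis
      using J dvd_add_cong[OF eq[of i], of "\<Sum>j\<in>J-{a,b}. z j i"]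
      by (simp add: sum_remove_pair[OF J] merge_pair_def)
  qed
  moreover have "merge_pair J a b y z \<in> PiE J X"
    using z y by (auto simp: cycles_def merge_pair_def PiE_def Pi_def)
  ultimately show ?thesis by (simp add: cycles_def)
qed

lemma pair_sum_eq_if_agreeing:
  assumes J: "finite J" "a \<in> J" "b \<in> J" "a \<noteq> b"
    and xy: "x \<in> cycles p J X" "y \<in> cycles p J X" "\<And>j. j \<in> J - {a, b} \<Longrightarrow> y j = x j"
  shows "pair_sum p a b y = pair_sum p a b x"
proof
  fix i
  have "(\<Sum>j\<in>J-{a,b}. y j i) = (\<Sum>j\<in>J-{a,b}. x j i)" using xy(3) by (intro sum.cong) auto
  moreover have "p dvd y a i + y b i + (\<Sum>j\<in>J-{a,b}. y j i)" "p dvd x a i + x b i + (\<Sum>j\<in>J-{a,b}. x j i)"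
    using xy by (simp_all add: cycles_def sum_remove_pair[OF J])
  ultimately show "pair_sum p a b y i = pair_sum p a b x i"
    unfolding pair_sum_def by (intro mod_eq_of_dvd_add[of p _ "\<Sum>j\<in>J-{a,b}. x j i"]) simp_all
qed

text \<open>Once the sum of the coordinates \<open>a\<close> and \<open>b\<close> is fixed, these
  two and the remaining ones vary independently, because halves of two cycles with equal sums merge
  to a cycle. The first factor counts the choices for the pair, the second those for the
  rest.\<close>

lemma card_pair_sum_class:
  assumes J: "finite J" "a \<in> J" "b \<in> J" "a \<noteq> b" and x: "x \<in> cycles p J X"
  defines "C \<equiv> cycles p J X"
  shows "card {y \<in> C. pair_sum p a b y = pair_sum p a b x} =
    card (agreeing C (J - {a, b}) x) * card (agreeing C {a, b} x)"
proof -
  let ?Q = "{y \<in> C. pair_sum p a b y = pair_sum p a b x}"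
  have ext: "u j = undefined" if "u \<in> C" "j \<notin> J" for u j using that by (auto simp: C_def cycles_def PiE_def extensional_def)
  have R: "pair_sum p a b y = pair_sum p a b x" if "y \<in> agreeing C (J - {a, b}) x" for y
    using that x by (intro pair_sum_eq_if_agreeing[OF J]) (auto simp: agreeing_def C_def)
  have inX: "u j \<in> X j" if "u \<in> C" "j \<in> J" for u j using that by (auto simp: C_def cycles_def)
  have mod: "(u a i + u b i) mod p = (v a i + v b i) mod p" if "pair_sum p a b u = pair_sum p a b v" for u v :: "'a \<Rightarrow> 'b \<Rightarrow> nat" and i
    using fun_cong[OF that, of i] by (simp add: pair_sum_def)
  have merge: "merge_pair J a b u v \<in> C" if "u \<in> C" "v \<in> C" "pair_sum p a b u = pair_sum p a b v" for u v
    unfolding C_def by (rule merge_pair_in_cycles[OF J]) (use that inX J mod[OF that(3)] in \<open>auto simp: C_def\<close>)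
  have "bij_betw (\<lambda>(y, z). merge_pair J a b y z) (agreeing C (J - {a, b}) x \<times> agreeing C {a, b} x) ?Q"
  proof (rule bij_betw_byWitness[where f' = "\<lambda>u. (merge_pair J a b u x, merge_pair J a b x u)"])
    show "\<forall>q\<in>agreeing C (J - {a, b}) x \<times> agreeing C {a, b} x.
      (\<lambda>u. (merge_pair J a b u x, merge_pair J a b x u)) ((\<lambda>(y, z). merge_pair J a b y z) q) = q"
    proof
      fix q assume "q \<in> agreeing C (J - {a, b}) x \<times> agreeing C {a, b} x"
      then obtain y z where q: "q = (y, z)" and yz: "y \<in> agreeing C (J - {a, b}) x" "z \<in> agreeing C {a, b} x"
        by auto
      have C: "x \<in> C" "y \<in> C" "z \<in> C" using x yz by (simp_all add: C_def agreeing_def)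
      have "merge_pair J a b (merge_pair J a b y z) x j = y j" for j
        using yz(1) ext[OF C(2), of j] J by (simp add: agreeing_def merge_pair_def)
      moreover have "merge_pair J a b x (merge_pair J a b y z) j = z j" for j
        using yz(2) ext[OF C(3), of j] J by (auto simp: agreeing_def merge_pair_def)
      ultimately show "(\<lambda>u. (merge_pair J a b u x, merge_pair J a b x u)) ((\<lambda>(y, z). merge_pair J a b y z) q) = q"
        by (simp add: q fun_eq_iff)
    qed
    show "\<forall>u\<in>?Q. (\<lambda>(y, z). merge_pair J a b y z) (merge_pair J a b u x, merge_pair J a b x u) = u"
      using ext by (auto simp: merge_pair_def fun_eq_iff)
    show "(\<lambda>(y, z). merge_pair J a b y z) ` (agreeing C (J - {a, b}) x \<times> agreeing C {a, b} x) \<subseteq> ?Q"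
    proof
      fix u assume "u \<in> (\<lambda>(y, z). merge_pair J a b y z) ` (agreeing C (J - {a, b}) x \<times> agreeing C {a, b} x)"
      then obtain y z where u: "u = merge_pair J a b y z"
        and y: "y \<in> agreeing C (J - {a, b}) x" and z: "z \<in> agreeing C {a, b} x" by auto
      have "pair_sum p a b z = pair_sum p a b x" using z by (simp add: agreeing_def pair_sum_def)
      hence "merge_pair J a b y z \<in> C" using y z R[OF y] by (intro merge) (auto simp: agreeing_def)
      moreover have "pair_sum p a b (merge_pair J a b y z) = pair_sum p a b y"
        using J by (simp add: pair_sum_def merge_pair_def)
      ultimately show "u \<in> ?Q" using R[OF y] u by simp
    qed
    show "(\<lambda>u. (merge_pair J a b u x, merge_pair J a b x u)) ` ?Q \<subseteq> agreeing C (J - {a, b}) x \<times> agreeing C {a, b} x"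
    proof
      fix q assume "q \<in> (\<lambda>u. (merge_pair J a b u x, merge_pair J a b x u)) ` ?Q"
      then obtain u where q: "q = (merge_pair J a b u x, merge_pair J a b x u)"
        and u: "u \<in> C" "pair_sum p a b u = pair_sum p a b x" by auto
      have "merge_pair J a b u x \<in> C" "merge_pair J a b x u \<in> C" using merge u x by (auto simp: C_def)
      thus "q \<in> agreeing C (J - {a, b}) x \<times> agreeing C {a, b} x"
        using J q by (auto simp: agreeing_def merge_pair_def)
    qed
  qed
  from bij_betw_same_card[OF this] show ?thesis by (simp add: card_cartesian_product)
qed

section \<open>Entropy of the sum of two coordinates\<close>

lemma sum_ln_le:
  fixes f :: "'a \<Rightarrow> real"
  assumes "\<And>x. x \<in> A \<Longrightarrow> 0 < f x" "sum f A \<le> real (card A)"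
  shows "(\<Sum>x\<in>A. ln (f x)) \<le> 0"
proof -
  \<comment> \<open>The tangent bound for \<open>ln\<close> takes the place of Jensen's inequality
    and reduces entropy inequalities to inequalities between cardinalities.\<close>
  have "(\<Sum>x\<in>A. ln (f x)) \<le> (\<Sum>x\<in>A. f x - 1)" using assms(1) by (intro sum_mono ln_le_minus_one)
  also have "\<dots> = sum f A - real (card A)" by (simp add: sum_subtractf)
  finally show ?thesis using assms(2) by linarith
qed

text \<open>Each class contributes exactly 1. Combined with \<open>sum_ln_le\<close>, this bounds
  the entropy of \<open>f\<close> by the logarithm of the number of its values.\<close>

lemma sum_inverse_class_size:
  assumes "finite C"
  shows "(\<Sum>x\<in>C. 1 / real (card {y \<in> C. f y = f x})) = real (card (f ` C))"
proof -
  have "(\<Sum>x\<in>C. 1 / real (card {y \<in> C. f y = f x})) =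
      (\<Sum>w\<in>f ` C. \<Sum>x\<in>{x \<in> C. f x = w}. 1 / real (card {y \<in> C. f y = f x}))"
    using assms by (intro sum.group[symmetric]) auto
  also have "\<dots> = (\<Sum>w\<in>f ` C. 1)"
  proof (rule sum.cong[OF refl])
    fix w assume "w \<in> f ` C"
    hence ne: "{y \<in> C. f y = w} \<noteq> {}" by blast
    have "(\<Sum>x\<in>{x \<in> C. f x = w}. 1 / real (card {y \<in> C. f y = f x})) =
        (\<Sum>x\<in>{x \<in> C. f x = w}. 1 / real (card {y \<in> C. f y = w}))"
      by (intro sum.cong) auto
    also have "\<dots> = 1" using assms ne by simp
    finally show "(\<Sum>x\<in>{x \<in> C. f x = w}. 1 / real (card {y \<in> C. f y = f x})) = 1" .
  qed
  finally show ?thesis by simp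
qed

text \<open>An exponential form of submodularity of entropy. Among the cycles with a given
  coordinate \<open>c\<close>, a triple \<open>(x, y, z)\<close> counted on the left is determined
  by \<open>(y, z)\<close>: \<open>y\<close> gives the coordinates of \<open>x\<close> other than
  \<open>a\<close> and \<open>b\<close>, \<open>z\<close> gives \<open>x a\<close>, and the zero sum
  gives \<open>x b\<close>.\<close>

lemma sum_agreeing_submodular:
  fixes X :: "'j \<Rightarrow> ('i \<Rightarrow> nat) set"
  assumes J: "finite J" "a \<in> J" "b \<in> J" "c \<in> J" "a \<noteq> b" "c \<noteq> a" "c \<noteq> b" and I: "finite I"
    and X: "\<And>j. j \<in> J \<Longrightarrow> X j \<subseteq> modvec p I"
  defines "C \<equiv> cycles p J X"
  shows "(\<Sum>x\<in>C. real (card (agreeing C (J - {a, b}) x)) * real (card (agreeing C {a, c} x)) /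
    real (card (agreeing C {c} x))) \<le> real (card C)"
proof -
  let ?r = "\<lambda>x. agreeing C (J - {a, b}) x" and ?s = "\<lambda>x. agreeing C {a, c} x"
  have fin: "finite C" unfolding C_def using J(1) I X by (rule finite_cycles)
  have fina: "finite (agreeing C S x)" for S x using fin by (simp add: agreeing_def)
  define K where "K v = {x \<in> C. x c = v}" for v
  have finK: "finite (K v)" for v using fin by (simp add: K_def)
  have cls: "(\<Sum>x\<in>K v. card (?r x) * card (?s x)) \<le> card (K v) * card (K v)" for v
  proof -
    have "(\<Sum>x\<in>K v. card (?r x) * card (?s x)) = card (Sigma (K v) (\<lambda>x. ?r x \<times> ?s x))"
      using finK fina by (simp add: card_cartesian_product)
    also have "\<dots> \<le> card (K v \<times> K v)"
    proof (rule card_inj_on_le[where f = snd])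
      show "inj_on snd (Sigma (K v) (\<lambda>x. ?r x \<times> ?s x))"
      proof (rule inj_onI)
        fix s t assume st: "s \<in> Sigma (K v) (\<lambda>x. ?r x \<times> ?s x)" "t \<in> Sigma (K v) (\<lambda>x. ?r x \<times> ?s x)" "snd s = snd t"
        obtain x x' y z where xyz: "s = (x, y, z)" "t = (x', y, z)" using st(3) by (cases s, cases t) auto
        have x: "x \<in> C" "x' \<in> C" "x a = x' a" "\<And>j. j \<in> J - {a, b} \<Longrightarrow> x j = x' j"
        proof -
          show "x \<in> C" "x' \<in> C" using st xyz by (simp_all add: K_def)
          have "z a = x a" "z a = x' a" using st xyz by (simp_all add: agreeing_def)
          thus "x a = x' a" by simp
          fix j assume "j \<in> J - {a, b}"
          hence "y j = x j" "y j = x' j" using st xyz by (simp_all add: agreeing_def)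
          thus "x j = x' j" by simp
        qed
        have "x = x'"
          by (rule cycles_eqI[OF J(1,3) X[OF J(3)] x(1)[unfolded C_def] x(2)[unfolded C_def]])
             (use x(3,4) in blast)
        thus "s = t" using xyz by simp
      qed
      show "snd ` Sigma (K v) (\<lambda>x. ?r x \<times> ?s x) \<subseteq> K v \<times> K v"
        using J by (auto simp: K_def agreeing_def)
      show "finite (K v \<times> K v)" using finK by simp
    qed
    finally show ?thesis by (simp add: card_cartesian_product)
  qed
  have "(\<Sum>x\<in>C. real (card (?r x)) * real (card (?s x)) / real (card (agreeing C {c} x))) =
     (\<Sum>v\<in>(\<lambda>x. x c) ` C. \<Sum>x\<in>K v. real (card (?r x)) * real (card (?s x)) / real (card (agreeing C {c} x)))"
    unfolding K_def using fin by (intro sum.group[symmetric]) auto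
  also have "\<dots> \<le> (\<Sum>v\<in>(\<lambda>x. x c) ` C. real (card (K v)))"
  proof (rule sum_mono)
    fix v assume "v \<in> (\<lambda>x. x c) ` C"
    hence "K v \<noteq> {}" by (auto simp: K_def)
    hence K0: "0 < card (K v)" using finK by (simp add: card_gt_0_iff)
    have "(\<Sum>x\<in>K v. real (card (?r x)) * real (card (?s x)) / real (card (agreeing C {c} x))) =
        (\<Sum>x\<in>K v. real (card (?r x)) * real (card (?s x)) / real (card (K v)))"
      by (intro sum.cong refl) (simp add: K_def agreeing_def)
    also have "\<dots> = real (\<Sum>x\<in>K v. card (?r x) * card (?s x)) / real (card (K v))"
      by (simp add: sum_divide_distrib)
    also have "\<dots> \<le> real (card (K v) * card (K v)) / real (card (K v))"
      using cls[of v] by (intro divide_right_mono) (simp_all only: of_nat_le_iff of_nat_0_le_iff)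
    also have "\<dots> = real (card (K v))" using K0 by simp
    finally show "(\<Sum>x\<in>K v. real (card (?r x)) * real (card (?s x)) / real (card (agreeing C {c} x))) \<le> real (card (K v))" .
  qed
  also have "\<dots> = (\<Sum>v\<in>(\<lambda>x. x c) ` C. \<Sum>x\<in>K v. 1)" by simp
  also have "\<dots> = (\<Sum>x\<in>C. 1)" unfolding K_def using fin by (intro sum.group) auto
  finally show ?thesis by simp
qed

text \<open>An entropy argument: for a uniformly random cycle \<open>x\<close>, \<open>\<Sum>x. ln (card (agreeing C S x))\<close> measures the
  conditional entropy of \<open>x\<close> given its coordinates in \<open>S\<close>. Submodularity shows that the pair of
  coordinates with maximal entropy has a sum of entropy at least that of a single coordinate.\<close>

lemma ex_pair_many_sums:
  fixes X :: "'j \<Rightarrow> ('i \<Rightarrow> nat) set"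
  assumes J: "finite J" "3 \<le> card J" and I: "finite I"
    and X: "\<And>j. j \<in> J \<Longrightarrow> X j \<subseteq> modvec p I"
  defines "C \<equiv> cycles p J X"
  assumes ne: "C \<noteq> {}" and deg: "\<And>j v. j \<in> J \<Longrightarrow> real (card {x \<in> C. x j = v}) \<le> D"
  shows "\<exists>a\<in>J. \<exists>b\<in>J. a \<noteq> b \<and> real (card C) / D \<le> real (card (pair_sum p a b ` C))"
proof -
  have fin: "finite C" unfolding C_def using J(1) I X by (rule finite_cycles)
  have T: "0 < real (card C)" using ne fin by (simp add: card_gt_0_iff)
  have fina: "finite (agreeing C S x)" for S x using fin by (simp add: agreeing_def)
  have pos: "0 < real (card (agreeing C S x))" if "x \<in> C" for S x
  proof -
    have "x \<in> agreeing C S x" using that by (simp add: agreeing_def)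
    thus ?thesis using fina[of S x] card_gt_0_iff[of "agreeing C S x"] by auto
  qed
  define L where "L S = (\<Sum>x\<in>C. ln (real (card (agreeing C S x))))" for S
  define Pairs where "Pairs = {q \<in> J \<times> J. fst q \<noteq> snd q}"
  have finP: "finite Pairs" unfolding Pairs_def using J by simp
  obtain a0 b0 where ab0: "a0 \<in> J" "b0 \<in> J" "a0 \<noteq> b0"
  proof -
    have "\<not> card J \<le> Suc 0" using J(2) by simp
    thus thesis using that card_le_Suc0_iff_eq[OF J(1)] by blast
  qed
  hence "Pairs \<noteq> {}" unfolding Pairs_def by force
  from ex_max_on[OF finP this, of "\<lambda>q. - L {fst q, snd q}"]
  obtain q where q: "q \<in> Pairs" "\<forall>q'\<in>Pairs. - L {fst q', snd q'} \<le> - L {fst q, snd q}" by blast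
  obtain a b where ab: "q = (a, b)" by (cases q)
  have abJ: "a \<in> J" "b \<in> J" "a \<noteq> b" using q(1) ab by (auto simp: Pairs_def)
  have "card (J - {a, b}) > 0" using J abJ by (simp add: card_Diff_subset)
  then obtain c where c: "c \<in> J" "c \<noteq> a" "c \<noteq> b" by (metis Diff_iff all_not_in_conv card.empty insertCI less_numeral_extra(3))
  \<comment> \<open>Large entropy of a pair means small \<open>L\<close>, the entropy that remains.
    The choice of \<open>{a, b}\<close> allows it to be exchanged for \<open>{a, c}\<close>, to
    which submodularity against \<open>J - {a, b}\<close> applies because the two sets meet only in
    \<open>c\<close>.\<close>
  have Lmin: "L {a, b} \<le> L {a, c}"
    using q(2)[rule_format, of "(a, c)"] ab abJ c by (simp add: Pairs_def)
  let ?W = "pair_sum p a b ` C" and ?q = "\<lambda>x. {y \<in> C. pair_sum p a b y = pair_sum p a b x}"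
  have W: "0 < real (card ?W)" using ne fin by (simp add: card_gt_0_iff)
  have qeq: "real (card (?q x)) = real (card (agreeing C (J - {a, b}) x)) * real (card (agreeing C {a, b} x))" if "x \<in> C" for x
    using card_pair_sum_class[OF J(1) abJ, of x p X] that by (simp add: C_def)
  \<comment> \<open>The pair sum has entropy at most \<open>ln (real (card ?W))\<close>, so its
    classes are large in the logarithmic mean; the factorisation of the classes splits this into two
    values of \<open>L\<close>.\<close>
  have 1: "real (card C) * ln (real (card C) / real (card ?W)) \<le> L (J - {a, b}) + L {a, b}"
  proof -
    have "(\<Sum>x\<in>C. ln (real (card C) / real (card ?W) * (1 / real (card (?q x))))) \<le> 0"
    proof (rule sum_ln_le)
      show "0 < real (card C) / real (card ?W) * (1 / real (card (?q x)))" if "x \<in> C" for x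
        using T W qeq[OF that] pos[OF that] by simp
      have "(\<Sum>x\<in>C. real (card C) / real (card ?W) * (1 / real (card (?q x)))) =
          real (card C) / real (card ?W) * real (card ?W)"
        unfolding sum_distrib_left[symmetric] by (subst sum_inverse_class_size[OF fin]) simp
      thus "(\<Sum>x\<in>C. real (card C) / real (card ?W) * (1 / real (card (?q x)))) \<le> real (card C)"
        using W by simp
    qed
    also have "(\<Sum>x\<in>C. ln (real (card C) / real (card ?W) * (1 / real (card (?q x))))) =
       (\<Sum>x\<in>C. ln (real (card C) / real (card ?W)) -
          (ln (real (card (agreeing C (J - {a, b}) x))) + ln (real (card (agreeing C {a, b} x)))))"
    proof (rule sum.cong[OF refl])
      fix x assume x: "x \<in> C"
      show "ln (real (card C) / real (card ?W) * (1 / real (card (?q x)))) = ln (real (card C) / real (card ?W)) -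
          (ln (real (card (agreeing C (J - {a, b}) x))) + ln (real (card (agreeing C {a, b} x))))"
        unfolding qeq[OF x] using T W pos[OF x] by (simp add: ln_mult ln_div)
    qed
    finally show ?thesis by (simp add: sum_subtractf sum.distrib L_def)
  qed
  have 2: "L (J - {a, b}) + L {a, c} \<le> L {c}"
  proof -
    have "(\<Sum>x\<in>C. ln (real (card (agreeing C (J - {a, b}) x)) * real (card (agreeing C {a, c} x)) /
        real (card (agreeing C {c} x)))) \<le> 0"
      using sum_agreeing_submodular[OF J(1) abJ(1,2) c(1) abJ(3) c(2,3) I X] pos
      by (intro sum_ln_le) (auto simp: C_def)
    also have "(\<Sum>x\<in>C. ln (real (card (agreeing C (J - {a, b}) x)) * real (card (agreeing C {a, c} x)) /
        real (card (agreeing C {c} x)))) = (\<Sum>x\<in>C. ln (real (card (agreeing C (J - {a, b}) x))) +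
          ln (real (card (agreeing C {a, c} x))) - ln (real (card (agreeing C {c} x))))"
    proof (rule sum.cong[OF refl])
      fix x assume x: "x \<in> C"
      show "ln (real (card (agreeing C (J - {a, b}) x)) * real (card (agreeing C {a, c} x)) /
          real (card (agreeing C {c} x))) = ln (real (card (agreeing C (J - {a, b}) x))) +
          ln (real (card (agreeing C {a, c} x))) - ln (real (card (agreeing C {c} x)))"
        using pos[OF x, of "J - {a, b}"] pos[OF x, of "{a, c}"] pos[OF x, of "{c}"] by (simp add: ln_mult ln_div)
    qed
    finally show ?thesis by (simp add: sum_subtractf sum.distrib L_def)
  qed
  have D: "1 \<le> D" using degree_ge_1[of p J X c D] fin ne deg[OF c(1)] by (simp add: C_def)
  have 3: "L {c} \<le> real (card C) * ln D"
  proof -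
    have "L {c} \<le> (\<Sum>x\<in>C. ln D)" unfolding L_def
    proof (rule sum_mono)
      fix x assume x: "x \<in> C"
      have "real (card (agreeing C {c} x)) \<le> D" using deg[OF c(1), of "x c"] by (simp add: agreeing_def)
      thus "ln (real (card (agreeing C {c} x))) \<le> ln D" using pos[OF x] D by simp
    qed
    thus ?thesis by simp
  qed
  have "real (card C) * ln (real (card C) / real (card ?W)) \<le> real (card C) * ln D"
    using 1 2 3 Lmin by linarith
  hence "ln (real (card C) / real (card ?W)) \<le> ln D" using T by simp
  hence "real (card C) / real (card ?W) \<le> D" using T W D by (subst (asm) ln_le_cancel_iff) auto
  hence "real (card C) / D \<le> real (card ?W)" using W D by (simp add: field_simps)
  thus ?thesis using abJ by blast
qed

text \<open>The pair supplied by \<open>ex_pair_many_sums\<close> depends on the system of cycles,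
  so maximal families \<open>M a b\<close> are taken for all pairs at once. If all of them are
  small, deleting all their vertices keeps at least half of the cycles. What is left still has many
  sums for some pair, and by maximality each of these sums already occurs in \<open>M a b\<close>,
  which is therefore not small.\<close>

lemma ex_disjoint_cycles_distinct_sums:
  fixes X :: "'j \<Rightarrow> ('i \<Rightarrow> nat) set"
  assumes J: "finite J" "3 \<le> card J" and I: "finite I"
    and X: "\<And>j. j \<in> J \<Longrightarrow> X j \<subseteq> modvec p I"
  defines "C \<equiv> cycles p J X"
  assumes ne: "C \<noteq> {}" and deg: "\<And>j v. j \<in> J \<Longrightarrow> real (card {x \<in> C. x j = v}) \<le> D"
  shows "\<exists>a\<in>J. \<exists>b\<in>J. \<exists>B\<subseteq>C. a \<noteq> b \<and> disjoint_cycles J B \<and> inj_on (pair_sum p a b) B \<and>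
    real (card C) / (2 * real (card J) ^ 3 * D) \<le> real (card B)"
proof (rule ccontr)
  assume neg: "\<not> ?thesis"
  have fin: "finite C" unfolding C_def using J(1) I X by (rule finite_cycles)
  have T: "0 < real (card C)" using ne fin by (simp add: card_gt_0_iff)
  define k where "k = real (card J)"
  have k: "3 \<le> k" using J by (simp add: k_def)
  obtain j0 where j0: "j0 \<in> J" using J by fastforce
  have D: "1 \<le> D" using degree_ge_1[of p J X j0 D] fin ne deg[OF j0] by (simp add: C_def)
  define good where "good a b B \<longleftrightarrow> B \<subseteq> C \<and> disjoint_cycles J B \<and> inj_on (pair_sum p a b) B" for a b B
  have "\<exists>B. good a b B \<and> (\<forall>B'. good a b B' \<longrightarrow> card B' \<le> card B)" for a b
  proof -
    have "finite {B. good a b B}" by (rule finite_subset[of _ "Pow C"]) (auto simp: good_def fin)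
    moreover have "good a b {}" by (simp add: good_def disjoint_cycles_def)
    hence "{B. good a b B} \<noteq> {}" by blast
    ultimately show ?thesis using ex_max_on[of "{B. good a b B}" card] by simp
  qed
  then obtain M where M: "\<And>a b. good a b (M a b)" "\<And>a b B. good a b B \<Longrightarrow> card B \<le> card (M a b)"
    by metis
  have MC: "M a b \<subseteq> C" for a b using M(1)[of a b] by (simp add: good_def)
  have small: "real (card (M a b)) < real (card C) / (2 * k ^ 3 * D)" if "a \<in> J" "b \<in> J" "a \<noteq> b" for a b
    using neg that M(1)[of a b] unfolding good_def k_def not_le[symmetric] by blast
  define P where "P = {q \<in> J \<times> J. fst q \<noteq> snd q}"
  have finP: "finite P" unfolding P_def using J by simp
  define M' where "M' q = M (fst q) (snd q)" for q
  have cardP: "real (card P) \<le> k ^ 2"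
  proof -
    have "card P \<le> card (J \<times> J)" unfolding P_def using J by (intro card_mono) auto
    hence "real (card P) \<le> real (card (J \<times> J))" by simp
    thus ?thesis by (simp add: card_cartesian_product k_def power2_eq_square)
  qed
  define X' where "X' j = X j - (\<Union>q\<in>P. (\<lambda>x. x j) ` M' q)" for j
  define C' where "C' = cycles p J X'"
  have C'C: "C' \<subseteq> C" unfolding C_def C'_def by (rule cycles_mono) (auto simp: X'_def)
  have removed: "C - C' \<subseteq> (\<Union>q\<in>P. \<Union>y\<in>M' q. \<Union>j\<in>J. {x \<in> C. x j = y j})"
  proof
    fix x assume x: "x \<in> C - C'"
    then obtain j where "j \<in> J" "x j \<notin> X' j" by (auto simp: C_def C'_def cycles_def PiE_def Pi_def)
    moreover have "x j \<in> X j" using x \<open>j \<in> J\<close> by (auto simp: C_def cycles_def)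
    ultimately obtain q y where "q \<in> P" "y \<in> M' q" "x j = y j" by (auto simp: X'_def)
    thus "x \<in> (\<Union>q\<in>P. \<Union>y\<in>M' q. \<Union>j\<in>J. {x \<in> C. x j = y j})" using x \<open>j \<in> J\<close> by blast
  qed
  have finM: "finite (M' q)" for q using finite_subset[OF MC fin] by (simp add: M'_def)
  have "card (C - C') \<le> card (\<Union>q\<in>P. \<Union>y\<in>M' q. \<Union>j\<in>J. {x \<in> C. x j = y j})"
    using finP finM J fin by (intro card_mono removed) auto
  also have "\<dots> \<le> (\<Sum>q\<in>P. card (\<Union>y\<in>M' q. \<Union>j\<in>J. {x \<in> C. x j = y j}))" by (rule card_UN_le[OF finP])
  also have "\<dots> \<le> (\<Sum>q\<in>P. \<Sum>y\<in>M' q. card (\<Union>j\<in>J. {x \<in> C. x j = y j}))"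
    by (intro sum_mono card_UN_le finM)
  also have "\<dots> \<le> (\<Sum>q\<in>P. \<Sum>y\<in>M' q. \<Sum>j\<in>J. card {x \<in> C. x j = y j})"
    by (intro sum_mono card_UN_le J)
  finally have "real (card (C - C')) \<le> real (\<Sum>q\<in>P. \<Sum>y\<in>M' q. \<Sum>j\<in>J. card {x \<in> C. x j = y j})"
    by (simp only: of_nat_le_iff)
  also have "\<dots> = (\<Sum>q\<in>P. \<Sum>y\<in>M' q. \<Sum>j\<in>J. real (card {x \<in> C. x j = y j}))" by simp
  \<comment> \<open>This count is the origin of \<open>2 * k ^ 3\<close>: at most
    \<open>k ^ 2\<close> ordered pairs, \<open>k\<close> vertices on each cycle of
    \<open>M' q\<close>, degree at most \<open>D\<close>, and half of the cycles to be kept.\<close>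
  also have "\<dots> \<le> (\<Sum>q\<in>P. \<Sum>y\<in>M' q. \<Sum>j\<in>J. D)" using deg by (intro sum_mono)
  also have "\<dots> = (\<Sum>q\<in>P. real (card (M' q)) * (k * D))" by (simp add: k_def)
  also have "\<dots> \<le> (\<Sum>q\<in>P. real (card C) / (2 * k ^ 3 * D) * (k * D))"
    using k D small by (intro sum_mono mult_right_mono) (auto simp: P_def M'_def less_imp_le)
  also have "\<dots> = real (card P) * (real (card C) / (2 * k ^ 2))"
    using k D by (simp add: field_simps power2_eq_square power3_eq_cube)
  also have "\<dots> \<le> k ^ 2 * (real (card C) / (2 * k ^ 2))" using cardP by (intro mult_right_mono) auto
  also have "\<dots> = real (card C) / 2" using k by simp
  finally have "real (card (C - C')) \<le> real (card C) / 2" .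
  moreover have "card C = card C' + card (C - C')"
    using card_Un_disjoint[of C' "C - C'"] C'C fin finite_subset[OF C'C fin] by (simp add: Un_absorb1)
  ultimately have T': "real (card C) / 2 \<le> real (card C')" by simp
  hence ne': "C' \<noteq> {}" using T by auto
  have deg': "real (card {x \<in> C'. x j = v}) \<le> D" if "j \<in> J" for j v
  proof -
    have "card {x \<in> C'. x j = v} \<le> card {x \<in> C. x j = v}" using fin C'C by (intro card_mono) auto
    thus ?thesis using deg[OF that, of v] by linarith
  qed
  have X'V: "X' j \<subseteq> modvec p I" if "j \<in> J" for j using X[OF that] by (auto simp: X'_def)
  obtain a b where ab: "a \<in> J" "b \<in> J" "a \<noteq> b" and W: "real (card C') / D \<le> real (card (pair_sum p a b ` C'))"
    using ex_pair_many_sums[where p = p and D = D and X = X', OF J I X'V] ne' deg' unfolding C'_def by blast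
  have abP: "(a, b) \<in> P" using ab by (simp add: P_def)
  \<comment> \<open>A remaining cycle avoids every vertex of \<open>M a b\<close>, so it could be
    added to that family unless its sum is already taken.\<close>
  have "pair_sum p a b ` C' \<subseteq> pair_sum p a b ` M a b"
  proof
    fix w assume "w \<in> pair_sum p a b ` C'"
    then obtain x where x: "x \<in> C'" "w = pair_sum p a b x" by blast
    show "w \<in> pair_sum p a b ` M a b"
    proof (rule ccontr)
      assume w: "w \<notin> pair_sum p a b ` M a b"
      hence xM: "x \<notin> M a b" using x by blast
      have xj: "x j \<noteq> y j" if "y \<in> M a b" "j \<in> J" for y j
      proof -
        have "x j \<in> X' j" using x that by (auto simp: C'_def cycles_def)
        thus ?thesis using that abP by (force simp: X'_def M'_def)
      qed
      have "disjoint_cycles J (insert x (M a b))"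
        using M(1)[of a b] xj xj[symmetric] unfolding good_def disjoint_cycles_def by auto
      moreover have "inj_on (pair_sum p a b) (insert x (M a b))"
        using M(1)[of a b] w x(2) unfolding good_def by auto
      ultimately have "good a b (insert x (M a b))" using MC x C'C by (auto simp: good_def)
      from M(2)[OF this] show False using xM finM[of "(a, b)"] by (simp add: M'_def)
    qed
  qed
  hence "card (pair_sum p a b ` C') \<le> card (M a b)"
    using finM[of "(a, b)"] by (intro surj_card_le) (auto simp: M'_def)
  hence "real (card C') / D \<le> real (card (M a b))" using W by linarith
  also have "\<dots> < real (card C) / (2 * k ^ 3 * D)" by (rule small[OF ab])
  also have "\<dots> \<le> real (card C) / (2 * D)"
  proof -
    have "1 \<le> k ^ 3" using k by (intro one_le_power) auto
    hence "2 * D \<le> 2 * k ^ 3 * D" using D by simp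
    thus ?thesis using D T k by (intro divide_left_mono mult_pos_pos) auto
  qed
  also have "\<dots> = real (card C) / 2 / D" by simp
  also have "\<dots> \<le> real (card C') / D" using T' D by (intro divide_right_mono) auto
  finally show False by simp
qed

section \<open>Splitting cycles at the sum of two coordinates\<close>

lemma card_le_sum_fibers:
  assumes "finite B" "Y \<subseteq> (\<Union>x\<in>B. P x)" "\<And>x. x \<in> B \<Longrightarrow> finite (Z x)"
    "\<And>x. x \<in> B \<Longrightarrow> inj_on (h x) (Y \<inter> P x)" "\<And>x. x \<in> B \<Longrightarrow> h x ` (Y \<inter> P x) \<subseteq> Z x"
  shows "card Y \<le> (\<Sum>x\<in>B. card (Z x))"
proof -
  have fin: "finite (Y \<inter> P x)" if "x \<in> B" for x
    using inj_on_finite[OF assms(4,5,3)] that by blast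
  have "Y = (\<Union>x\<in>B. Y \<inter> P x)" using assms(2) by blast
  hence "card Y = card (\<Union>x\<in>B. Y \<inter> P x)" by simp
  also have "\<dots> \<le> (\<Sum>x\<in>B. card (Y \<inter> P x))" using assms(1) by (rule card_UN_le)
  also have "\<dots> \<le> (\<Sum>x\<in>B. card (Z x))" using assms(3-5) by (intro sum_mono card_inj_on_le)
  finally show ?thesis .
qed

lemma pair_sum_in_modvec:
  assumes "0 < p" "x a \<in> modvec p I" "x b \<in> modvec p I"
  shows "pair_sum p a b x \<in> modvec p I"
  unfolding pair_sum_def using assms by (intro mod_in_modvec) (auto simp: modvec_def)

text \<open>Adjoining the negative of \<open>x a + x b\<close> as a coordinate \<open>c\<close>
  turns \<open>B\<close> into a family of triangles, disjoint also at \<open>c\<close> because the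
  sums are distinct on \<open>B\<close>. Any triangle on their vertices has the
  \<open>c\<close>-coordinate of some \<open>x\<close> in \<open>B\<close>, and its other two
  coordinates may replace \<open>x a\<close> and \<open>x b\<close> in \<open>x\<close>. So the
  triangles over a given \<open>x\<close> inject into
  \<open>agreeing C (J - {a, b}) x\<close>.\<close>

lemma sum_agreeing_rest_ge:
  fixes X :: "'j \<Rightarrow> ('i \<Rightarrow> nat) set"
  assumes p: "0 < p" and J: "finite J" "a \<in> J" "b \<in> J" "a \<noteq> b" and c: "c \<noteq> a" "c \<noteq> b" and I: "finite I"
    and X: "\<And>j. j \<in> J \<Longrightarrow> X j \<subseteq> modvec p I"
  defines "C \<equiv> cycles p J X"
  assumes B: "B \<subseteq> C" "disjoint_cycles J B" "inj_on (pair_sum p a b) B"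
    and mb: "matching_bound p \<kappa> r \<theta> {a, b, c} I"
  shows "\<kappa> * real (card B) powr (1 + \<theta>) * (real p ^ card I) powr (r - \<theta>) \<le>
    (\<Sum>x\<in>B. real (card (agreeing C (J - {a, b}) x)))"
proof -
  have fin: "finite C" unfolding C_def using J(1) I X by (rule finite_cycles)
  have finB: "finite B" using finite_subset[OF B(1) fin] .
  let ?w = "pair_sum p a b"
  define f where "f x = (\<lambda>j\<in>{a, b, c}. if j = c then neg_mod p (?w x) else x j)" for x :: "'j \<Rightarrow> 'i \<Rightarrow> nat"
  have f: "f x a = x a" "f x b = x b" "f x c = neg_mod p (?w x)" for x using c by (auto simp: f_def)
  have sum3: "(\<Sum>j\<in>{a, b, c}. g j) = g a + g b + g c" for g :: "'j \<Rightarrow> nat" using J c by simp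
  have xV: "x j \<in> modvec p I" if "x \<in> B" "j \<in> J" for x j
    using that B X[OF that(2)] by (auto simp: C_def cycles_def)
  have wV: "?w x \<in> modvec p I" if "x \<in> B" for x
    by (rule pair_sum_in_modvec[of p x a I b, OF p xV[OF that J(2)] xV[OF that J(3)]])
  have nV: "neg_mod p (?w x) \<in> modvec p I" if "x \<in> B" for x
    using wV[OF that] by (intro neg_mod_in_modvec p) (auto simp: modvec_def)
  have w_neg: "?w x = ?w y" if "x \<in> B" "y \<in> B" "neg_mod p (?w x) = neg_mod p (?w y)" for x y
  proof (rule modvec_eqI[OF wV[OF that(1)] wV[OF that(2)]])
    fix i
    have "?w x i mod p = ?w y i mod p"
      using dvd_neg_mod[OF p, of "?w x" i] dvd_neg_mod[OF p, of "?w y" i] that(3)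
      by (intro mod_eq_of_dvd_add[of p _ "neg_mod p (?w x) i"]) auto
    thus "int p dvd int (?w x i) - int (?w y i)" by (simp add: mod_eq_dvd_iff[symmetric] zmod_int[symmetric])
  qed
  have dis: "x j \<noteq> y j" if "x \<in> B" "y \<in> B" "x \<noteq> y" "j \<in> J" for x y j
    using B(2) that unfolding disjoint_cycles_def by blast
  have injf: "inj_on f B"
  proof (rule inj_onI)
    fix x y assume xy: "x \<in> B" "y \<in> B" "f x = f y"
    show "x = y" using dis[OF xy(1,2) _ J(2)] f(1)[of x] f(1)[of y] xy(3) by auto
  qed
  let ?V = "cycles p {a, b, c} (\<lambda>_. modvec p I)"
  have fV: "f x \<in> ?V" if "x \<in> B" for x
  proof -
    have "p dvd x a i + x b i + neg_mod p (?w x) i" for i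
      using dvd_neg_mod[OF p, of "?w x" i] dvd_add_cong[of "?w x i" p "x a i + x b i"]
      by (simp add: pair_sum_def)
    hence "\<forall>i. p dvd (\<Sum>j\<in>{a, b, c}. f x j i)" unfolding sum3 f by blast
    moreover have "f x \<in> PiE {a, b, c} (\<lambda>_. modvec p I)" using xV[OF that] nV[OF that] J by (auto simp: f_def)
    ultimately show ?thesis by (simp add: cycles_def)
  qed
  have disf: "disjoint_cycles {a, b, c} (f ` B)"
    unfolding disjoint_cycles_def
  proof (intro ballI impI)
    fix y z j assume "y \<in> f ` B" "z \<in> f ` B" "y \<noteq> z" and j: "j \<in> {a, b, c}"
    then obtain u v where uv: "u \<in> B" "v \<in> B" "y = f u" "z = f v" "u \<noteq> v" by blast
    have "neg_mod p (?w u) \<noteq> neg_mod p (?w v)" using w_neg[OF uv(1,2)] inj_onD[OF B(3)] uv by blast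
    moreover have "u a \<noteq> v a" "u b \<noteq> v b" using dis uv J by auto
    ultimately show "y j \<noteq> z j" using j f uv by auto
  qed
  define Y where "Y = cycles p {a, b, c} (\<lambda>j. (\<lambda>x. x j) ` f ` B)"
  have "\<kappa> * real (card (f ` B)) powr (1 + \<theta>) * (real p ^ card I) powr (r - \<theta>) \<le> real (card Y)"
    using mb fV disf unfolding matching_bound_def Y_def by blast
  also have "card (f ` B) = card B" by (rule card_image[OF injf])
  finally have "\<kappa> * real (card B) powr (1 + \<theta>) * (real p ^ card I) powr (r - \<theta>) \<le> real (card Y)" .
  also have "card Y \<le> (\<Sum>x\<in>B. card (agreeing C (J - {a, b}) x))"
  proof (rule card_le_sum_fibers[OF finB, where P = "\<lambda>x. {y. y c = f x c}" and h = "\<lambda>x y. merge_pair J a b y x"])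
    show "Y \<subseteq> (\<Union>x\<in>B. {y. y c = f x c})" by (auto simp: Y_def cycles_def PiE_def Pi_def)
    show "finite (agreeing C (J - {a, b}) x)" for x using fin by (simp add: agreeing_def)
    fix x assume x: "x \<in> B"
    show "inj_on (\<lambda>y. merge_pair J a b y x) (Y \<inter> {y. y c = f x c})"
    proof (rule inj_onI)
      fix y z assume y: "y \<in> Y \<inter> {y. y c = f x c}" and z: "z \<in> Y \<inter> {y. y c = f x c}"
        and eq: "merge_pair J a b y x = merge_pair J a b z x"
      have "y a = z a" "y b = z b" using fun_cong[OF eq, of a] fun_cong[OF eq, of b] J by (auto simp: merge_pair_def)
      moreover have "y c = z c" using y z by simp
      moreover have "y \<in> PiE {a, b, c} (\<lambda>j. (\<lambda>x. x j) ` f ` B)" "z \<in> PiE {a, b, c} (\<lambda>j. (\<lambda>x. x j) ` f ` B)"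
        using y z by (auto simp: Y_def cycles_def)
      ultimately show "y = z" by (intro PiE_ext) auto
    qed
    show "(\<lambda>y. merge_pair J a b y x) ` (Y \<inter> {y. y c = f x c}) \<subseteq> agreeing C (J - {a, b}) x"
    proof
      fix u assume "u \<in> (\<lambda>y. merge_pair J a b y x) ` (Y \<inter> {y. y c = f x c})"
      then obtain y where u: "u = merge_pair J a b y x" and y: "y \<in> Y" "y c = f x c" by blast
      have "y a \<in> (\<lambda>x. x a) ` f ` B" "y b \<in> (\<lambda>x. x b) ` f ` B" using y(1) by (auto simp: Y_def cycles_def)
      moreover have "x j \<in> X j" if "x \<in> B" "j \<in> J" for x j using that B(1) by (auto simp: C_def cycles_def)
      ultimately have yX: "y a \<in> X a" "y b \<in> X b" using J f by auto
      have "merge_pair J a b y x \<in> C" unfolding C_def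
      proof (rule merge_pair_in_cycles[OF J _ yX])
        show "x \<in> cycles p J X" using x B(1) by (auto simp: C_def)
        fix i
        have "p dvd (\<Sum>j\<in>{a, b, c}. y j i)" using y(1) by (simp add: Y_def cycles_def)
        hence 1: "p dvd y a i + y b i + neg_mod p (?w x) i" unfolding sum3 y(2) f .
        have "p dvd (\<Sum>j\<in>{a, b, c}. f x j i)" using fV[OF x] unfolding cycles_def by blast
        hence 2: "p dvd x a i + x b i + neg_mod p (?w x) i" unfolding sum3 f .
        show "(y a i + y b i) mod p = (x a i + x b i) mod p" by (rule mod_eq_of_dvd_add[OF 1 2])
      qed
      thus "u \<in> agreeing C (J - {a, b}) x" by (simp add: u agreeing_def merge_pair_def)
    qed
  qed
  hence "real (card Y) \<le> (\<Sum>x\<in>B. real (card (agreeing C (J - {a, b}) x)))"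
    unfolding of_nat_sum[symmetric] of_nat_le_iff .
  finally show ?thesis .
qed

text \<open>The other half of the split. Storing \<open>x a + x b\<close> at index \<open>a\<close>
  and dropping \<open>b\<close> shortens the cycles of \<open>B\<close> and keeps them disjoint. Any
  short cycle on their vertices carries at \<open>a\<close> the sum of some \<open>x\<close> in
  \<open>B\<close>, and its remaining coordinates combine with \<open>x a\<close> and
  \<open>x b\<close> to a cycle of full length.\<close>

lemma sum_agreeing_pair_ge:
  fixes X :: "'j \<Rightarrow> ('i \<Rightarrow> nat) set"
  assumes p: "0 < p" and J: "finite J" "a \<in> J" "b \<in> J" "a \<noteq> b" and I: "finite I"
    and X: "\<And>j. j \<in> J \<Longrightarrow> X j \<subseteq> modvec p I"
  defines "C \<equiv> cycles p J X"
  assumes B: "B \<subseteq> C" "disjoint_cycles J B" "inj_on (pair_sum p a b) B" and c: "c \<in> J" "c \<noteq> a" "c \<noteq> b"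
    and mb: "matching_bound p \<kappa> r \<theta> (J - {b}) I"
  shows "\<kappa> * real (card B) powr (1 + \<theta>) * (real p ^ card I) powr (r - \<theta>) \<le>
    (\<Sum>x\<in>B. real (card (agreeing C {a, b} x)))"
proof -
  have fin: "finite C" unfolding C_def using J(1) I X by (rule finite_cycles)
  have finB: "finite B" using finite_subset[OF B(1) fin] .
  let ?w = "pair_sum p a b" and ?J = "J - {b}"
  define g where "g x = (\<lambda>j\<in>?J. if j = a then ?w x else x j)" for x :: "'j \<Rightarrow> 'i \<Rightarrow> nat"
  have g: "g x a = ?w x" "\<And>j. j \<in> J - {a, b} \<Longrightarrow> g x j = x j" for x using J by (auto simp: g_def)
  have sumJ: "(\<Sum>j\<in>?J. h j) = h a + (\<Sum>j\<in>J-{a,b}. h j)" for h :: "'j \<Rightarrow> nat"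
  proof -
    have "?J - {a} = J - {a, b}" by blast
    thus ?thesis using J by (subst sum.remove[of _ a]) auto
  qed
  have xV: "x j \<in> modvec p I" if "x \<in> B" "j \<in> J" for x j
    using that B X[OF that(2)] by (auto simp: C_def cycles_def)
  have wV: "?w x \<in> modvec p I" if "x \<in> B" for x
    by (rule pair_sum_in_modvec[of p x a I b, OF p xV[OF that J(2)] xV[OF that J(3)]])
  have dis: "x j \<noteq> y j" if "x \<in> B" "y \<in> B" "x \<noteq> y" "j \<in> J" for x y j
    using B(2) that unfolding disjoint_cycles_def by blast
  have injg: "inj_on g B"
  proof (rule inj_onI)
    fix x y assume xy: "x \<in> B" "y \<in> B" "g x = g y"
    hence "?w x = ?w y" using g(1)[of x] g(1)[of y] by simp
    thus "x = y" using inj_onD[OF B(3)] xy by blast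
  qed
  let ?V = "cycles p ?J (\<lambda>_. modvec p I)"
  have gV: "g x \<in> ?V" if "x \<in> B" for x
  proof -
    have "p dvd (\<Sum>j\<in>?J. g x j i)" for i
    proof -
      have "(\<Sum>j\<in>J-{a,b}. g x j i) = (\<Sum>j\<in>J-{a,b}. x j i)" using g(2) by (intro sum.cong) auto
      moreover have "p dvd x a i + x b i + (\<Sum>j\<in>J-{a,b}. x j i)"
        using that B(1) by (auto simp: C_def cycles_def sum_remove_pair[OF J])
      ultimately show ?thesis
        using dvd_add_cong[of "?w x i" p "x a i + x b i"] by (simp add: sumJ g(1) pair_sum_def)
    qed
    moreover have "g x \<in> PiE ?J (\<lambda>_. modvec p I)" using xV[OF that] wV[OF that] by (auto simp: g_def)
    ultimately show ?thesis by (simp add: cycles_def)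
  qed
  have disg: "disjoint_cycles ?J (g ` B)"
    unfolding disjoint_cycles_def
  proof (intro ballI impI)
    fix y z j assume "y \<in> g ` B" "z \<in> g ` B" "y \<noteq> z" and j: "j \<in> ?J"
    then obtain u v where uv: "u \<in> B" "v \<in> B" "y = g u" "z = g v" "u \<noteq> v" by blast
    have "?w u \<noteq> ?w v" using inj_onD[OF B(3)] uv by blast
    moreover have "u j \<noteq> v j" using dis uv j by auto
    ultimately show "y j \<noteq> z j" using j uv by (auto simp: g_def)
  qed
  define Y where "Y = cycles p ?J (\<lambda>j. (\<lambda>x. x j) ` g ` B)"
  have "\<kappa> * real (card (g ` B)) powr (1 + \<theta>) * (real p ^ card I) powr (r - \<theta>) \<le> real (card Y)"
    using mb gV disg unfolding matching_bound_def Y_def by blast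
  also have "card (g ` B) = card B" by (rule card_image[OF injg])
  finally have "\<kappa> * real (card B) powr (1 + \<theta>) * (real p ^ card I) powr (r - \<theta>) \<le> real (card Y)" .
  also have "card Y \<le> (\<Sum>x\<in>B. card (agreeing C {a, b} x))"
  proof (rule card_le_sum_fibers[OF finB, where P = "\<lambda>x. {y. y a = g x a}" and h = "\<lambda>x y. merge_pair J a b x y"])
    show "Y \<subseteq> (\<Union>x\<in>B. {y. y a = g x a})" using J by (auto simp: Y_def cycles_def PiE_def Pi_def)
    show "finite (agreeing C {a, b} x)" for x using fin by (simp add: agreeing_def)
    fix x assume x: "x \<in> B"
    show "inj_on (\<lambda>y. merge_pair J a b x y) (Y \<inter> {y. y a = g x a})"
    proof (rule inj_onI)
      fix y z assume y: "y \<in> Y \<inter> {y. y a = g x a}" and z: "z \<in> Y \<inter> {y. y a = g x a}"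
        and eq: "merge_pair J a b x y = merge_pair J a b x z"
      have "y j = z j" if "j \<in> ?J" for j
        using fun_cong[OF eq, of j] that y z by (cases "j = a") (auto simp: merge_pair_def)
      moreover have "y \<in> PiE ?J (\<lambda>j. (\<lambda>x. x j) ` g ` B)" "z \<in> PiE ?J (\<lambda>j. (\<lambda>x. x j) ` g ` B)"
        using y z by (auto simp: Y_def cycles_def)
      ultimately show "y = z" by (intro PiE_ext) auto
    qed
    show "(\<lambda>y. merge_pair J a b x y) ` (Y \<inter> {y. y a = g x a}) \<subseteq> agreeing C {a, b} x"
    proof
      fix u assume "u \<in> (\<lambda>y. merge_pair J a b x y) ` (Y \<inter> {y. y a = g x a})"
      then obtain y where u: "u = merge_pair J a b x y" and y: "y \<in> Y" "y a = g x a" by blast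
      have xX: "x j \<in> X j" if "x \<in> B" "j \<in> J" for x j using that B(1) by (auto simp: C_def cycles_def)
      have yX: "y j \<in> X j" if "j \<in> J - {a, b}" for j
      proof -
        have "y j \<in> (\<lambda>x. x j) ` g ` B" using y(1) that by (auto simp: Y_def cycles_def)
        thus ?thesis using g(2)[OF that] xX that by auto
      qed
      have "u \<in> PiE J X" using yX xX[OF x] J by (auto simp: u merge_pair_def)
      moreover have "p dvd (\<Sum>j\<in>J. u j i)" for i
      proof -
        have "p dvd (\<Sum>j\<in>?J. y j i)" using y(1) by (simp add: Y_def cycles_def)
        hence 1: "p dvd ?w x i + (\<Sum>j\<in>J-{a,b}. y j i)" unfolding sumJ y(2) g(1) .
        have "(\<Sum>j\<in>J-{a,b}. u j i) = (\<Sum>j\<in>J-{a,b}. y j i)"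
          by (intro sum.cong) (auto simp: u merge_pair_def)
        thus ?thesis using 1 J dvd_add_cong[of "?w x i" p "x a i + x b i"]
          by (simp add: sum_remove_pair[OF J] u merge_pair_def pair_sum_def)
      qed
      ultimately have "u \<in> C" by (simp add: C_def cycles_def)
      thus "u \<in> agreeing C {a, b} x" using J by (simp add: u agreeing_def merge_pair_def)
    qed
  qed
  hence "real (card Y) \<le> (\<Sum>x\<in>B. real (card (agreeing C {a, b} x)))"
    unfolding of_nat_sum[symmetric] of_nat_le_iff .
  finally show ?thesis .
qed

text \<open>A superlinear lower bound for the sums over all subsets forces all but few of the terms to
  be large.\<close>

lemma sum_mult_ge_of_subset_sums:
  fixes f g :: "'a \<Rightarrow> real"
  assumes B: "finite B" and nonneg: "\<And>x. x \<in> B \<Longrightarrow> 0 \<le> f x" "\<And>x. x \<in> B \<Longrightarrow> 0 \<le> g x"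
    and K: "0 \<le> K" "0 \<le> L" and \<alpha>: "0 \<le> \<alpha>" "0 \<le> \<beta>"
    and f: "\<And>B'. B' \<subseteq> B \<Longrightarrow> K * real (card B') powr (1 + \<alpha>) \<le> sum f B'"
    and g: "\<And>B'. B' \<subseteq> B \<Longrightarrow> L * real (card B') powr (1 + \<beta>) \<le> sum g B'"
  defines "m \<equiv> real (card B) / 3"
  shows "m * (K * m powr \<alpha>) * (L * m powr \<beta>) \<le> (\<Sum>x\<in>B. f x * g x)"
proof -
  \<comment> \<open>The set of small terms is itself a subset to which the lower bound applies; with
    more than \<open>m\<close> elements its average would reach the threshold. With at most a third
    of \<open>B\<close> bad for \<open>f\<close> and a third bad for \<open>g\<close>, a third
    remains where both are large.\<close>
  have small: "real (card {x \<in> B. h x < H * m powr \<eta>}) \<le> m"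
    if h: "\<And>B'. B' \<subseteq> B \<Longrightarrow> H * real (card B') powr (1 + \<eta>) \<le> sum h B'" and H: "0 \<le> H" "0 \<le> \<eta>" for h H \<eta>
  proof (rule ccontr)
    let ?S = "{x \<in> B. h x < H * m powr \<eta>}"
    assume "\<not> ?thesis"
    hence gt: "m < real (card ?S)" by simp
    hence "0 < real (card ?S)" unfolding m_def by (meson divide_nonneg_nonneg le_less_trans of_nat_0_le_iff zero_le_numeral)
    hence pos: "0 < card ?S" by simp
    hence "finite ?S" "?S \<noteq> {}" by (auto simp: card_gt_0_iff)
    hence "sum h ?S < (\<Sum>x\<in>?S. H * m powr \<eta>)" by (intro sum_strict_mono) auto
    also have "\<dots> = real (card ?S) * (H * m powr \<eta>)" by simp
    also have "\<dots> \<le> real (card ?S) * (H * real (card ?S) powr \<eta>)"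
      using gt H by (intro mult_left_mono powr_mono2) (auto simp: m_def)
    also have "\<dots> = H * real (card ?S) powr (1 + \<eta>)" using pos by (simp add: powr_add)
    also have "\<dots> \<le> sum h ?S" by (intro h) auto
    finally show False by simp
  qed
  define G where "G = {x \<in> B. K * m powr \<alpha> \<le> f x \<and> L * m powr \<beta> \<le> g x}"
  let ?F = "{x \<in> B. f x < K * m powr \<alpha>}" and ?H = "{x \<in> B. g x < L * m powr \<beta>}"
  have "B = G \<union> ?F \<union> ?H" by (auto simp: G_def)
  hence "card B \<le> card G + card ?F + card ?H"
    by (metis (no_types, lifting) card_Un_le add_le_mono1 order_trans)
  hence "real (card B) \<le> real (card G) + real (card ?F) + real (card ?H)" by simp
  hence "m \<le> real (card G)"
    using small[OF f K(1) \<alpha>(1)] small[OF g K(2) \<alpha>(2)] by (simp add: m_def)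
  hence "m * ((K * m powr \<alpha>) * (L * m powr \<beta>)) \<le> real (card G) * ((K * m powr \<alpha>) * (L * m powr \<beta>))"
    using K by (intro mult_right_mono) auto
  also have "\<dots> = (\<Sum>x\<in>G. (K * m powr \<alpha>) * (L * m powr \<beta>))" by simp
  also have "\<dots> \<le> (\<Sum>x\<in>G. f x * g x)"
    using K nonneg by (intro sum_mono mult_mono) (auto simp: G_def)
  also have "\<dots> \<le> (\<Sum>x\<in>B. f x * g x)"
    using B nonneg by (intro sum_mono2) (auto simp: G_def)
  finally show ?thesis by (simp add: mult.assoc)
qed

section \<open>Induction on the length of the cycles\<close>

text \<open>The cycles with the same pair sum as \<open>x\<close> number \<open>?f x * ?g x\<close>,
  and these classes are disjoint for different \<open>x\<close> in \<open>B\<close> since the sums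
  are distinct. Disjointness and distinct sums pass to subsets of \<open>B\<close>, so both halves
  of the split are bounded on every subset, and the product is large on a third of \<open>B\<close>.
  This is where \<theta>1 and \<theta>2 are added.\<close>

lemma card_cycles_ge_of_distinct_sums:
  fixes X :: "'j \<Rightarrow> ('i \<Rightarrow> nat) set"
  assumes p: "0 < p" and J: "finite J" "a \<in> J" "b \<in> J" "a \<noteq> b" and c: "c \<in> J" "c \<noteq> a" "c \<noteq> b" and I: "finite I"
    and X: "\<And>j. j \<in> J \<Longrightarrow> X j \<subseteq> modvec p I"
  defines "C \<equiv> cycles p J X"
  assumes B: "B \<subseteq> C" "disjoint_cycles J B" "inj_on (pair_sum p a b) B"
    and \<kappa>: "0 \<le> \<kappa>1" "0 \<le> \<kappa>2" and \<theta>: "0 \<le> \<theta>1" "0 \<le> \<theta>2"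
    and mb: "matching_bound p \<kappa>1 r1 \<theta>1 {a, b, c} I" "matching_bound p \<kappa>2 r2 \<theta>2 (J - {b}) I"
  shows "\<kappa>1 * \<kappa>2 * (real (card B) / 3) powr (1 + (\<theta>1 + \<theta>2)) * (real p ^ card I) powr (r1 + r2 - (\<theta>1 + \<theta>2))
    \<le> real (card C)"
proof (cases "card B = 0")
  case True
  thus ?thesis by simp
next
  case False
  let ?N = "real p ^ card I" and ?m = "real (card B) / 3"
  have N: "0 < ?N" using p by simp
  have m: "0 < ?m" using False by simp
  have fin: "finite C" unfolding C_def using J(1) I X by (rule finite_cycles)
  have finB: "finite B" using finite_subset[OF B(1) fin] .
  let ?f = "\<lambda>x. real (card (agreeing C (J - {a, b}) x))" and ?g = "\<lambda>x. real (card (agreeing C {a, b} x))"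
  have sub: "B' \<subseteq> C" "disjoint_cycles J B'" "inj_on (pair_sum p a b) B'" if "B' \<subseteq> B" for B'
    using that B(1,2) inj_on_subset[OF B(3) that] unfolding disjoint_cycles_def by blast+
  have "?m * ((\<kappa>1 * ?N powr (r1 - \<theta>1)) * ?m powr \<theta>1) * ((\<kappa>2 * ?N powr (r2 - \<theta>2)) * ?m powr \<theta>2) \<le> (\<Sum>x\<in>B. ?f x * ?g x)"
  proof (rule sum_mult_ge_of_subset_sums[OF finB])
    fix B' assume B': "B' \<subseteq> B"
    show "\<kappa>1 * ?N powr (r1 - \<theta>1) * real (card B') powr (1 + \<theta>1) \<le> sum ?f B'"
      using sum_agreeing_rest_ge[OF p J c(2,3) I X sub[OF B', unfolded C_def] mb(1)]
      by (simp add: C_def mult_ac)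
    show "\<kappa>2 * ?N powr (r2 - \<theta>2) * real (card B') powr (1 + \<theta>2) \<le> sum ?g B'"
      using sum_agreeing_pair_ge[OF p J I X sub[OF B', unfolded C_def] c mb(2)]
      by (simp add: C_def mult_ac)
  qed (use \<kappa> \<theta> in auto)
  also have "(\<Sum>x\<in>B. ?f x * ?g x) = (\<Sum>x\<in>B. real (card {y \<in> C. pair_sum p a b y = pair_sum p a b x}))"
  proof (rule sum.cong[OF refl])
    fix x assume "x \<in> B"
    hence "x \<in> cycles p J X" using B(1) by (auto simp: C_def)
    from card_pair_sum_class[OF J this] show "?f x * ?g x = real (card {y \<in> C. pair_sum p a b y = pair_sum p a b x})"
      by (simp add: C_def)
  qed
  also have "\<dots> = real (\<Sum>x\<in>B. card {y \<in> C. pair_sum p a b y = pair_sum p a b x})" by simp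
  also have "(\<Sum>x\<in>B. card {y \<in> C. pair_sum p a b y = pair_sum p a b x}) =
      card (\<Union>x\<in>B. {y \<in> C. pair_sum p a b y = pair_sum p a b x})"
    using finB fin B(3) by (intro card_UN_disjoint[symmetric]) (auto dest: inj_onD)
  also have "real \<dots> \<le> real (card C)" using fin by (intro of_nat_mono card_mono) auto
  finally have "?m * ((\<kappa>1 * ?N powr (r1 - \<theta>1)) * ?m powr \<theta>1) * ((\<kappa>2 * ?N powr (r2 - \<theta>2)) * ?m powr \<theta>2) \<le> real (card C)" .
  moreover have "?m powr (1 + (\<theta>1 + \<theta>2)) = ?m * ?m powr \<theta>1 * ?m powr \<theta>2"
    using m by (simp add: powr_add)
  moreover have "?N powr (r1 + r2 - (\<theta>1 + \<theta>2)) = ?N powr (r1 - \<theta>1) * ?N powr (r2 - \<theta>2)"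
    by (simp only: powr_add[symmetric]) (simp add: algebra_simps)
  ultimately show ?thesis by (simp only: mult_ac)
qed

text \<open>At least T / (2 k^3 D) disjoint cycles have distinct pair sums. Inserting this number
  into the count of all cycles gives an inequality with T powr (1 + \<theta>) on the left and T on
  the right; cancelling one T and solving for \<open>D\<close> leaves the degree bound. The 6 is
  this 2 times the 3 lost in the split.\<close>

lemma degree_bound_of_matching_bounds:
  fixes J :: "'j set" and I :: "'i set"
  assumes p: "0 < p" and J: "finite J" "3 \<le> card J" and I: "finite I"
    and \<kappa>: "0 < \<kappa>1" "0 < \<kappa>2" and \<theta>: "0 \<le> \<theta>1" "0 \<le> \<theta>2"
    and mb: "\<And>J'. J' \<subseteq> J \<Longrightarrow> card J' = 3 \<Longrightarrow> matching_bound p \<kappa>1 r1 \<theta>1 J' I"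
      "\<And>b. b \<in> J \<Longrightarrow> matching_bound p \<kappa>2 r2 \<theta>2 (J - {b}) I"
  shows "degree_bound p (\<kappa>1 * \<kappa>2 / (6 * real (card J) ^ 3) powr (1 + (\<theta>1 + \<theta>2))) (r1 + r2) (\<theta>1 + \<theta>2) J I"
  unfolding degree_bound_def
proof (intro allI impI)
  fix X :: "'j \<Rightarrow> ('i \<Rightarrow> nat) set" and D :: real
  define \<theta> where "\<theta> = \<theta>1 + \<theta>2"
  define N where "N = real p ^ card I"
  define k where "k = real (card J)"
  define C where "C = cycles p J X"
  define T where "T = real (card C)"
  have \<theta>0: "0 \<le> \<theta>" using \<theta> by (simp add: \<theta>_def)
  have N: "0 < N" using p by (simp add: N_def)
  have k: "3 \<le> k" using J by (simp add: k_def)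
  assume "\<forall>j\<in>J. X j \<subseteq> modvec p I" and deg: "\<forall>j\<in>J. \<forall>v. real (card {x \<in> cycles p J X. x j = v}) \<le> D"
  hence X: "\<And>j. j \<in> J \<Longrightarrow> X j \<subseteq> modvec p I" by blast
  have fin: "finite C" unfolding C_def using J(1) I X by (rule finite_cycles)
  have "\<kappa>1 * \<kappa>2 / (6 * k ^ 3) powr (1 + \<theta>) * T powr \<theta> * N powr (r1 + r2 - \<theta>) \<le> D powr (1 + \<theta>)"
  proof (cases "C = {}")
    case True
    thus ?thesis by (simp add: T_def)
  next
    case ne: False
    have T: "0 < T" using ne fin by (simp add: T_def card_gt_0_iff)
    obtain j0 where j0: "j0 \<in> J" using J by fastforce
    have D: "1 \<le> D" using degree_ge_1[of p J X j0 D] fin ne deg j0 by (simp add: C_def)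
    have "\<exists>a\<in>J. \<exists>b\<in>J. \<exists>B\<subseteq>C. a \<noteq> b \<and> disjoint_cycles J B \<and> inj_on (pair_sum p a b) B \<and>
        real (card C) / (2 * real (card J) ^ 3 * D) \<le> real (card B)"
      unfolding C_def by (rule ex_disjoint_cycles_distinct_sums[OF J I X]) (use ne deg in \<open>auto simp: C_def\<close>)
    then obtain a b B where ab: "a \<in> J" "b \<in> J" "a \<noteq> b"
      and B: "B \<subseteq> C" "disjoint_cycles J B" "inj_on (pair_sum p a b) B"
      and m: "T / (2 * k ^ 3 * D) \<le> real (card B)"
      unfolding T_def k_def by blast
    have "card (J - {a, b}) > 0" using J ab by (simp add: card_Diff_subset)
    hence "J - {a, b} \<noteq> {}" by (metis card.empty less_irrefl)
    then obtain c where c: "c \<in> J" "c \<noteq> a" "c \<noteq> b" by blast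
    have mb1: "matching_bound p \<kappa>1 r1 \<theta>1 {a, b, c} I" using ab c by (intro mb) auto
    have "\<kappa>1 * \<kappa>2 * (real (card B) / 3) powr (1 + \<theta>) * N powr (r1 + r2 - \<theta>) \<le> T"
      unfolding \<theta>_def N_def T_def C_def
      by (rule card_cycles_ge_of_distinct_sums[OF p J(1) ab c I X B[unfolded C_def] _ _ \<theta> mb1 mb(2)[OF ab(2)]])
         (use \<kappa> in auto)
    moreover have "(T / (6 * k ^ 3 * D)) powr (1 + \<theta>) \<le> (real (card B) / 3) powr (1 + \<theta>)"
    proof (rule powr_mono2)
      have "T / (6 * k ^ 3 * D) = T / (2 * k ^ 3 * D) / 3" by simp
      also have "\<dots> \<le> real (card B) / 3" using m by (rule divide_right_mono) simp
      finally show "T / (6 * k ^ 3 * D) \<le> real (card B) / 3" .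
    qed (use \<theta>0 T k D in auto)
    hence "\<kappa>1 * \<kappa>2 * (T / (6 * k ^ 3 * D)) powr (1 + \<theta>) * N powr (r1 + r2 - \<theta>)
        \<le> \<kappa>1 * \<kappa>2 * (real (card B) / 3) powr (1 + \<theta>) * N powr (r1 + r2 - \<theta>)"
      using \<kappa> by (intro mult_right_mono mult_left_mono) auto
    ultimately have "\<kappa>1 * \<kappa>2 * (T / (6 * k ^ 3 * D)) powr (1 + \<theta>) * N powr (r1 + r2 - \<theta>) \<le> T" by linarith
    moreover have "(T / (6 * k ^ 3 * D)) powr (1 + \<theta>) = T * T powr \<theta> / ((6 * k ^ 3) powr (1 + \<theta>) * D powr (1 + \<theta>))"
    proof -
      have "(T / (6 * k ^ 3 * D)) powr (1 + \<theta>) = T powr (1 + \<theta>) / ((6 * k ^ 3) powr (1 + \<theta>) * D powr (1 + \<theta>))"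
        using T k D by (simp add: powr_divide powr_mult)
      thus ?thesis using T by (simp add: powr_add)
    qed
    ultimately have le: "\<kappa>1 * \<kappa>2 * (T * T powr \<theta> / ((6 * k ^ 3) powr (1 + \<theta>) * D powr (1 + \<theta>))) * N powr (r1 + r2 - \<theta>) \<le> T"
      by simp
    have pos: "0 < D powr (1 + \<theta>)" using D by simp
    have "T * (\<kappa>1 * \<kappa>2 / (6 * k ^ 3) powr (1 + \<theta>) * T powr \<theta> * N powr (r1 + r2 - \<theta>)) =
      \<kappa>1 * \<kappa>2 * (T * T powr \<theta> / ((6 * k ^ 3) powr (1 + \<theta>) * D powr (1 + \<theta>))) * N powr (r1 + r2 - \<theta>) * D powr (1 + \<theta>)"
      using pos by simp
    also have "\<dots> \<le> T * D powr (1 + \<theta>)" using le pos by (intro mult_right_mono) auto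
    finally show ?thesis using T by (simp only: mult_le_cancel_left_pos)
  qed
  thus "\<kappa>1 * \<kappa>2 / (6 * real (card J) ^ 3) powr (1 + (\<theta>1 + \<theta>2)) * real (card (cycles p J X)) powr (\<theta>1 + \<theta>2) *
      (real p ^ card I) powr (r1 + r2 - (\<theta>1 + \<theta>2)) \<le> D powr (1 + (\<theta>1 + \<theta>2))"
    by (simp only: \<theta>_def N_def k_def T_def C_def)
qed

text \<open>The constant is chosen before \<open>J\<close> and \<open>I\<close>: one that varied
  with the dimension could not be removed by Cartesian powers. Each further coordinate contributes
  the parameters 1 and 1 / c of a triangle.\<close>

lemma ex_matching_bound:
  fixes p k :: nat
  assumes p: "prime p" and k: "3 \<le> k"
  shows "\<exists>\<kappa>>0. \<forall>(J::'j set) (I::'i set). finite I \<longrightarrow> card J = k \<longrightarrow>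
    matching_bound p \<kappa> (real k - 2) ((real k - 2) / c_p3 p) J I"
  using k
proof (induction k rule: dec_induct)
  have p1: "0 < p" "1 < p" using p prime_gt_0_nat prime_gt_1_nat by blast+
  define \<theta> where "\<theta> = 1 / c_p3 p"
  have \<theta>: "0 \<le> \<theta>" using c_p3_pos[OF p1(2)] by (simp add: \<theta>_def)
  have base: "\<exists>\<kappa>>0. \<forall>(J::'j set) (I::'i set). finite I \<longrightarrow> card J = 3 \<longrightarrow> matching_bound p \<kappa> 1 \<theta> J I"
  proof -
    obtain \<kappa> where \<kappa>: "0 < \<kappa>" "\<And>(J::'j set) (I::'i set). finite I \<Longrightarrow> card J = 3 \<Longrightarrow> degree_bound p \<kappa> 1 \<theta> J I"
      using degree_bound_3[OF p] unfolding \<theta>_def by blast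
    have "matching_bound p (\<kappa> / (1 + \<theta>) powr (1 + \<theta>)) 1 \<theta> J I" if "finite I" "card J = 3" for J :: "'j set" and I :: "'i set"
    proof (rule matching_bound_of_degree_bound[OF p1(1) _ _ that(1) \<kappa>(1) \<theta> \<kappa>(2)[OF that]])
      show "finite J" using that(2) by (intro card_ge_0_finite) simp
      show "J \<noteq> {}" using that(2) by auto
    qed
    moreover have "0 < \<kappa> / (1 + \<theta>) powr (1 + \<theta>)" using \<kappa> \<theta> by simp
    ultimately show ?thesis by blast
  qed
  show "\<exists>\<kappa>>0. \<forall>(J::'j set) (I::'i set). finite I \<longrightarrow> card J = 3 \<longrightarrow>
      matching_bound p \<kappa> (real 3 - 2) ((real 3 - 2) / c_p3 p) J I"
    using base by (simp add: \<theta>_def)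
  fix k :: nat
  assume k: "3 \<le> k" and IH: "\<exists>\<kappa>>0. \<forall>(J::'j set) (I::'i set). finite I \<longrightarrow> card J = k \<longrightarrow>
    matching_bound p \<kappa> (real k - 2) ((real k - 2) / c_p3 p) J I"
  define \<theta>2 where "\<theta>2 = (real k - 2) / c_p3 p"
  have \<theta>2: "0 \<le> \<theta>2" using k c_p3_pos[OF p1(2)] by (simp add: \<theta>2_def)
  obtain \<kappa>1 where \<kappa>1: "0 < \<kappa>1" "\<And>(J::'j set) (I::'i set). finite I \<Longrightarrow> card J = 3 \<Longrightarrow> matching_bound p \<kappa>1 1 \<theta> J I"
    using base by blast
  obtain \<kappa>2 where \<kappa>2: "0 < \<kappa>2" "\<And>(J::'j set) (I::'i set). finite I \<Longrightarrow> card J = k \<Longrightarrow>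
      matching_bound p \<kappa>2 (real k - 2) \<theta>2 J I"
    using IH unfolding \<theta>2_def by blast
  have r: "1 + (real k - 2) = real (Suc k) - 2" "\<theta> + \<theta>2 = (real (Suc k) - 2) / c_p3 p"
    by (simp_all add: \<theta>_def \<theta>2_def add_divide_distrib[symmetric])
  define \<theta>' where "\<theta>' = \<theta> + \<theta>2"
  define \<kappa> where "\<kappa> = \<kappa>1 * \<kappa>2 / (6 * real (Suc k) ^ 3) powr (1 + \<theta>')"
  have \<kappa>: "0 < \<kappa>" using \<kappa>1 \<kappa>2 by (simp add: \<kappa>_def)
  have "matching_bound p (\<kappa> / (1 + \<theta>') powr (1 + \<theta>')) (real (Suc k) - 2) \<theta>' J I"
    if I: "finite I" and J: "card J = Suc k" for J :: "'j set" and I :: "'i set"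
  proof -
    have finJ: "finite J" using J by (intro card_ge_0_finite) simp
    have "degree_bound p (\<kappa>1 * \<kappa>2 / (6 * real (card J) ^ 3) powr (1 + (\<theta> + \<theta>2))) (1 + (real k - 2)) (\<theta> + \<theta>2) J I"
      using k J I \<kappa>1(1) \<kappa>2(1) \<theta> \<theta>2 p1(1) finJ
      by (intro degree_bound_of_matching_bounds \<kappa>1(2) \<kappa>2(2)) auto
    hence "degree_bound p \<kappa> (real (Suc k) - 2) \<theta>' J I" unfolding r(1) \<kappa>_def \<theta>'_def J .
    thus ?thesis using J \<theta> \<theta>2 by (intro matching_bound_of_degree_bound p1 finJ I \<kappa>) (auto simp: \<theta>'_def)
  qed
  moreover have "0 < \<kappa> / (1 + \<theta>') powr (1 + \<theta>')" using \<kappa> \<theta> \<theta>2 by (simp add: \<theta>'_def add_nonneg_eq_0_iff)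
  ultimately show "\<exists>\<kappa>>0. \<forall>(J::'j set) (I::'i set). finite I \<longrightarrow> card J = Suc k \<longrightarrow>
      matching_bound p \<kappa> (real (Suc k) - 2) ((real (Suc k) - 2) / c_p3 p) J I"
    unfolding \<theta>'_def r(2) by blast
qed

section \<open>Removing the constant\<close>

lemma le_of_power_le:
  fixes Q T \<kappa> :: real
  assumes "0 < \<kappa>" "0 \<le> T" "\<And>l. \<kappa> * Q ^ l \<le> T ^ l"
  shows "Q \<le> T"
proof (rule ccontr)
  assume "\<not> ?thesis"
  hence QT: "T < Q" by simp
  show False
  proof (cases "T = 0")
    case True
    thus False using assms(3)[of 1] assms(1) QT by (simp add: mult_le_0_iff)
  next
    case False
    hence T: "0 < T" using assms by simp
    hence "1 < Q / T" using QT by simp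
    then obtain l where "1 / \<kappa> < (Q / T) ^ l" using real_arch_pow by blast
    hence "T ^ l < \<kappa> * Q ^ l" using T assms(1) by (simp add: power_divide field_simps)
    thus False using assms(3)[of l] by simp
  qed
qed

text \<open>Block \<open>t\<close> of the index set \<open>I \<times> {..<l}\<close> holds the
  \<open>t\<close>-th member of the tuple; the zeros beyond \<open>l\<close> keep the result in
  \<open>modvec\<close>.\<close>

definition tensor :: "'j set \<Rightarrow> nat \<Rightarrow> (nat \<Rightarrow> 'j \<Rightarrow> 'i \<Rightarrow> nat) \<Rightarrow> 'j \<Rightarrow> 'i \<times> nat \<Rightarrow> nat" where
  "tensor J l F = (\<lambda>j\<in>J. \<lambda>(i, t). if t < l then F t j i else 0)"

text \<open>The constant is removed by applying the bound to Cartesian powers of the given sets.\<close>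

lemma matching_bound_tensor:
  fixes I :: "'i set" and J :: "'j set"
  assumes p: "0 < p" and J: "finite J" "J \<noteq> {}" and I: "finite I" and \<kappa>: "0 < \<kappa>"
    and mb: "\<And>I' :: ('i \<times> nat) set. finite I' \<Longrightarrow> matching_bound p \<kappa> r \<theta> J I'"
  shows "matching_bound p 1 r \<theta> J I"
  unfolding matching_bound_def
proof (intro allI impI)
  fix A assume A: "A \<subseteq> cycles p J (\<lambda>_. modvec p I)" and dis: "disjoint_cycles J A"
  define N where "N = real p ^ card I"
  have N: "0 < N" using p by (simp add: N_def)
  define X where "X j = (\<lambda>x. x j) ` A" for j
  have X: "X j \<subseteq> modvec p I" if "j \<in> J" for j using A that by (auto simp: X_def cycles_def)
  define C where "C = cycles p J X"
  have fin: "finite C" unfolding C_def using J(1) I X by (rule finite_cycles)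
  have AC: "A \<subseteq> C" using A by (auto simp: C_def cycles_def X_def PiE_def)
  have finA: "finite A" using finite_subset[OF AC fin] .
  let ?Q = "real (card A) powr (1 + \<theta>) * N powr (r - \<theta>)"
  \<comment> \<open>The empty family is treated apart, since exchanging a natural power with
    \<open>powr\<close> uses a positive base.\<close>
  have powers: "\<kappa> * ?Q ^ l \<le> real (card C) ^ l" if A0: "card A \<noteq> 0" for l
  proof -
    define I' where "I' = I \<times> {..<l}"
    have I': "finite I'" "card I' = card I * l" using I by (simp_all add: I'_def card_cartesian_product)
    define P where "P = PiE {..<l} (\<lambda>_. A)"
    have tens: "tensor J l F j (i, t) = F t j i" if "j \<in> J" "t < l" for F :: "nat \<Rightarrow> 'j \<Rightarrow> 'i \<Rightarrow> nat" and j i t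
      using that by (simp add: tensor_def)
    have tens0: "tensor J l F j (i, t) = 0" if "j \<in> J" "\<not> t < l" for F :: "nat \<Rightarrow> 'j \<Rightarrow> 'i \<Rightarrow> nat" and j i t
      using that by (simp add: tensor_def)
    have FA: "F t \<in> A" if "F \<in> P" "t < l" for F t using that by (auto simp: P_def)
    have Fm: "F t j \<in> modvec p I" if "F \<in> P" "t < l" "j \<in> J" for F t j
      using FA[OF that(1,2)] A that(3) by (auto simp: cycles_def)
    have tV: "tensor J l F \<in> cycles p J (\<lambda>_. modvec p I')" if F: "F \<in> P" for F
    proof -
      have "tensor J l F j \<in> modvec p I'" if j: "j \<in> J" for j
      proof -
        have "tensor J l F j (i, t) < p" if "i \<in> I" "t < l" for i t
          using Fm[OF F that(2) j] that by (simp add: tens[OF j that(2)] modvec_def)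
        moreover have "tensor J l F j (i, t) = 0" if "(i, t) \<notin> I'" for i t
        proof (cases "t < l")
          case True
          thus ?thesis using Fm[OF F True j] that by (simp add: tens[OF j True] modvec_def I'_def)
        next
          case False
          thus ?thesis using tens0[OF j] by simp
        qed
        ultimately show ?thesis by (auto simp: modvec_def I'_def)
      qed
      moreover have "p dvd (\<Sum>j\<in>J. tensor J l F j q)" for q
      proof -
        obtain i t where q: "q = (i, t)" by (cases q)
        show ?thesis
        proof (cases "t < l")
          case True
          have "p dvd (\<Sum>j\<in>J. F t j i)" using FA[OF F True] A by (auto simp: cycles_def)
          thus ?thesis using True by (simp add: q tens)
        next
          case False
          thus ?thesis by (simp add: q tens0)
        qed
      qed
      ultimately show ?thesis by (auto simp: cycles_def tensor_def)
    qed
    have tdiff: "tensor J l F j \<noteq> tensor J l G j" if FG: "F \<in> P" "G \<in> P" "F \<noteq> G" and j: "j \<in> J" for F G j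
    proof -
      have "\<exists>t<l. F t \<noteq> G t" using FG unfolding P_def by (metis PiE_ext lessThan_iff)
      then obtain t where t: "t < l" "F t \<noteq> G t" by blast
      hence "F t j \<noteq> G t j" using dis FA[OF FG(1) t(1)] FA[OF FG(2) t(1)] j unfolding disjoint_cycles_def by blast
      then obtain i where "F t j i \<noteq> G t j i" by auto
      hence "tensor J l F j (i, t) \<noteq> tensor J l G j (i, t)" by (simp add: tens j t)
      thus ?thesis by auto
    qed
    have inj: "inj_on (tensor J l) P"
    proof (rule inj_onI, rule ccontr)
      fix F G assume "F \<in> P" "G \<in> P" "tensor J l F = tensor J l G" "F \<noteq> G"
      thus False using tdiff[of F G] J(2) by auto
    qed
    have "disjoint_cycles J (tensor J l ` P)"
      unfolding disjoint_cycles_def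
    proof (intro ballI impI)
      fix x y j assume "x \<in> tensor J l ` P" "y \<in> tensor J l ` P" "x \<noteq> y" "j \<in> J"
      then obtain F G where "F \<in> P" "G \<in> P" "x = tensor J l F" "y = tensor J l G" "F \<noteq> G" by blast
      thus "x j \<noteq> y j" using tdiff \<open>j \<in> J\<close> by blast
    qed
    moreover have "tensor J l ` P \<subseteq> cycles p J (\<lambda>_. modvec p I')" using tV by blast
    moreover define Y where "Y = cycles p J (\<lambda>j. (\<lambda>x. x j) ` tensor J l ` P)"
    ultimately have "\<kappa> * real (card (tensor J l ` P)) powr (1 + \<theta>) * (real p ^ card I') powr (r - \<theta>) \<le> real (card Y)"
      using mb[OF I'(1)] unfolding matching_bound_def by blast
    moreover have "card (tensor J l ` P) = card A ^ l"
      unfolding card_image[OF inj] by (simp add: P_def card_PiE)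
    moreover have "real p ^ card I' = N ^ l" by (simp add: I' N_def power_mult)
    \<comment> \<open>Every block of a vertex of the power is a vertex of \<open>A\<close>, and zero
      sums are tested blockwise. So a cycle on these vertices is a tuple of \<open>l\<close> cycles
      of \<open>C\<close>, and the number of cycles is at most the \<open>l\<close>-th
      power.\<close>
    moreover have leY: "card Y \<le> card (PiE {..<l} (\<lambda>_. C))"
    proof (rule card_inj_on_le)
      let ?h = "\<lambda>y. \<lambda>t\<in>{..<l}. \<lambda>j\<in>J. \<lambda>i. y j (i, t)"
      have YF: "\<exists>F\<in>P. y j = tensor J l F j" if "y \<in> Y" "j \<in> J" for y j
        using that by (auto simp: Y_def cycles_def PiE_def Pi_def)
      show "inj_on ?h Y"
      proof (rule inj_onI)
        fix y z assume y: "y \<in> Y" and z: "z \<in> Y" and eq: "?h y = ?h z"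
        have "y j = z j" if j: "j \<in> J" for j
        proof
          fix q :: "'i \<times> nat"
          obtain i t where q: "q = (i, t)" by (cases q)
          show "y j q = z j q"
          proof (cases "t < l")
            case True
            have "?h y t j i = ?h z t j i" by (simp only: eq)
            thus ?thesis using True j by (simp add: q)
          next
            case False
            thus ?thesis using YF[OF y j] YF[OF z j] tens0[OF j] by (auto simp: q)
          qed
        qed
        moreover have "y \<in> PiE J (\<lambda>j. (\<lambda>x. x j) ` tensor J l ` P)" "z \<in> PiE J (\<lambda>j. (\<lambda>x. x j) ` tensor J l ` P)"
          using y z by (simp_all add: Y_def cycles_def)
        ultimately show "y = z" by (intro PiE_ext) auto
      qed
      show "?h ` Y \<subseteq> PiE {..<l} (\<lambda>_. C)"
      proof (intro subsetI PiE_I)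
        fix H t assume H: "H \<in> ?h ` Y"
        then obtain y where y: "y \<in> Y" "H = ?h y" by blast
        show "H t = undefined" if "t \<notin> {..<l}" using y that by simp
        assume "t \<in> {..<l}"
        hence t: "t < l" by simp
        have "(\<lambda>i. y j (i, t)) \<in> X j" if j: "j \<in> J" for j
        proof -
          obtain F where F: "F \<in> P" "y j = tensor J l F j" using YF[OF y(1) j] by blast
          have "(\<lambda>i. y j (i, t)) = F t j" using t j by (simp add: F(2) tens)
          thus ?thesis using FA[OF F(1) t] by (auto simp: X_def)
        qed
        moreover have "p dvd (\<Sum>j\<in>J. y j (i, t))" for i using y(1) by (simp add: Y_def cycles_def)
        ultimately show "H t \<in> C" using t by (simp add: y(2) C_def cycles_def)
      qed
      show "finite (PiE {..<l} (\<lambda>_. C))" using fin by (intro finite_PiE) auto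
    qed
    moreover have "(real (card A ^ l)) powr (1 + \<theta>) = (real (card A) powr (1 + \<theta>)) ^ l"
      using A0 by (simp add: powr_realpow[symmetric] powr_powr mult.commute)
    moreover have "(N ^ l) powr (r - \<theta>) = (N powr (r - \<theta>)) ^ l"
      using N by (simp add: powr_realpow[symmetric] powr_powr mult.commute)
    ultimately have "\<kappa> * ?Q ^ l \<le> real (card Y)" by (simp add: power_mult_distrib mult.assoc)
    also have "\<dots> \<le> real (card C ^ l)" using leY by (simp add: card_PiE del: of_nat_power)
    finally show ?thesis by simp
  qed
  have "?Q \<le> real (card C)"
  proof (cases "card A = 0")
    case True
    thus ?thesis by simp
  next
    case False
    show ?thesis by (rule le_of_power_le[OF \<kappa> _ powers[OF False]]) simp
  qed
  thus "1 * real (card A) powr (1 + \<theta>) * (real p ^ card I) powr (r - \<theta>)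
       \<le> real (card (cycles p J (\<lambda>j. (\<lambda>x. x j) ` A)))"
    by (simp add: N_def C_def X_def[abs_def])
qed

section \<open>Maximal disjoint families and cycle removal\<close>

lemma ex_maximal_disjoint_cycles:
  fixes X :: "'j \<Rightarrow> ('i \<Rightarrow> nat) set"
  assumes J: "finite J" "J \<noteq> {}" and I: "finite I" and X: "\<And>j. j \<in> J \<Longrightarrow> X j \<subseteq> modvec p I"
  obtains A where "A \<subseteq> cycles p J X" "disjoint_cycles J A"
    "cycles p J (\<lambda>j. X j - (\<lambda>x. x j) ` A) = {}"
proof -
  let ?C = "cycles p J X"
  have fin: "finite ?C" using J(1) I X by (rule finite_cycles)
  let ?G = "{A. A \<subseteq> ?C \<and> disjoint_cycles J A}"
  have finG: "finite ?G" by (rule finite_subset[of _ "Pow ?C"]) (auto simp: fin)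
  have "{} \<in> ?G" by (simp add: disjoint_cycles_def)
  hence "?G \<noteq> {}" by blast
  from ex_max_on[OF finG this, of card]
  obtain A where A: "A \<in> ?G" "\<forall>B\<in>?G. card B \<le> card A" by blast
  have AC: "A \<subseteq> ?C" "disjoint_cycles J A" using A(1) by simp_all
  have finA: "finite A" using finite_subset[OF AC(1) fin] .
  have False if x: "x \<in> cycles p J (\<lambda>j. X j - (\<lambda>x. x j) ` A)" for x
  proof -
    have xj: "x j \<noteq> y j" if "j \<in> J" "y \<in> A" for j y
    proof -
      have "x j \<in> X j - (\<lambda>x. x j) ` A" using x that(1) by (auto simp: cycles_def)
      thus ?thesis using that(2) by auto
    qed
    have xC: "x \<in> ?C" using x cycles_mono[of J "\<lambda>j. X j - (\<lambda>x. x j) ` A" X p] by blast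
    have "disjoint_cycles J (insert x A)"
      using AC(2) xj xj[symmetric] unfolding disjoint_cycles_def by auto
    hence "card (insert x A) \<le> card A" using A(2) AC(1) xC by simp
    moreover have "x \<notin> A" using xj J(2) by blast
    ultimately show False using finA by simp
  qed
  thus thesis using that[OF AC] by blast
qed

theorem theorem3:
  fixes p k n :: nat and \<epsilon> :: real and X :: "nat \<Rightarrow> (nat \<Rightarrow> nat) set"
  assumes "prime p" and "k \<ge> 3" and "0 < \<epsilon>" and "\<epsilon> < 1" and "n \<ge> 1"
    and "\<forall>j<k. X j \<subseteq> Fpn p n"
  shows "real (card (k_cycles p k X)) \<ge> \<epsilon> powr (C_pk p k) * real (p ^ n) ^ (k - 1)
    \<or> (\<exists>Y. (\<forall>j<k. Y j \<subseteq> X j \<and> real (card (X j - Y j)) < \<epsilon> * real (p ^ n))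
           \<and> k_cycles p k Y = {})"
proof -
  define J I where "J = {..<k}" and "I = {..<n}"
  have k_cycles: "k_cycles p k Z = cycles p J Z" for Z
    by (simp add: k_cycles_def cycles_def sums_to_zero_def J_def dvd_eq_mod_eq_0)
  have "Fpn p n = modvec p I" by (auto simp: Fpn_def modvec_def I_def)
  hence X: "X j \<subseteq> modvec p I" if "j \<in> J" for j using assms(6) that by (simp add: J_def)
  have J: "finite J" "J \<noteq> {}" "card J = k" and I: "finite I" "card I = n"
    using assms(2) by (simp_all add: J_def I_def lessThan_empty_iff)
  have p: "0 < p" "1 < p" using assms(1) prime_gt_0_nat prime_gt_1_nat by blast+
  define N where "N = real p ^ n"
  have N: "0 < N" using p by (simp add: N_def)
  define r \<theta> where "r = real k - 2" and "\<theta> = r / c_p3 p"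
  have \<theta>: "0 \<le> \<theta>" using assms(2) c_p3_pos[OF p(2)] by (simp add: r_def \<theta>_def)
  have C_pk: "C_pk p k = 1 + \<theta>" by (simp add: C_pk_def C_p3_def r_def \<theta>_def)
  \<comment> \<open>The size of one maximal family decides between the alternatives. If it is small,
    deleting its vertices costs at most \<open>card A\<close> elements of each set and, by
    maximality, destroys every cycle; otherwise its size enters the matching bound.\<close>
  obtain A where A: "A \<subseteq> cycles p J X" "disjoint_cycles J A"
    and removed: "cycles p J (\<lambda>j. X j - (\<lambda>x. x j) ` A) = {}"
    by (rule ex_maximal_disjoint_cycles[where p = p and X = X, OF J(1,2) I(1) X])
  have fin: "finite (cycles p J X)" using J(1) I(1) X by (rule finite_cycles)
  have finA: "finite A" using finite_subset[OF A(1) fin] .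
  show ?thesis
  proof (cases "real (card A) < \<epsilon> * N")
    case True
    let ?Y = "\<lambda>j. X j - (\<lambda>x. x j) ` A"
    have "real (card (X j - ?Y j)) < \<epsilon> * N" for j
    proof -
      have "card (X j - ?Y j) \<le> card ((\<lambda>x. x j) ` A)" using finA by (intro card_mono) auto
      also have "\<dots> \<le> card A" by (rule card_image_le[OF finA])
      finally show ?thesis using True by linarith
    qed
    hence "(\<forall>j<k. ?Y j \<subseteq> X j \<and> real (card (X j - ?Y j)) < \<epsilon> * real (p ^ n)) \<and> k_cycles p k ?Y = {}"
      using removed by (auto simp: N_def k_cycles)
    thus ?thesis by (intro disjI2 exI)
  next
    case False
    \<comment> \<open>The bound with a constant is instantiated at index sets of pairs, where the
      Cartesian powers of \<open>I\<close> live.\<close>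
    obtain \<kappa> where \<kappa>: "0 < \<kappa>" "\<And>(J::nat set) (I'::(nat \<times> nat) set). finite I' \<Longrightarrow> card J = k \<Longrightarrow> matching_bound p \<kappa> r \<theta> J I'"
      using ex_matching_bound[OF assms(1,2), folded r_def, folded \<theta>_def] by blast
    have mb: "matching_bound p 1 r \<theta> J I"
      by (rule matching_bound_tensor[OF p(1) J(1,2) I(1) \<kappa>(1)]) (rule \<kappa>(2)[OF _ J(3)])
    \<comment> \<open>As \<open>N ^ (k - 1)\<close> is \<open>N powr (1 + r)\<close>, enough powers
      of \<open>N\<close> are available to pair each factor \<epsilon> with one; the rest is
      \<open>N powr (r - \<theta>)\<close>. This expresses the target through
      \<open>\<epsilon> * N\<close>, the lower bound for \<open>card A\<close>.\<close>
    have "\<epsilon> powr (C_pk p k) * N ^ (k - 1) = (\<epsilon> * N) powr (1 + \<theta>) * N powr (r - \<theta>)"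
    proof -
      have "N ^ (k - 1) = N powr (1 + r)"
        using N assms(2) by (simp add: powr_realpow[symmetric] of_nat_diff r_def)
      also have "\<dots> = N powr (1 + \<theta>) * N powr (r - \<theta>)" by (simp add: powr_add[symmetric])
      finally show ?thesis using assms(3) N by (simp add: C_pk powr_mult)
    qed
    also have "\<dots> \<le> real (card A) powr (1 + \<theta>) * N powr (r - \<theta>)"
      using False assms(3) N \<theta> by (intro mult_right_mono powr_mono2) auto
    also have "\<dots> \<le> real (card (cycles p J (\<lambda>j. (\<lambda>x. x j) ` A)))"
    proof -
      have "A \<subseteq> cycles p J (\<lambda>_. modvec p I)" using A(1) cycles_mono[of J X "\<lambda>_. modvec p I" p] X by blast
      thus ?thesis using mb A(2) I(2) unfolding matching_bound_def N_def by fastforce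
    qed
    also have "\<dots> \<le> real (card (cycles p J X))"
    proof -
      have "cycles p J (\<lambda>j. (\<lambda>x. x j) ` A) \<subseteq> cycles p J X"
        using A(1) by (intro cycles_mono) (auto simp: cycles_def)
      thus ?thesis using card_mono[OF fin] by simp
    qed
    finally show ?thesis by (simp add: k_cycles N_def)
  qed
qed

end
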